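(* Let $T$ be a proper rooted binary tree with $n$ leaves labeled $1,\ldots,n$ in left-to-right order, each internal node $v$ labeled with $q_v\in[\tfrac12,1]$, and let $p_{i,j}=q_{i\vee j}$, $p_{j,i}=1-p_{i,j}$ for $1\le i<j\le n$. Suppose that $\{p_{i,j}\}$ is weakly monotone and that each $p_{i,j}$ is a constant less than $1$ (bounded away from $1$ independently of $n$). Then the mixing time of the nearest neighbor chain $\mathcal{M}_{nn}$ on $S_n$ with these probabilities satisfies $\tau_{nn}(\epsilon)=O(n^9\log(n/\epsilon))$.
   Context: For leaves $i,j$ of $T$, $i\vee j$ denotes their lowest common ancestor. The set $\{p_{i,j}\}$ is weakly monotone if (1) $p_{i,j}\ge 1/2$ for all $1\le i<j\le n$, and either (2) $p_{i,j+1}\ge p_{i,j}$ for all $1\le i<j\le n-1$, or (3) $p_{i-1,j}\ge p_{i,j}$ for all $2\le i<j\le n$. Permutations $\sigma\in S_n$ are lists $\sigma(1),\ldots,\sigma(n)$; the stationary distribution is $\pi(\sigma)=Z^{-1}\prod_{a\text{ before }b\text{ in }\sigma}p_{a,b}$. $\mathcal{M}_{nn}$: from $\sigma_t$, choose $i\in[n-1]$ uniformly at random; with probability $p_{\sigma_t(i+1),\sigma_t(i)}$ swap $\sigma_t(i)$ and $\sigma_t(i+1)$, otherwise stay. Mixing time: $\tau(\epsilon)=\min\{t:\|\mathcal{P}^{t'},\pi\|_{tv}\le\epsilon\ \forall t'\ge t\}$, where $\|\mathcal{P}^t,\pi\|_{tv}=\max_x\frac12\sum_y|\mathcal{P}^t(x,y)-\pi(y)|$.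 The $O(\cdot)$ bound is as $n\to\infty$ with constant independent of $n$ and $\epsilon$. *)

theory Defs
  imports
    "HOL-Probability.Probability_Mass_Function"
    "HOL-Combinatorics.Multiset_Permutations"
    "HOL-Library.Extended_Real"
begin

section \<open>Labelled binary trees\<close>

datatype ltree = Leaf nat | Branch (lft: ltree) (node_label: real) (rgt: ltree)

primrec leaves :: "ltree \<Rightarrow> nat list" where
  "leaves (Leaf i) = [i]"
| "leaves (Branch l q r) = leaves l @ leaves r"

primrec internal_labels :: "ltree \<Rightarrow> real set" where
  "internal_labels (Leaf i) = {}"
| "internal_labels (Branch l q r) = insert q (internal_labels l \<union> internal_labels r)"

primrec subtrees :: "ltree \<Rightarrow> ltree set" where
  "subtrees (Leaf i) = {Leaf i}"
| "subtrees (Branch l q r) = insert (Branch l q r) (subtrees l \<union> subtrees r)"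

text \<open>
  A node is identified with the subtree rooted at it, which is unambiguous whenever the leaf
  labels are distinct. The lowest common ancestor of two leaves is the common ancestor that
  is a descendant of every common ancestor.
\<close>

definition common_ancestors :: "ltree \<Rightarrow> nat \<Rightarrow> nat \<Rightarrow> ltree set" where
  "common_ancestors T i j = {v \<in> subtrees T. i \<in> set (leaves v) \<and> j \<in> set (leaves v)}"

definition lca :: "ltree \<Rightarrow> nat \<Rightarrow> nat \<Rightarrow> ltree" where
  "lca T i j =
     (THE v. v \<in> common_ancestors T i j \<and> (\<forall>u \<in> common_ancestors T i j. v \<in> subtrees u))"

text \<open>The value on the diagonal is irrelevant.\<close>

definition tree_prob :: "ltree \<Rightarrow> nat \<Rightarrow> nat \<Rightarrow> real" where
  "tree_prob T i j =
     (if i < j then node_label (lca T i j) else 1 - node_label (lca T j i))"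

definition weakly_monotone :: "nat \<Rightarrow> (nat \<Rightarrow> nat \<Rightarrow> real) \<Rightarrow> bool" where
  "weakly_monotone n p \<longleftrightarrow>
     (\<forall>i j. 1 \<le> i \<and> i < j \<and> j \<le> n \<longrightarrow> p i j \<ge> 1/2) \<and>
     ((\<forall>i j. 1 \<le> i \<and> i < j \<and> j \<le> n - 1 \<longrightarrow> p i (j + 1) \<ge> p i j) \<or>
      (\<forall>i j. 2 \<le> i \<and> i < j \<and> j \<le> n \<longrightarrow> p (i - 1) j \<ge> p i j))"

section \<open>Markov chains on a finite state space and mixing time\<close>

definition chain_dist :: "('s \<Rightarrow> 's pmf) \<Rightarrow> nat \<Rightarrow> 's \<Rightarrow> 's pmf" where
  "chain_dist K t x = ((\<lambda>\<mu>. bind_pmf \<mu> K) ^^ t) (return_pmf x)"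

definition tv_dist :: "'s set \<Rightarrow> ('s \<Rightarrow> 's pmf) \<Rightarrow> ('s \<Rightarrow> real) \<Rightarrow> nat \<Rightarrow> real" where
  "tv_dist S K \<pi> t = (MAX x\<in>S. 1/2 * (\<Sum>y\<in>S. \<bar>pmf (chain_dist K t x) y - \<pi> y\<bar>))"

text \<open>The mixing time is infinite if the chain never gets (and stays) \<open>\<epsilon>\<close>-close to \<open>\<pi>\<close>.\<close>

definition mixing_time ::
    "'s set \<Rightarrow> ('s \<Rightarrow> 's pmf) \<Rightarrow> ('s \<Rightarrow> real) \<Rightarrow> real \<Rightarrow> enat" where
  "mixing_time S K \<pi> \<epsilon> = Inf {enat t | t. \<forall>t'\<ge>t. tv_dist S K \<pi> t' \<le> \<epsilon>}"

section \<open>The nearest neighbor chain\<close>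

text \<open>
  A permutation is the list of its values, an element of \<^term>\<open>permutations_of_set {1..n}\<close>;
  positions are counted from 0.
\<close>

definition perm_weight :: "(nat \<Rightarrow> nat \<Rightarrow> real) \<Rightarrow> nat list \<Rightarrow> real" where
  "perm_weight p \<sigma> = (\<Prod>k<length \<sigma>. \<Prod>i<k. p (\<sigma> ! i) (\<sigma> ! k))"

definition nn_stationary :: "nat \<Rightarrow> (nat \<Rightarrow> nat \<Rightarrow> real) \<Rightarrow> nat list \<Rightarrow> real" where
  "nn_stationary n p \<sigma> =
     perm_weight p \<sigma> / (\<Sum>\<rho>\<in>permutations_of_set {1..n}. perm_weight p \<rho>)"

definition swap_next :: "nat \<Rightarrow> 'a list \<Rightarrow> 'a list" where
  "swap_next i \<sigma> = \<sigma>[i := \<sigma> ! (i + 1), i + 1 := \<sigma> ! i]"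

text \<open>Meaningful for \<open>n \<ge> 2\<close> only, since a position has to be chosen.\<close>

definition nn_step :: "nat \<Rightarrow> (nat \<Rightarrow> nat \<Rightarrow> real) \<Rightarrow> nat list \<Rightarrow> nat list pmf" where
  "nn_step n p \<sigma> =
     bind_pmf (pmf_of_set {..<n - 1}) (\<lambda>i.
     bind_pmf (bernoulli_pmf (p (\<sigma> ! (i + 1)) (\<sigma> ! i))) (\<lambda>b.
     return_pmf (if b then swap_next i \<sigma> else \<sigma>)))"

definition nn_mixing_time :: "nat \<Rightarrow> (nat \<Rightarrow> nat \<Rightarrow> real) \<Rightarrow> real \<Rightarrow> enat" where
  "nn_mixing_time n p \<epsilon> =
     mixing_time (permutations_of_set {1..n}) (nn_step n p) (nn_stationary n p) \<epsilon>"

end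

theory Submission
  imports Defs
begin

text \<open>
  A permutation of the leaves is a shuffle, at every internal node, of the orders of the left and the
  right subtree, and the weight factorizes accordingly. So the variance tensorizes over the
  internal nodes, and each factor is an asymmetric exclusion process, which satisfies a Poincare
  inequality with constant of order \<open>n\<^sup>2\<close> uniformly in the bias, by a path coupling contraction in a
  height-weighted metric. This bounds the variance by the energy of the exchanges of two entries
  \<open>i < j\<close> with only entries outside \<open>[i, j]\<close> between them.

  Such an exchange is decomposed into nearest neighbor swaps: let \<open>j\<close> jump left over the larger
  entries one at a time (skipping the smaller ones in between), exchange it with \<open>i\<close>, and let \<open>i\<close> jump
  right in the same way. By weak monotonicity no configuration on the way weighs less than the lighter
  end point, and the original permutation can be recovered from the current one together with the two
  positions and the current place in the path. The congestion is therefore of order \<open>n\<^sup>4\<close>.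

  Every update is an orthogonal projection in \<open>L\<^sup>2(\<pi>)\<close>, so one step contracts the variance by
  \<open>1 - 1/K\<close> with \<open>K\<close> of order \<open>n\<^sup>7\<close> without any laziness; the remaining factor \<open>n\<^sup>2\<close> comes from
  \<open>ln (1 / min \<pi>)\<close>.
\<close>

section \<open>Variance and Poincare inequalities for weighted sums\<close>

text \<open>The variance estimate loses nothing with the depth of the tree, because no pair is
  charged twice: \<open>(i, j)\<close> is charged only at the node where the two leaves separate.
  The jumps are forced by the entries between \<open>i\<close> and \<open>j\<close>, which are
  smaller than \<open>i\<close> or larger than \<open>j\<close>. If \<open>j\<close> walked left
  over smaller entries, or \<open>i\<close> right over larger ones, each step could lose a constant
  factor of the weight, and the total loss could be exponential. In a jump only entries larger than
  the skipped block cross it, and every state on the way is reached from one end of the jump by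
  moving such an entry to the right, which gains weight. The constant \<open>K = 16 n^7\<close>
  arises from \<open>n^2 / 2\<close> (exclusion process), \<open>16 n^4\<close> (congestion), 2
  (from \<open>min\<close> of two weights to the flux) and \<open>n - 1 <= n\<close> (choice of the
  position). In the congestion, one \<open>n\<close> is the length of a path, one the number of
  jumps that may use the same position, and \<open>n^2\<close> counts the pairs of
  positions.\<close>

definition wvar :: "'a set \<Rightarrow> ('a \<Rightarrow> real) \<Rightarrow> ('a \<Rightarrow> real) \<Rightarrow> real" where
  "wvar S W f = (\<Sum>x\<in>S. \<Sum>y\<in>S. W x * W y * (f x - f y)\<^sup>2)"

lemma wvar_nonneg: "(\<And>x. x \<in> S \<Longrightarrow> 0 \<le> W x) \<Longrightarrow> 0 \<le> wvar S W f"
  unfolding wvar_def by (intro sum_nonneg mult_nonneg_nonneg) auto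

text \<open>So \<open>wvar\<close> is \<open>2 (sum W S)^2\<close> times the variance under the
  normalized weights. Leaving it unnormalized allows it to be applied directly to the factors of a
  product of weights.\<close>

lemma wvar_eq:
  "wvar S W f = 2 * sum W S * (\<Sum>x\<in>S. W x * (f x)\<^sup>2) - 2 * (\<Sum>x\<in>S. W x * f x)\<^sup>2"
proof -
  have "wvar S W f = (\<Sum>x\<in>S. \<Sum>y\<in>S. (W x * (f x)\<^sup>2) * W y + W x * (W y * (f y)\<^sup>2)
      - 2 * ((W x * f x) * (W y * f y)))"
    unfolding wvar_def by (intro sum.cong refl) (simp add: power2_eq_square algebra_simps)
  also have "\<dots> = 2 * (sum W S * (\<Sum>x\<in>S. W x * (f x)\<^sup>2)) - 2 * (\<Sum>x\<in>S. W x * f x)\<^sup>2"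
    unfolding sum.distrib sum_subtractf sum_distrib_left[symmetric] sum_product[symmetric]
    by (simp add: power2_eq_square sum_distrib_right[symmetric])
  finally show ?thesis by simp
qed

lemma wvar_reindex:
  assumes "bij_betw h S S'" "\<And>x. x \<in> S \<Longrightarrow> W' (h x) = W x"
  shows "wvar S' W' f = wvar S W (\<lambda>x. f (h x))"
proof -
  have "wvar S' W' f = (\<Sum>x\<in>S. \<Sum>y\<in>S. W' (h x) * W' (h y) * (f (h x) - f (h y))\<^sup>2)"
    unfolding wvar_def by (subst sum.reindex_bij_betw[OF assms(1), symmetric])+ simp
  also have "\<dots> = wvar S W (\<lambda>x. f (h x))"
    unfolding wvar_def using assms(2) by (intro sum.cong refl) auto
  finally show ?thesis .
qed

lemma weighted_cauchy_schwarz: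
  fixes u v :: "'a \<Rightarrow> real"
  assumes "\<And>x. x \<in> S \<Longrightarrow> 0 \<le> W x"
  shows "(\<Sum>x\<in>S. W x * u x * v x)\<^sup>2 \<le> (\<Sum>x\<in>S. W x * (u x)\<^sup>2) * (\<Sum>x\<in>S. W x * (v x)\<^sup>2)"
proof -
  have "(\<Sum>x\<in>S. W x * u x * v x) = (\<Sum>x\<in>S. (sqrt (W x) * u x) * (sqrt (W x) * v x))"
  proof (intro sum.cong refl)
    fix x assume "x \<in> S"
    then have "W x = sqrt (W x) * sqrt (W x)" using assms by simp
    then show "W x * u x * v x = sqrt (W x) * u x * (sqrt (W x) * v x)"
      by (metis mult.assoc mult.left_commute)
  qed
  then have "(\<Sum>x\<in>S. W x * u x * v x)\<^sup>2 \<le>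
      (\<Sum>x\<in>S. (sqrt (W x) * u x)\<^sup>2) * (\<Sum>x\<in>S. (sqrt (W x) * v x)\<^sup>2)"
    using Cauchy_Schwarz_ineq_sum[of "\<lambda>x. sqrt (W x) * u x" "\<lambda>x. sqrt (W x) * v x" S] by simp
  also have "\<dots> = (\<Sum>x\<in>S. W x * (u x)\<^sup>2) * (\<Sum>x\<in>S. W x * (v x)\<^sup>2)"
    by (intro arg_cong2[where f = "(*)"] sum.cong refl) (simp_all add: power_mult_distrib assms)
  finally show ?thesis .
qed

lemma sum_square_le:
  fixes u :: "'a \<Rightarrow> real"
  shows "(\<Sum>x\<in>I. u x)\<^sup>2 \<le> card I * (\<Sum>x\<in>I. (u x)\<^sup>2)"
  using weighted_cauchy_schwarz[of I "\<lambda>_. 1" "\<lambda>_. 1" u] by simp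

text \<open>Efron-Stein: the total splits exactly into the mean of the variances in \<open>x\<close>
  and the variance of the unnormalized conditional mean \<open>g\<close>. By Cauchy-Schwarz the
  latter is at most the mean of the variances in \<open>y\<close>.\<close>

lemma wvar_prod_le:
  assumes "\<And>x. x \<in> A \<Longrightarrow> 0 \<le> U x" "\<And>y. y \<in> B \<Longrightarrow> 0 \<le> V y"
  shows "wvar (A \<times> B) (\<lambda>(x, y). U x * V y) f \<le>
     sum V B * (\<Sum>y\<in>B. V y * wvar A U (\<lambda>x. f (x, y))) +
     sum U A * (\<Sum>x\<in>A. U x * wvar B V (\<lambda>y. f (x, y)))"
proof -
  define g where "g y = (\<Sum>x\<in>A. U x * f (x, y))" for y
  define q where "q y = (\<Sum>x\<in>A. U x * (f (x, y))\<^sup>2)" for y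
  have s: "(\<Sum>z\<in>A \<times> B. (case z of (x, y) \<Rightarrow> U x * V y) * F z) = (\<Sum>y\<in>B. V y * (\<Sum>x\<in>A. U x * F (x, y)))"
    for F :: "_ \<Rightarrow> real"
  proof -
    have "(\<Sum>z\<in>A \<times> B. (case z of (x, y) \<Rightarrow> U x * V y) * F z) = (\<Sum>x\<in>A. \<Sum>y\<in>B. U x * V y * F (x, y))"
      by (simp add: sum.cartesian_product case_prod_beta)
    also have "\<dots> = (\<Sum>y\<in>B. \<Sum>x\<in>A. U x * V y * F (x, y))" by (rule sum.swap)
    finally show ?thesis by (simp add: sum_distrib_left mult_ac)
  qed
  have Z: "(\<Sum>z\<in>A \<times> B. (case z of (x, y) \<Rightarrow> U x * V y)) = sum U A * sum V B"
    by (simp add: sum_product sum.cartesian_product)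
  have total: "wvar (A \<times> B) (\<lambda>(x, y). U x * V y) f =
      2 * (sum U A * sum V B) * (\<Sum>y\<in>B. V y * q y) - 2 * (\<Sum>y\<in>B. V y * g y)\<^sup>2"
    unfolding wvar_eq Z s q_def g_def by simp
  have first: "sum V B * (\<Sum>y\<in>B. V y * wvar A U (\<lambda>x. f (x, y))) =
     2 * (sum U A * sum V B) * (\<Sum>y\<in>B. V y * q y) - 2 * sum V B * (\<Sum>y\<in>B. V y * (g y)\<^sup>2)"
  proof -
    have "(\<Sum>y\<in>B. V y * wvar A U (\<lambda>x. f (x, y))) =
        (\<Sum>y\<in>B. 2 * sum U A * (V y * q y) - 2 * (V y * (g y)\<^sup>2))"
      unfolding wvar_eq q_def g_def by (intro sum.cong refl) (simp add: algebra_simps)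
    then show ?thesis
      by (simp add: sum_subtractf right_diff_distrib flip: sum_distrib_left)
  qed
  have "wvar B V g \<le> (\<Sum>y\<in>B. \<Sum>y'\<in>B. V y * V y' * (sum U A * (\<Sum>x\<in>A. U x * (f (x, y) - f (x, y'))\<^sup>2)))"
    unfolding wvar_def
  proof (intro sum_mono mult_left_mono)
    fix y y' assume "y \<in> B" "y' \<in> B"
    have "(g y - g y')\<^sup>2 = (\<Sum>x\<in>A. U x * 1 * (f (x, y) - f (x, y')))\<^sup>2"
      by (simp add: g_def sum_subtractf algebra_simps)
    also have "\<dots> \<le> sum U A * (\<Sum>x\<in>A. U x * (f (x, y) - f (x, y'))\<^sup>2)"
      using weighted_cauchy_schwarz[of A U "\<lambda>_. 1" "\<lambda>x. f (x, y) - f (x, y')"] assms by simp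
    finally show "(g y - g y')\<^sup>2 \<le> sum U A * (\<Sum>x\<in>A. U x * (f (x, y) - f (x, y'))\<^sup>2)" .
  qed (use assms in auto)
  also have "\<dots> = sum U A * (\<Sum>x\<in>A. U x * wvar B V (\<lambda>y. f (x, y)))"
  proof -
    have "(\<Sum>x\<in>A. U x * wvar B V (\<lambda>y. f (x, y))) =
       (\<Sum>x\<in>A. \<Sum>y\<in>B. \<Sum>y'\<in>B. V y * V y' * (U x * (f (x, y) - f (x, y'))\<^sup>2))"
      unfolding wvar_def by (simp add: sum_distrib_left mult_ac)
    also have "\<dots> = (\<Sum>y\<in>B. \<Sum>x\<in>A. \<Sum>y'\<in>B. V y * V y' * (U x * (f (x, y) - f (x, y'))\<^sup>2))"
      by (rule sum.swap)
    also have "\<dots> = (\<Sum>y\<in>B. \<Sum>y'\<in>B. \<Sum>x\<in>A. V y * V y' * (U x * (f (x, y) - f (x, y'))\<^sup>2))"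
      by (intro sum.cong refl sum.swap)
    finally show ?thesis by (simp add: sum_distrib_left mult_ac)
  qed
  finally show ?thesis unfolding total first wvar_eq[of B V g] by simp
qed

text \<open>Log-convexity makes the ratios \<open>a (t + 1) / a t\<close> nondecreasing, so a first
  ratio above \<theta> would persist as geometric growth and overtake the bound.\<close>

lemma iterate_log_convex:
  fixes a :: "nat \<Rightarrow> real"
  assumes nn: "\<And>t. 0 \<le> a t" and conv: "\<And>t. (a (Suc t))\<^sup>2 \<le> a t * a (Suc (Suc t))"
    and bound: "\<And>t. a t \<le> C * \<theta> ^ t" and \<theta>: "0 \<le> \<theta>"
  shows "a 1 \<le> \<theta> * a 0"
proof (rule ccontr)
  assume "\<not> ?thesis"
  then have gt: "\<theta> * a 0 < a 1" by simp
  have a1: "a 1 > 0" using gt mult_nonneg_nonneg[OF \<theta> nn[of 0]] by linarith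
  have a0: "a 0 > 0" using conv[of 0] a1 nn[of 0]
    by (metis One_nat_def mult_zero_left not_less order_le_less zero_less_power)
  define \<rho> where "\<rho> = a 1 / a 0"
  have \<rho>: "\<rho> > \<theta>" "\<rho> > 0" using gt a0 a1 by (simp_all add: \<rho>_def field_simps)
  have pos: "a t > 0 \<and> a (Suc t) \<ge> \<rho> * a t" for t
  proof (induction t)
    case 0 then show ?case using a0 by (simp add: \<rho>_def)
  next
    case (Suc t)
    then have p: "a t > 0" "a (Suc t) > 0" using \<rho> by (auto intro: less_le_trans[OF mult_pos_pos])
    have "\<rho> * a t * a (Suc t) \<le> a (Suc t) * a (Suc t)" using Suc p by (simp add: mult_right_mono)
    also have "\<dots> \<le> a t * a (Suc (Suc t))" using conv[of t] by (simp add: power2_eq_square)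
    finally show ?case using p by (simp add: mult_ac)
  qed
  have low: "\<rho> ^ t * a 0 \<le> a t" for t
  proof (induction t)
    case (Suc t)
    have "\<rho> * (\<rho> ^ t * a 0) \<le> \<rho> * a t" using Suc \<rho> by (intro mult_left_mono) auto
    then show ?case using pos[of t] by (simp add: mult.assoc)
  qed simp
  show False
  proof (cases "\<theta> = 0")
    case True
    then show False using bound[of 1] a1 by simp
  next
    case False
    then have th: "\<theta> > 0" using \<theta> by simp
    have "(\<rho> / \<theta>) ^ t \<le> C / a 0" for t
    proof -
      have "\<rho> ^ t * a 0 \<le> C * \<theta> ^ t" using low[of t] bound[of t] by linarith
      then show ?thesis using th a0 by (simp add: power_divide field_simps)
    qed
    moreover have "\<rho> / \<theta> > 1" using \<rho> th by simp
    ultimately show False using real_arch_pow[of "\<rho> / \<theta>" "C / a 0"] by (meson not_less)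
  qed
qed

text \<open>
  A self-adjoint averaging operator whose iterates forget their initial function at rate \<open>\<theta>\<close>
  contracts the orthogonal complement of the constants at rate \<open>\<theta>\<close>. Log-convexity of
  \<open>t \<mapsto> \<parallel>P\<^sup>t g\<parallel>\<^sup>2\<close> replaces the spectral theorem.
\<close>

lemma poincare_of_contraction:
  fixes S :: "'a set" and P :: "('a \<Rightarrow> real) \<Rightarrow> 'a \<Rightarrow> real"
  assumes fin: "finite S" and W: "\<And>x. x \<in> S \<Longrightarrow> 0 < W x"
    and sa: "\<And>f g. (\<Sum>x\<in>S. W x * f x * P g x) = (\<Sum>x\<in>S. W x * P f x * g x)"
    and const: "\<And>x. x \<in> S \<Longrightarrow> P (\<lambda>_. 1) x = 1"
    and shift: "\<And>g c x. P (\<lambda>y. g y - c) x = P g x - c"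
    and contr: "\<And>g. \<exists>C. \<forall>t. \<forall>x\<in>S. \<forall>y\<in>S. \<bar>(P ^^ t) g x - (P ^^ t) g y\<bar> \<le> C * \<theta> ^ t"
    and \<theta>: "0 \<le> \<theta>"
  shows "(1 - \<theta>) * wvar S W g \<le> 2 * sum W S * (\<Sum>x\<in>S. W x * g x * (g x - P g x))"
proof (cases "S = {}")
  case True then show ?thesis by (simp add: wvar_def)
next
  case False
  have Z: "sum W S > 0" using False fin W by (simp add: sum_pos)
  define c where "c = (\<Sum>x\<in>S. W x * g x) / sum W S"
  define h where "h = (\<lambda>x. g x - c)"
  have mean: "(\<Sum>x\<in>S. W x * (P ^^ t) h x) = 0" for t
  proof (induction t)
    case 0
    have "sum W S * c = (\<Sum>x\<in>S. W x * g x)" using Z by (simp add: c_def)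
    then show ?case by (simp add: h_def right_diff_distrib sum_subtractf flip: sum_distrib_right)
  next
    case (Suc t)
    have "(\<Sum>x\<in>S. W x * (P ^^ Suc t) h x) = (\<Sum>x\<in>S. W x * 1 * P ((P ^^ t) h) x)" by simp
    also have "\<dots> = (\<Sum>x\<in>S. W x * P (\<lambda>_. 1) x * (P ^^ t) h x)" by (rule sa)
    also have "\<dots> = 0" using Suc const by simp
    finally show ?case .
  qed
  define a where "a t = (\<Sum>x\<in>S. W x * ((P ^^ t) h x)\<^sup>2)" for t
  have wv: "wvar S W ((P ^^ t) h) = 2 * sum W S * a t" for t
    unfolding wvar_eq a_def mean by simp
  have a_nn: "0 \<le> a t" for t
    unfolding a_def using W by (intro sum_nonneg mult_nonneg_nonneg) (auto intro: less_imp_le)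
  \<comment> \<open>Self-adjointness moves one \<open>P\<close> to the other factor, which turns the
    squared norm of iterate \<open>t + 1\<close> into the product of iterates \<open>t\<close> and
    \<open>t + 2\<close>; then Cauchy-Schwarz applies.\<close>
  have a_conv: "(a (Suc t))\<^sup>2 \<le> a t * a (Suc (Suc t))" for t
  proof -
    have "a (Suc t) = (\<Sum>x\<in>S. W x * P ((P ^^ t) h) x * (P ^^ Suc t) h x)"
      by (simp add: a_def power2_eq_square mult.assoc)
    also have "\<dots> = (\<Sum>x\<in>S. W x * (P ^^ t) h x * (P ^^ Suc (Suc t)) h x)"
      by (simp add: sa)
    finally show ?thesis
      unfolding a_def using weighted_cauchy_schwarz[of S W "(P ^^ t) h" "(P ^^ Suc (Suc t)) h"] W
      by (simp add: less_imp_le)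
  qed
  obtain C where C: "\<And>t x y. x \<in> S \<Longrightarrow> y \<in> S \<Longrightarrow> \<bar>(P ^^ t) h x - (P ^^ t) h y\<bar> \<le> C * \<theta> ^ t"
    using contr[of h] by blast
  have a_bd: "a t \<le> (sum W S * C\<^sup>2 / 2) * (\<theta>\<^sup>2) ^ t" for t
  proof -
    have "wvar S W ((P ^^ t) h) \<le> (\<Sum>x\<in>S. \<Sum>y\<in>S. W x * W y * (C * \<theta> ^ t)\<^sup>2)"
      unfolding wvar_def
    proof (intro sum_mono mult_left_mono)
      fix x y assume xy: "x \<in> S" "y \<in> S"
      show "((P ^^ t) h x - (P ^^ t) h y)\<^sup>2 \<le> (C * \<theta> ^ t)\<^sup>2"
        using power_mono[OF C[OF xy], of t 2] by simp
    qed (use W in \<open>auto intro: less_imp_le\<close>)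
    also have "\<dots> = sum W S * sum W S * (C * \<theta> ^ t)\<^sup>2"
      by (subst sum_product) (simp add: sum_distrib_right)
    finally have "2 * sum W S * a t \<le> sum W S * sum W S * (C * \<theta> ^ t)\<^sup>2" by (simp add: wv)
    then show ?thesis using Z
      by (simp add: power_mult_distrib field_simps power_mult[symmetric])
  qed
  \<comment> \<open>Since \<open>a\<close> is a squared norm, its rate is the square of \<theta>,
    and a root is taken next.\<close>
  have "a 1 \<le> \<theta>\<^sup>2 * a 0"
    by (rule iterate_log_convex[OF a_nn a_conv a_bd]) simp
  then have "sqrt (a 1) \<le> \<theta> * sqrt (a 0)"
    using \<theta> by (metis abs_of_nonneg real_sqrt_abs real_sqrt_le_mono real_sqrt_mult)
  moreover have "(\<Sum>x\<in>S. W x * h x * P h x) \<le> sqrt (a 0) * sqrt (a 1)"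
  proof -
    have "(\<Sum>x\<in>S. W x * h x * P h x)\<^sup>2 \<le> a 0 * a 1"
      unfolding a_def using weighted_cauchy_schwarz[of S W h "P h"] W by (simp add: less_imp_le)
    then show ?thesis by (metis real_le_rsqrt real_sqrt_mult)
  qed
  ultimately have "(\<Sum>x\<in>S. W x * h x * P h x) \<le> sqrt (a 0) * (\<theta> * sqrt (a 0))"
    using mult_left_mono[of "sqrt (a 1)" "\<theta> * sqrt (a 0)" "sqrt (a 0)"] a_nn[of 0] by simp
  also have "\<dots> = \<theta> * a 0" using a_nn[of 0] by simp
  finally have main: "(\<Sum>x\<in>S. W x * h x * P h x) \<le> \<theta> * a 0" .
  have Ph: "P h x = P g x - c" for x unfolding h_def by (rule shift)
  have mPg: "(\<Sum>x\<in>S. W x * (g x - P g x)) = 0"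
  proof -
    have "(\<Sum>x\<in>S. W x * (g x - P g x)) = (\<Sum>x\<in>S. W x * h x - W x * P h x)"
      by (intro sum.cong refl) (simp add: Ph, simp add: h_def algebra_simps)
    then show ?thesis using mean[of 0] mean[of 1] by (simp add: sum_subtractf)
  qed
  have "(1 - \<theta>) * a 0 \<le> (\<Sum>x\<in>S. W x * h x * (h x - P h x))"
    using main by (simp add: a_def algebra_simps sum_subtractf power2_eq_square)
  also have "\<dots> = (\<Sum>x\<in>S. W x * g x * (g x - P g x)) - c * (\<Sum>x\<in>S. W x * (g x - P g x))"
    unfolding Ph by (simp add: h_def sum_distrib_left algebra_simps flip: sum_subtractf)
  finally have "(1 - \<theta>) * a 0 \<le> (\<Sum>x\<in>S. W x * g x * (g x - P g x))" by (simp add: mPg)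
  moreover have "wvar S W g = wvar S W h" by (simp add: wvar_def h_def)
  ultimately show ?thesis using Z wv[of 0]
    by simp
qed

section \<open>Adjacent random swaps of lists\<close>

text \<open>The recursive form of \<open>perm_weight\<close> (see \<open>perm_weight_eq\<close>); it
  is also used for lists with repeated entries, namely words over \<open>bool\<close>.\<close>

primrec list_weight :: "('a \<Rightarrow> 'a \<Rightarrow> real) \<Rightarrow> 'a list \<Rightarrow> real" where
  "list_weight p [] = 1"
| "list_weight p (x # xs) = (\<Prod>y\<leftarrow>xs. p x y) * list_weight p xs"

lemma list_weight_append:
  "list_weight p (xs @ ys) = list_weight p xs * (\<Prod>x\<leftarrow>xs. \<Prod>y\<leftarrow>ys. p x y) * list_weight p ys"
  by (induction xs) (simp_all add: mult_ac)

lemma prod_list_mset_cong: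
  fixes f :: "'a \<Rightarrow> real"
  shows "mset xs = mset ys \<Longrightarrow> (\<Prod>x\<leftarrow>xs. f x) = (\<Prod>x\<leftarrow>ys. f x)"
  by (metis mset_map prod_mset_prod_list)

lemma list_weight_swap:
  "list_weight p (A @ x # y # R) * p y x = list_weight p (A @ y # x # R) * p x y"
  by (simp add: list_weight_append mult_ac)

lemma list_weight_pos:
  assumes "\<And>x y. x \<in> set xs \<Longrightarrow> y \<in> set xs \<Longrightarrow> x \<noteq> y \<Longrightarrow> 0 < p x y" "distinct xs"
  shows "0 < list_weight p xs"
  using assms
proof (induction xs)
  case (Cons x xs)
  have "0 < (\<Prod>y\<leftarrow>ys. p x y)" if "set ys \<subseteq> set xs" for ys
    using that Cons.prems by (induction ys) (auto intro!: mult_pos_pos)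
  then show ?case using Cons by simp
qed simp

lemma split_adjacent:
  assumes "l + 1 < length xs"
  obtains A R where "xs = A @ xs ! l # xs ! (l + 1) # R" "length A = l"
proof
  show "xs = take l xs @ xs ! l # xs ! (l + 1) # drop (l + 2) xs"
    using assms by (metis Cons_nth_drop_Suc Suc_eq_plus1 Suc_lessD add_2_eq_Suc' append_take_drop_id)
qed (use assms in simp)

lemma swap_next_append: "swap_next (length A) (A @ x # y # R) = A @ y # x # R"
  by (simp add: swap_next_def list_update_append nth_append)

lemma length_swap_next [simp]: "length (swap_next l xs) = length xs"
  by (simp add: swap_next_def)

lemma swap_next_swap_next:
  assumes "l + 1 < length xs" shows "swap_next l (swap_next l xs) = xs"
  using assms by (elim split_adjacent) (metis swap_next_append)

lemma mset_swap_next: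
  assumes "l + 1 < length xs" shows "mset (swap_next l xs) = mset xs"
  using assms by (elim split_adjacent) (metis (no_types, lifting) swap_next_append add_mset_commute mset.simps(2) mset_append)

lemma swap_next_nth:
  assumes "l + 1 < length xs"
  shows "swap_next l xs ! l = xs ! (l + 1)" "swap_next l xs ! (l + 1) = xs ! l"
  using assms by (simp_all add: swap_next_def)

lemma swap_next_same:
  assumes "l + 1 < length xs" "xs ! l = xs ! (l + 1)" shows "swap_next l xs = xs"
  using assms by (simp add: swap_next_def) (metis list_update_id)

section \<open>Updates of one position as operators on functions\<close>

definition heat_bath :: "('a \<Rightarrow> 'a \<Rightarrow> real) \<Rightarrow> nat \<Rightarrow> ('a list \<Rightarrow> real) \<Rightarrow> 'a list \<Rightarrow> real" where
  "heat_bath p l g xs = p (xs ! (l + 1)) (xs ! l) * g (swap_next l xs) +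
     (1 - p (xs ! (l + 1)) (xs ! l)) * g xs"

definition avg_update :: "nat \<Rightarrow> ('a \<Rightarrow> 'a \<Rightarrow> real) \<Rightarrow> ('a list \<Rightarrow> real) \<Rightarrow> 'a list \<Rightarrow> real" where
  "avg_update N p g xs = (\<Sum>l<N - 1. heat_bath p l g xs) / real (N - 1)"

lemma heat_bath_append:
  "heat_bath p (length A) g (A @ x # y # R) = p y x * g (A @ y # x # R) + (1 - p y x) * g (A @ x # y # R)"
  by (simp add: heat_bath_def swap_next_append nth_append)

text \<open>Two instances follow: the words of the exclusion process and the permutations.
  Neighboring letters of a word may coincide, so the conditions on \<open>p\<close> are confined to
  distinct neighbors.\<close>

locale adjacent_swaps =
  fixes S :: "'a list set" and N :: nat and p :: "'a \<Rightarrow> 'a \<Rightarrow> real"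
  assumes finite_states: "finite S"
    and length_states: "xs \<in> S \<Longrightarrow> length xs = N"
    and closed: "xs \<in> S \<Longrightarrow> l + 1 < N \<Longrightarrow> swap_next l xs \<in> S"
    and complementary: "xs \<in> S \<Longrightarrow> l + 1 < N \<Longrightarrow> xs ! l \<noteq> xs ! (l + 1) \<Longrightarrow>
      p (xs ! l) (xs ! (l + 1)) + p (xs ! (l + 1)) (xs ! l) = 1"
    and positive: "xs \<in> S \<Longrightarrow> l + 1 < N \<Longrightarrow> xs ! l \<noteq> xs ! (l + 1) \<Longrightarrow> 0 < p (xs ! l) (xs ! (l + 1))"
    and weight_pos: "xs \<in> S \<Longrightarrow> 0 < list_weight p xs"
    and N2: "2 \<le> N"
begin

abbreviation "W \<equiv> list_weight p"
abbreviation "dirichlet g \<equiv> \<Sum>xs\<in>S. W xs * g xs * (g xs - avg_update N p g xs)"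

lemma detailed_balance:
  assumes "xs \<in> S" "l + 1 < N"
  shows "W xs * p (xs ! (l + 1)) (xs ! l) =
     W (swap_next l xs) * p (swap_next l xs ! (l + 1)) (swap_next l xs ! l)"
proof -
  have len: "l + 1 < length xs" using assms length_states by simp
  obtain A R where A: "xs = A @ xs ! l # xs ! (l + 1) # R" "length A = l"
    using split_adjacent[OF len] by blast
  have "swap_next l xs = A @ xs ! (l + 1) # xs ! l # R"
    using A swap_next_append by metis
  then show ?thesis
    unfolding swap_next_nth[OF len] using A(1) list_weight_swap[of p A "xs ! l" "xs ! (l + 1)" R] by simp
qed

lemma involution:
  assumes "xs \<in> S" "l + 1 < N" shows "swap_next l (swap_next l xs) = xs"
  using assms length_states swap_next_swap_next by metis

lemma sum_swap_next:
  assumes "l + 1 < N" shows "(\<Sum>xs\<in>S. F (swap_next l xs)) = (\<Sum>xs\<in>S. F xs)"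
  by (rule sum.reindex_bij_witness[of _ "swap_next l" "swap_next l"])
     (use assms closed involution in auto)

text \<open>Detailed balance allows the term of each state to be averaged with that of its swap. The
  result is symmetric in \<open>f\<close> and \<open>g\<close>, from which self-adjointness is read
  off.\<close>

lemma sum_heat_bath:
  assumes "l + 1 < N"
  shows "(\<Sum>xs\<in>S. W xs * f xs * (g xs - heat_bath p l g xs)) =
    (\<Sum>xs\<in>S. W xs * p (xs ! (l + 1)) (xs ! l) * ((f xs - f (swap_next l xs)) * (g xs - g (swap_next l xs)))) / 2"
proof -
  define G where "G xs = W xs * p (xs ! (l + 1)) (xs ! l) * (f xs * (g xs - g (swap_next l xs)))" for xs
  have G2: "G (swap_next l xs) =
      W xs * p (xs ! (l + 1)) (xs ! l) * (f (swap_next l xs) * (g (swap_next l xs) - g xs))" if "xs \<in> S" for xs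
    unfolding G_def involution[OF that assms] detailed_balance[OF that assms] by simp
  have "(\<Sum>xs\<in>S. W xs * f xs * (g xs - heat_bath p l g xs)) = sum G S"
    by (intro sum.cong refl) (simp add: G_def heat_bath_def algebra_simps)
  also have "\<dots> = (\<Sum>xs\<in>S. G xs + G (swap_next l xs)) / 2"
    using sum_swap_next[OF assms, of G] by (simp add: sum.distrib)
  also have "\<dots> = (\<Sum>xs\<in>S. W xs * p (xs ! (l + 1)) (xs ! l) *
      ((f xs - f (swap_next l xs)) * (g xs - g (swap_next l xs)))) / 2"
    by (intro arg_cong2[where f = "(/)"] sum.cong refl) (simp add: G2, simp add: G_def algebra_simps)
  finally show ?thesis .
qed

lemma heat_bath_self_adjoint:
  assumes "l + 1 < N"
  shows "(\<Sum>xs\<in>S. W xs * f xs * heat_bath p l g xs) = (\<Sum>xs\<in>S. W xs * heat_bath p l f xs * g xs)"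
proof -
  have "(\<Sum>xs\<in>S. W xs * f xs * (g xs - heat_bath p l g xs)) =
      (\<Sum>xs\<in>S. W xs * g xs * (f xs - heat_bath p l f xs))"
    unfolding sum_heat_bath[OF assms] by (simp add: mult.commute)
  then show ?thesis by (simp add: algebra_simps sum_subtractf)
qed

text \<open>The update resamples the order of two distinct entries regardless of the order found, so
  the updated function takes the same value on both orders.\<close>

lemma heat_bath_idem:
  assumes "l + 1 < N" "xs \<in> S"
  shows "heat_bath p l (heat_bath p l g) xs = heat_bath p l g xs"
proof (cases "xs ! l = xs ! (l + 1)")
  case True
  then show ?thesis using assms length_states swap_next_same[of l xs]
    by (simp add: heat_bath_def algebra_simps)
next
  case False
  have len: "l + 1 < length xs" using assms length_states by simp
  have e: "p (xs ! (l + 1)) (xs ! l) = 1 - p (xs ! l) (xs ! (l + 1))"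
    using complementary[OF assms(2,1) False] by simp
  have "heat_bath p l g (swap_next l xs) = heat_bath p l g xs"
    unfolding heat_bath_def swap_next_nth[OF len] swap_next_swap_next[OF len] e by simp
  then show ?thesis by (subst heat_bath_def) (simp add: algebra_simps)
qed

lemma heat_bath_norm:
  assumes "l + 1 < N"
  shows "(\<Sum>xs\<in>S. W xs * (heat_bath p l g xs)\<^sup>2) = (\<Sum>xs\<in>S. W xs * g xs * heat_bath p l g xs)"
proof -
  have "(\<Sum>xs\<in>S. W xs * g xs * heat_bath p l g xs) =
      (\<Sum>xs\<in>S. W xs * g xs * heat_bath p l (heat_bath p l g) xs)"
    using assms by (simp add: heat_bath_idem)
  also have "\<dots> = (\<Sum>xs\<in>S. W xs * heat_bath p l g xs * heat_bath p l g xs)"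
    by (rule heat_bath_self_adjoint[OF assms])
  finally show ?thesis by (simp add: power2_eq_square mult.assoc)
qed

text \<open>One of the two complementary probabilities is at least 1/2, and by detailed balance the
  flux may be computed from either end. This converts energies weighted with \<open>min\<close>,
  which suit the path argument, into the Dirichlet form.\<close>

lemma flux_ge_min:
  assumes "xs \<in> S" "l + 1 < N" "xs ! l \<noteq> xs ! (l + 1)"
  shows "min (W xs) (W (swap_next l xs)) / 2 \<le> W xs * p (xs ! (l + 1)) (xs ! l)"
proof -
  have len: "l + 1 < length xs" using assms length_states by simp
  define a b where "a = p (xs ! l) (xs ! (l + 1))" and "b = p (xs ! (l + 1)) (xs ! l)"
  have ab: "a + b = 1" "0 < a" using complementary positive assms by (auto simp: a_def b_def)
  have bal: "W xs * b = W (swap_next l xs) * a"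
    using detailed_balance[OF assms(1,2)] unfolding swap_next_nth[OF len] a_def b_def .
  have "0 < W xs" "0 < W (swap_next l xs)" using assms weight_pos closed by auto
  then have "min (W xs) (W (swap_next l xs)) / 2 \<le> W xs * b"
  proof (cases "b \<ge> 1/2")
    case True
    then have "W xs * (1/2) \<le> W xs * b" using \<open>0 < W xs\<close> by (intro mult_left_mono) auto
    then show ?thesis by (simp add: min_def split: if_splits)
  next
    case False
    then have "W (swap_next l xs) * (1/2) \<le> W (swap_next l xs) * a"
      using \<open>0 < W (swap_next l xs)\<close> ab by (intro mult_left_mono) auto
    then show ?thesis using bal by (simp add: min_def split: if_splits)
  qed
  then show ?thesis by (simp add: b_def)
qed

lemma avg_update_self_adjoint:
  "(\<Sum>xs\<in>S. W xs * f xs * avg_update N p g xs) = (\<Sum>xs\<in>S. W xs * avg_update N p f xs * g xs)"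
proof -
  have "(\<Sum>xs\<in>S. W xs * f xs * avg_update N p g xs) =
      (\<Sum>l<N - 1. \<Sum>xs\<in>S. W xs * f xs * heat_bath p l g xs) / real (N - 1)"
    by (subst sum.swap) (simp add: avg_update_def sum_distrib_left sum_divide_distrib)
  also have "\<dots> = (\<Sum>l<N - 1. \<Sum>xs\<in>S. W xs * heat_bath p l f xs * g xs) / real (N - 1)"
    by (intro arg_cong2[where f = "(/)"] sum.cong[OF refl] heat_bath_self_adjoint refl) auto
  also have "\<dots> = (\<Sum>xs\<in>S. W xs * avg_update N p f xs * g xs)"
    by (subst sum.swap) (simp add: avg_update_def sum_distrib_left sum_distrib_right sum_divide_distrib)
  finally show ?thesis .
qed

lemma avg_update_const: "avg_update N p (\<lambda>_. c) xs = c"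
proof -
  have "heat_bath p l (\<lambda>_. c) xs = c" for l by (simp add: heat_bath_def algebra_simps)
  then show ?thesis using N2 by (simp add: avg_update_def)
qed

lemma avg_update_diff: "avg_update N p (\<lambda>y. g y - c) xs = avg_update N p g xs - c"
proof -
  have "heat_bath p l (\<lambda>y. g y - c) xs = heat_bath p l g xs - c" for l
    by (simp add: heat_bath_def algebra_simps)
  then show ?thesis using N2
    by (simp add: avg_update_def sum_subtractf diff_divide_distrib)
qed

text \<open>The factor \<open>N - 1\<close> stems from the choice of the position, the 2 from
  counting each swap from both ends.\<close>

lemma dirichlet_eq:
  "dirichlet g =
   (\<Sum>l<N - 1. \<Sum>xs\<in>S. W xs * p (xs ! (l + 1)) (xs ! l) * (g xs - g (swap_next l xs))\<^sup>2) / (2 * real (N - 1))"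
proof -
  have "g xs - avg_update N p g xs = (\<Sum>l<N - 1. g xs - heat_bath p l g xs) / real (N - 1)" for xs
    using N2 by (simp add: avg_update_def sum_subtractf field_simps)
  then have "dirichlet g =
      (\<Sum>l<N - 1. \<Sum>xs\<in>S. W xs * g xs * (g xs - heat_bath p l g xs)) / real (N - 1)"
    by (subst sum.swap) (simp add: sum_distrib_left sum_divide_distrib)
  also have "\<dots> = (\<Sum>l<N - 1. (\<Sum>xs\<in>S. W xs * p (xs ! (l + 1)) (xs ! l) * (g xs - g (swap_next l xs))\<^sup>2) / 2)
      / real (N - 1)"
    by (intro arg_cong2[where f = "(/)"] sum.cong refl)
       (subst sum_heat_bath, auto simp: power2_eq_square)
  finally show ?thesis by (simp add: sum_divide_distrib)
qed

end

section \<open>The biased exclusion process\<close>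

definition shuffle_words :: "nat \<Rightarrow> nat \<Rightarrow> bool list set" where
  "shuffle_words a b = {w. count_list w True = a \<and> count_list w False = b}"

text \<open>The diagonal value 1 removes pairs of equal letters from \<open>list_weight\<close>.
  What remains is a factor \<open>q\<close> for each True before a False and \<open>1 - q\<close>
  for each False before a True.\<close>

definition shuffle_bias :: "real \<Rightarrow> bool \<Rightarrow> bool \<Rightarrow> real" where
  "shuffle_bias q x y = (if x = y then 1 else if x then q else 1 - q)"

lemma length_eq_counts: "length w = count_list w True + count_list w False"
  by (induction w) auto

lemma finite_shuffle_words: "finite (shuffle_words a b)"
proof (rule finite_subset)
  show "shuffle_words a b \<subseteq> {w. set w \<subseteq> UNIV \<and> length w = a + b}"
    by (auto simp: shuffle_words_def length_eq_counts)
  show "finite {w :: bool list. set w \<subseteq> UNIV \<and> length w = a + b}"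
    by (rule finite_lists_length_eq) simp
qed

lemma list_weight_bias_pos:
  assumes "0 < q" "q < 1" shows "0 < list_weight (shuffle_bias q) w"
proof (induction w)
  case (Cons x w)
  have "0 < (\<Prod>y\<leftarrow>ys. shuffle_bias q x y)" for ys
    using assms by (induction ys) (auto intro!: mult_pos_pos simp: shuffle_bias_def)
  then show ?case using Cons by simp
qed simp

lemma count_list_mset_cong: "mset xs = mset ys \<Longrightarrow> count_list xs x = count_list ys x"
  by (metis count_mset)

lemma count_list_swap_next:
  "l + 1 < length xs \<Longrightarrow> count_list (swap_next l xs) x = count_list xs x"
  by (rule count_list_mset_cong) (rule mset_swap_next)

lemma shuffle_words_adjacent_swaps:
  assumes "0 < q" "q < 1" "2 \<le> a + b"
  shows "adjacent_swaps (shuffle_words a b) (a + b) (shuffle_bias q)"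
proof
  show "xs \<in> shuffle_words a b \<Longrightarrow> length xs = a + b" for xs
    by (simp add: shuffle_words_def length_eq_counts)
  then show "swap_next l xs \<in> shuffle_words a b" if "xs \<in> shuffle_words a b" "l + 1 < a + b" for l xs
    using that by (simp add: shuffle_words_def count_list_swap_next)
  show "0 < list_weight (shuffle_bias q) xs" for xs
    using assms list_weight_bias_pos by blast
qed (use assms finite_shuffle_words in \<open>auto simp: shuffle_bias_def\<close>)

text \<open>
  A word is the step sequence of a lattice path with height \<open>#True - #False\<close>. Two words that differ
  by exchanging the entries after a prefix \<open>A\<close> are at distance \<open>\<phi>(|A| + 1) \<lambda>\<^sup>h\<close>, where \<open>h\<close> is the
  height of \<open>A\<close> and \<open>\<phi> x = x (N - x)\<close>. For \<open>\<lambda> = sqrt ((1 - q) / q)\<close> a new discrepancy created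
  at a neighboring position has, independently of its direction, the expected weight
  \<open>sqrt (q (1 - q)) \<le> 1/2\<close> relative to the old one; so the concavity of \<open>\<phi>\<close> gives a contraction.
\<close>

definition height_weight :: "real \<Rightarrow> bool list \<Rightarrow> real" where
  "height_weight c A = (\<Prod>x\<leftarrow>A. if x then c else 1 / c)"

definition parabola :: "nat \<Rightarrow> nat \<Rightarrow> real" where
  "parabola N x = real x * (real N - real x)"

text \<open>The dual view of path coupling: instead of coupling two copies of the chain, one follows
  the constant \<open>L\<close> of a function under the update. Comparing words at distance one
  exchange suffices, as these connect all words.\<close>

definition lipschitz_word :: "nat \<Rightarrow> nat \<Rightarrow> real \<Rightarrow> real \<Rightarrow> (bool list \<Rightarrow> real) \<Rightarrow> bool" where
  "lipschitz_word a b c L g \<longleftrightarrow> (\<forall>A R. A @ True # False # R \<in> shuffle_words a b \<longrightarrow>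
     \<bar>g (A @ True # False # R) - g (A @ False # True # R)\<bar> \<le>
       L * (height_weight c A * parabola (a + b) (length A + 1)))"

lemma height_weight_pos: "0 < c \<Longrightarrow> 0 < height_weight c A"
  unfolding height_weight_def by (induction A) auto

lemma height_weight_append: "height_weight c (A @ B) = height_weight c A * height_weight c B"
  by (simp add: height_weight_def)

lemma parabola_le: "parabola N x \<le> (real N)\<^sup>2 / 4"
proof -
  have "0 \<le> (real N - 2 * real x)\<^sup>2" by simp
  then show ?thesis by (simp add: parabola_def power2_eq_square algebra_simps)
qed

lemma parabola_second_difference:
  "parabola N x / 2 + parabola N (x + 2) / 2 = parabola N (x + 1) - 1"
  by (simp add: parabola_def field_simps)

lemma lipschitz_wordD:
  assumes "lipschitz_word a b c L g" "A @ x # y # R \<in> shuffle_words a b" "x \<noteq> y"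
  shows "\<bar>g (A @ True # False # R) - g (A @ False # True # R)\<bar> \<le>
     L * (height_weight c A * parabola (a + b) (length A + 1))"
proof -
  have "A @ True # False # R \<in> shuffle_words a b"
    using assms(2,3) by (cases x; cases y) (auto simp: shuffle_words_def)
  then show ?thesis using assms(1) by (simp add: lipschitz_word_def)
qed

text \<open>The arithmetic of an update next to a discrepancy: \<open>u\<close> is the old
  difference, \<open>u'\<close> a second one that arises with probability \<open>s\<close>, and
  \<open>v\<close>, \<open>v'\<close> are the height weights of their prefixes. Since
  \<open>r <= 1/2\<close>, the second one enters with at most half of its parabola value
  \<open>w'\<close>.\<close>

lemma local_discrepancy:
  fixes q L v v' w w' u u' :: real
  assumes a: "\<bar>u\<bar> \<le> L * (v * w)" and b: "\<bar>u'\<bar> \<le> L * (v' * w')" and s: "0 \<le> s" "s * v' = r * v"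
    and r: "r \<le> 1/2" and v: "0 \<le> v" and w': "0 \<le> w'" and L: "0 \<le> L" and e: "\<bar>d\<bar> \<le> \<bar>u\<bar> + s * \<bar>u'\<bar>"
  shows "\<bar>d\<bar> \<le> L * v * (w + w' / 2)"
proof -
  have "s * \<bar>u'\<bar> \<le> s * (L * (v' * w'))" using b s by (intro mult_left_mono) auto
  also have "\<dots> = L * w' * (s * v')" by simp
  also have "\<dots> = r * (L * w' * v)" unfolding s by simp
  also have "\<dots> \<le> 1/2 * (L * w' * v)" using r L w' v by (intro mult_right_mono) auto
  finally show ?thesis using e a by (simp add: algebra_simps)
qed

lemma abs_eq_add_scaled:
  fixes s x y d :: real
  assumes "d = x + s * y" "0 \<le> s" shows "\<bar>d\<bar> \<le> \<bar>x\<bar> + s * \<bar>y\<bar>"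
  using abs_triangle_ineq[of x "s * y"] assms by (simp add: abs_mult)

lemma convex_discrepancy:
  fixes s M u u' v v' :: real
  assumes "\<bar>u - u'\<bar> \<le> M" "\<bar>v - v'\<bar> \<le> M" "0 \<le> s" "s \<le> 1"
  shows "\<bar>(s * u + (1 - s) * v) - (s * u' + (1 - s) * v')\<bar> \<le> M"
proof -
  have "\<bar>s * (u - u') + (1 - s) * (v - v')\<bar> \<le> s * M + (1 - s) * M"
    using assms by (intro order_trans[OF abs_triangle_ineq] add_mono) (auto simp: abs_mult intro!: mult_left_mono)
  then show ?thesis by (simp add: algebra_simps)
qed

section \<open>Contraction of the Lipschitz constant in one step\<close>

locale biased_shuffle =
  fixes a b :: nat and q :: real
  assumes q: "1/2 \<le> q" "q < 1" and ab: "2 \<le> a + b"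
begin

definition c :: real where "c = sqrt ((1 - q) / q)"

lemma c_pos: "0 < c" using q by (simp add: c_def)

lemma bias_height: "q * c = sqrt (q * (1 - q))" "(1 - q) / c = sqrt (q * (1 - q))"
proof -
  have "q * c = sqrt (q\<^sup>2 * ((1 - q) / q))" "(1 - q) / c = sqrt ((1 - q)\<^sup>2 / ((1 - q) / q))"
    unfolding real_sqrt_mult[of "q\<^sup>2"] real_sqrt_divide[of "(1 - q)\<^sup>2"] using q by (simp_all add: c_def)
  moreover have "q\<^sup>2 * ((1 - q) / q) = q * (1 - q)" "(1 - q)\<^sup>2 / ((1 - q) / q) = q * (1 - q)"
    using q by (simp_all add: power2_eq_square)
  ultimately show "q * c = sqrt (q * (1 - q))" "(1 - q) / c = sqrt (q * (1 - q))" by simp_all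
qed

lemma bias_half: "sqrt (q * (1 - q)) \<le> 1/2"
proof -
  have "0 \<le> (q - 1/2)\<^sup>2" by simp
  then have "q * (1 - q) \<le> (1/2)\<^sup>2" by (simp add: power2_eq_square algebra_simps)
  then show ?thesis by (intro real_le_lsqrt) auto
qed

abbreviation "lip \<equiv> lipschitz_word a b c"
abbreviation "om A \<equiv> height_weight c A * parabola (a + b) (length A + 1)"
abbreviation "hb \<equiv> heat_bath (shuffle_bias q)"

lemma prefix_bound: "A @ x # y # R \<in> shuffle_words a b \<Longrightarrow> length A + 2 \<le> a + b"
  using length_eq_counts[of "A @ x # y # R"] by (simp add: shuffle_words_def)

text \<open>An update of exactly the two discrepant letters makes the words agree in distribution;
  one that involves neither of them acts on both words alike; one that involves a single discrepant
  letter keeps the old discrepancy and may create another.\<close>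

lemma heat_bath_discrepancy:
  assumes lip: "lip L g" and L: "0 \<le> L" and mem: "A @ True # False # R \<in> shuffle_words a b"
    and l: "l < a + b - 1"
  shows "\<bar>hb l g (A @ True # False # R) - hb l g (A @ False # True # R)\<bar> \<le>
    L * height_weight c A * ((if l = length A then 0 else parabola (a + b) (length A + 1))
      + (if l = length A + 1 then parabola (a + b) (length A + 2) / 2 else 0)
      + (if l + 1 = length A then parabola (a + b) (length A) / 2 else 0))"
proof -
  let ?\<eta> = "A @ True # False # R" and ?\<eta>' = "A @ False # True # R"
  have len: "length A + length R + 2 = a + b"
    using mem length_eq_counts[of ?\<eta>] by (simp add: shuffle_words_def)
  have base: "\<bar>g ?\<eta> - g ?\<eta>'\<bar> \<le> L * om A" using lipschitz_wordD[OF lip mem] by simp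
  have vA: "0 \<le> height_weight c A" using height_weight_pos[OF c_pos] by (simp add: less_imp_le)
  have par: "0 \<le> parabola (a + b) x" if "x \<le> a + b" for x using that by (simp add: parabola_def)
  consider "l = length A" | "l = length A + 1" | "l + 1 = length A" | "l + 2 \<le> length A" | "length A + 2 \<le> l"
    by linarith
  then show ?thesis
  proof cases
    case 1
    then show ?thesis by (simp add: heat_bath_append shuffle_bias_def)
  next
    case 2
    then obtain x R' where R: "R = x # R'" using l len by (cases R) auto
    \<comment> \<open>Whatever \<open>x\<close> is, in one of the two words it meets an equal
      letter, so only the other word can change. It does so with probability \<open>s\<close>, and
      its two outcomes differ by an exchange after \<open>A @ [x]\<close>, whose height weight has
      the additional factor \<open>d\<close>.\<close>
    define s d where "s = (if x then q else 1 - q)" and "d = (if x then c else 1 / c)"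
    let ?\<alpha> = "(A @ [x]) @ True # False # R'" and ?\<alpha>' = "(A @ [x]) @ False # True # R'"
    have l': "l = length (A @ [True])" "l = length (A @ [False])" using 2 by simp_all
    have mem': "(A @ [x]) @ (\<not> x) # x # R' \<in> shuffle_words a b"
      using mem R by (cases x) (simp_all add: shuffle_words_def)
    have "\<bar>hb l g ?\<eta> - hb l g ?\<eta>'\<bar> \<le> L * height_weight c A *
        (parabola (a + b) (length A + 1) + parabola (a + b) (length A + 2) / 2)"
    proof (rule local_discrepancy[OF base _ _ _ bias_half])
      show "\<bar>g ?\<alpha> - g ?\<alpha>'\<bar> \<le> L * (height_weight c A * d * parabola (a + b) (length A + 2))"
        using lipschitz_wordD[OF lip mem'] by (simp add: height_weight_append height_weight_def d_def)
      show "s * (height_weight c A * d) = sqrt (q * (1 - q)) * height_weight c A"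
        using bias_height by (simp add: s_def d_def mult.commute mult.left_commute[of q])
      have "hb l g ?\<eta> = shuffle_bias q x False * g (A @ True # x # False # R') + (1 - shuffle_bias q x False) * g ?\<eta>"
        unfolding l'(1) R using heat_bath_append[of "shuffle_bias q" "A @ [True]" g False x R'] by simp
      moreover have "hb l g ?\<eta>' = shuffle_bias q x True * g (A @ False # x # True # R') + (1 - shuffle_bias q x True) * g ?\<eta>'"
        unfolding l'(2) R using heat_bath_append[of "shuffle_bias q" "A @ [False]" g True x R'] by simp
      ultimately have "hb l g ?\<eta> - hb l g ?\<eta>' = (g ?\<eta> - g ?\<eta>') + s * (g ?\<alpha> - g ?\<alpha>')"
        using R by (cases x) (simp_all add: s_def shuffle_bias_def algebra_simps)
      from abs_eq_add_scaled[OF this] show "\<bar>hb l g ?\<eta> - hb l g ?\<eta>'\<bar> \<le> \<bar>g ?\<eta> - g ?\<eta>'\<bar> + s * \<bar>g ?\<alpha> - g ?\<alpha>'\<bar>"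
        using q by (simp add: s_def)
    qed (use q vA L par len R in \<open>auto simp: s_def\<close>)
    then show ?thesis using 2 by simp
  next
    case 3
    then obtain B x where A: "A = B @ [x]" by (metis Suc_eq_plus1 length_Suc_conv_rev)
    \<comment> \<open>Now the second discrepancy sits after the shorter prefix \<open>B\<close>,
      whose height weight lacks the factor of \<open>x\<close>; correspondingly the probabilities
      are interchanged.\<close>
    define s where "s = (if x then 1 - q else q)"
    let ?\<alpha> = "B @ True # False # x # R" and ?\<alpha>' = "B @ False # True # x # R"
    have l': "l = length B" using 3 A by simp
    have mem': "B @ x # (\<not> x) # x # R \<in> shuffle_words a b"
      using mem A by (cases x) (simp_all add: shuffle_words_def)
    have "\<bar>hb l g ?\<eta> - hb l g ?\<eta>'\<bar> \<le> L * height_weight c A *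
        (parabola (a + b) (length A + 1) + parabola (a + b) (length A) / 2)"
    proof (rule local_discrepancy[OF base _ _ _ bias_half])
      show "\<bar>g ?\<alpha> - g ?\<alpha>'\<bar> \<le> L * (height_weight c B * parabola (a + b) (length A))"
        using lipschitz_wordD[OF lip mem'] A by simp
      have "s = sqrt (q * (1 - q)) * (if x then c else 1 / c)"
        using bias_height c_pos by (simp add: s_def field_simps)
      then show "s * height_weight c B = sqrt (q * (1 - q)) * height_weight c A"
        unfolding A height_weight_append by (simp add: height_weight_def)
      have "hb l g ?\<eta> = shuffle_bias q True x * g (B @ True # x # False # R) + (1 - shuffle_bias q True x) * g ?\<eta>"
        unfolding l' A using heat_bath_append[of "shuffle_bias q" B g x True "False # R"] by simp
      moreover have "hb l g ?\<eta>' = shuffle_bias q False x * g (B @ False # x # True # R) + (1 - shuffle_bias q False x) * g ?\<eta>'"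
        unfolding l' A using heat_bath_append[of "shuffle_bias q" B g x False "True # R"] by simp
      ultimately have "hb l g ?\<eta> - hb l g ?\<eta>' = (g ?\<eta> - g ?\<eta>') + s * (g ?\<alpha> - g ?\<alpha>')"
        using A by (cases x) (simp_all add: s_def shuffle_bias_def algebra_simps)
      from abs_eq_add_scaled[OF this] show "\<bar>hb l g ?\<eta> - hb l g ?\<eta>'\<bar> \<le> \<bar>g ?\<eta> - g ?\<eta>'\<bar> + s * \<bar>g ?\<alpha> - g ?\<alpha>'\<bar>"
        using q by (simp add: s_def)
    qed (use q vA L par len A in \<open>auto simp: s_def\<close>)
    then show ?thesis using 3 by simp
  next
    case 4
    then have "l + 1 < length A" by simp
    then obtain B x y B' where A: "A = B @ x # y # B'" and l': "l = length B"
      using split_adjacent by (metis (no_types))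
    define A' where "A' = B @ y # x # B'"
    have e: "hb l g (A @ X) = shuffle_bias q y x * g (A' @ X) + (1 - shuffle_bias q y x) * g (A @ X)" for X
      unfolding A A'_def l' using heat_bath_append[of "shuffle_bias q" B g x y "B' @ X"] by simp
    have mem': "A' @ True # False # R \<in> shuffle_words a b"
      using mem unfolding A A'_def shuffle_words_def by auto
    have "height_weight c A' = height_weight c A" "length A' = length A"
      unfolding A A'_def height_weight_def by simp_all
    then have "\<bar>g (A' @ True # False # R) - g (A' @ False # True # R)\<bar> \<le> L * om A"
      using lipschitz_wordD[OF lip mem'] by simp
    from convex_discrepancy[OF this base, of "shuffle_bias q y x"]
    show ?thesis using 4 q unfolding e by (simp add: shuffle_bias_def mult.assoc)
  next
    case 5
    define m where "m = l - (length A + 2)"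
    have "m + 1 < length R" using 5 l len by (simp add: m_def)
    then obtain B x y B' where R: "R = B @ x # y # B'" and l': "m = length B"
      using split_adjacent by (metis (no_types))
    define R' where "R' = B @ y # x # B'"
    have e: "hb l g (A @ u # v # R) = shuffle_bias q y x * g (A @ u # v # R') +
       (1 - shuffle_bias q y x) * g (A @ u # v # R)" for u v
    proof -
      have "l = length (A @ u # v # B)" using 5 l' by (simp add: m_def)
      then show ?thesis
        unfolding R R'_def using heat_bath_append[of "shuffle_bias q" "A @ u # v # B" g x y "B'"] by simp
    qed
    have mem': "A @ True # False # R' \<in> shuffle_words a b"
      using mem unfolding R R'_def shuffle_words_def by auto
    have "\<bar>g (A @ True # False # R') - g (A @ False # True # R')\<bar> \<le> L * om A"
      using lipschitz_wordD[OF lip mem'] by simp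
    from convex_discrepancy[OF this base, of "shuffle_bias q y x"]
    show ?thesis using 5 q unfolding e by (simp add: shuffle_bias_def mult.assoc)
  qed
qed

text \<open>Let \<open>N = a + b\<close>. Summed over all positions, the concavity of
  \<open>parabola\<close> gains 1 (\<open>parabola_second_difference\<close>). Relative to
  \<open>parabola <= N^2 / 4\<close> and averaged over the \<open>N - 1\<close> positions this is
  \<open>4 / (N^2 (N - 1))\<close>.\<close>

definition rate :: real where "rate = 1 - 4 / (real (a + b) ^ 2 * real (a + b - 1))"

lemma lipschitz_avg_update:
  assumes lip: "lip L g" and L: "0 \<le> L"
  shows "lip (rate * L) (avg_update (a + b) (shuffle_bias q) g)"
  unfolding lipschitz_word_def
proof (intro allI impI)
  fix A R assume mem: "A @ True # False # R \<in> shuffle_words a b"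
  let ?N = "a + b" and ?\<eta> = "A @ True # False # R" and ?\<eta>' = "A @ False # True # R"
  let ?M = "real (?N - 1)"
  define k where "k = length A"
  have kN: "k + 2 \<le> ?N" using prefix_bound[OF mem] by (simp add: k_def)
  have M: "0 < ?M" using ab by simp
  have vA: "0 \<le> height_weight c A" using height_weight_pos[OF c_pos] by (simp add: less_imp_le)
  define \<beta> where "\<beta> l = (if l = k then 0 else parabola ?N (k + 1))
      + (if l = k + 1 then parabola ?N (k + 2) / 2 else 0)
      + (if l + 1 = k then parabola ?N k / 2 else 0)" for l
  have "(\<Sum>l<?N - 1. \<beta> l) = (\<Sum>l<?N - 1. parabola ?N (k + 1) - (if l = k then parabola ?N (k + 1) else 0)
      + (if l = k + 1 then parabola ?N (k + 2) / 2 else 0)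
      + (if l + 1 = k then parabola ?N k / 2 else 0))"
    by (intro sum.cong refl) (simp add: \<beta>_def)
  also have "\<dots> \<le> ?M * parabola ?N (k + 1) - parabola ?N (k + 1) + parabola ?N (k + 2) / 2 + parabola ?N k / 2"
  proof -
    \<comment> \<open>At an end of the word one neighboring position is missing. As
      \<open>parabola\<close> vanishes at 0 and at \<open>N\<close>, the bound also covers that
      case.\<close>
    have "(\<Sum>l<?N - 1. if l + 1 = k then parabola ?N k / 2 else 0) \<le> parabola ?N k / 2"
    proof (cases k)
      case 0 then show ?thesis by (simp add: parabola_def)
    next
      case (Suc k')
      then show ?thesis using kN by (simp add: sum.delta)
    qed
    moreover have "(\<Sum>l<?N - 1. if l = k + 1 then parabola ?N (k + 2) / 2 else 0) \<le> parabola ?N (k + 2) / 2"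
      using kN by (simp add: sum.delta parabola_def)
    moreover have "(\<Sum>l<?N - 1. if l = k then parabola ?N (k + 1) else 0) = parabola ?N (k + 1)"
      using kN by (simp add: sum.delta)
    ultimately show ?thesis by (simp add: sum.distrib sum_subtractf)
  qed
  also have "\<dots> = ?M * parabola ?N (k + 1) - 1"
    using parabola_second_difference[of ?N k] by simp
  also have "\<dots> \<le> ?M * parabola ?N (k + 1) - 4 * parabola ?N (k + 1) / real ?N ^ 2"
    using parabola_le[of ?N "k + 1"] ab by (simp add: field_simps)
  also have "\<dots> = ?M * (rate * parabola ?N (k + 1))"
  proof -
    have "m * x - 4 * x / n ^ 2 = m * ((1 - 4 / (n ^ 2 * m)) * x)" if "0 < m" "0 < n" for m n x :: real
      using that by (simp add: field_simps)
    then show ?thesis unfolding rate_def using M ab by simp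
  qed
  finally have \<beta>: "(\<Sum>l<?N - 1. \<beta> l) \<le> ?M * (rate * parabola ?N (k + 1))" .
  have "\<bar>\<Sum>l<?N - 1. hb l g ?\<eta> - hb l g ?\<eta>'\<bar> \<le> (\<Sum>l<?N - 1. L * height_weight c A * \<beta> l)"
    unfolding \<beta>_def k_def
    by (intro order_trans[OF sum_abs] sum_mono heat_bath_discrepancy[OF lip L mem]) simp
  also have "\<dots> = L * height_weight c A * (\<Sum>l<?N - 1. \<beta> l)" by (simp add: sum_distrib_left)
  also have "\<dots> \<le> L * height_weight c A * (?M * (rate * parabola ?N (k + 1)))"
    using \<beta> L vA by (intro mult_left_mono) auto
  finally have "\<bar>\<Sum>l<?N - 1. hb l g ?\<eta> - hb l g ?\<eta>'\<bar> / ?M \<le> rate * L * om A"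
    using M by (simp add: field_simps k_def)
  moreover have "avg_update ?N (shuffle_bias q) g ?\<eta> - avg_update ?N (shuffle_bias q) g ?\<eta>' =
     (\<Sum>l<?N - 1. hb l g ?\<eta> - hb l g ?\<eta>') / ?M"
    by (simp add: avg_update_def sum_subtractf diff_divide_distrib)
  ultimately show "\<bar>avg_update ?N (shuffle_bias q) g ?\<eta> - avg_update ?N (shuffle_bias q) g ?\<eta>'\<bar> \<le> rate * L * om A"
    using M by (simp add: abs_divide)
qed

lemma rate_nonneg: "0 \<le> rate"
proof -
  have "2 ^ 2 * 1 \<le> real (a + b) ^ 2 * real (a + b - 1)"
    using ab by (intro mult_mono power_mono) auto
  then show ?thesis using ab by (simp add: rate_def field_simps)
qed

section \<open>From Lipschitz constants to oscillation and the Poincare inequality\<close>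

lemma move_to_back:
  "A @ False # replicate i True @ R \<in> shuffle_words a b \<Longrightarrow>
   \<exists>C\<ge>0. \<forall>g L. lip L g \<longrightarrow> \<bar>g (A @ False # replicate i True @ R) - g (A @ replicate i True @ False # R)\<bar> \<le> C * L"
proof (induction i arbitrary: A)
  case 0 then show ?case by (intro exI[of _ 0]) simp
next
  case (Suc i)
  have "(A @ [True]) @ False # replicate i True @ R \<in> shuffle_words a b"
    using Suc.prems by (simp add: shuffle_words_def)
  from Suc.IH[OF this] obtain C where C: "C \<ge> 0" "\<And>g L. lip L g \<Longrightarrow>
      \<bar>g (A @ True # False # replicate i True @ R) - g (A @ True # replicate i True @ False # R)\<bar> \<le> C * L"
    by auto
  have mem: "A @ True # False # replicate i True @ R \<in> shuffle_words a b"
    using Suc.prems by (simp add: shuffle_words_def)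
  have om: "0 \<le> om A"
    using prefix_bound[OF mem] height_weight_pos[OF c_pos, of A] by (simp add: parabola_def)
  show ?case
  proof (intro exI[of _ "C + om A"] conjI allI impI)
    fix g L assume lip: "lip L g"
    show "\<bar>g (A @ False # replicate (Suc i) True @ R) - g (A @ replicate (Suc i) True @ False # R)\<bar>
        \<le> (C + om A) * L"
      using C(2)[OF lip] lipschitz_wordD[OF lip mem] by (simp add: algebra_simps)
  qed (use C om in simp)
qed

lemma sort_word:
  "A @ w \<in> shuffle_words a b \<Longrightarrow> \<exists>C\<ge>0. \<forall>g L. lip L g \<longrightarrow>
   \<bar>g (A @ w) - g (A @ replicate (count_list w True) True @ replicate (count_list w False) False)\<bar> \<le> C * L"
proof (induction w arbitrary: A)
  case Nil then show ?case by (intro exI[of _ 0]) simp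
next
  case (Cons x w)
  have "(A @ [x]) @ w \<in> shuffle_words a b" using Cons.prems by simp
  from Cons.IH[OF this] obtain C where C: "C \<ge> 0" "\<And>g L. lip L g \<Longrightarrow>
    \<bar>g (A @ x # w) - g (A @ x # replicate (count_list w True) True @ replicate (count_list w False) False)\<bar> \<le> C * L"
    by auto
  show ?case
  proof (cases x)
    case True
    then show ?thesis using C by auto
  next
    case False
    have cr: "count_list (replicate i y) x = (if x = y then i else 0)" for i :: nat and x y :: bool
      by (induction i) auto
    have "A @ False # replicate (count_list w True) True @ replicate (count_list w False) False \<in> shuffle_words a b"
      using Cons.prems False by (simp add: shuffle_words_def cr)
    from move_to_back[OF this] obtain C' where C': "C' \<ge> 0" "\<And>g L. lip L g \<Longrightarrow>
      \<bar>g (A @ False # replicate (count_list w True) True @ replicate (count_list w False) False)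
        - g (A @ replicate (count_list w True) True @ False # replicate (count_list w False) False)\<bar> \<le> C' * L"
      by auto
    show ?thesis
    proof (intro exI[of _ "C + C'"] conjI allI impI)
      fix g L assume lip: "lip L g"
      show "\<bar>g (A @ x # w) - g (A @ replicate (count_list (x # w) True) True @ replicate (count_list (x # w) False) False)\<bar>
        \<le> (C + C') * L"
        using C(2)[OF lip] C'(2)[OF lip] False by (simp add: algebra_simps)
    qed (use C C' in simp)
  qed
qed

text \<open>Both words are sorted by adjacent exchanges. Any finite \<open>C\<close> will do, since
  \<open>poincare_of_contraction\<close> retains only the exponential rate.\<close>

lemma lipschitz_oscillation:
  "\<exists>C. \<forall>g L. lip L g \<longrightarrow> (\<forall>x\<in>shuffle_words a b. \<forall>y\<in>shuffle_words a b. \<bar>g x - g y\<bar> \<le> C * L)"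
proof -
  let ?S = "shuffle_words a b" and ?z = "replicate a True @ replicate b False"
  have "\<forall>w\<in>?S. \<exists>C. C \<ge> 0 \<and> (\<forall>g L. lip L g \<longrightarrow> \<bar>g w - g ?z\<bar> \<le> C * L)"
    using sort_word[of "[]"] by (auto simp: shuffle_words_def)
  then obtain C where C: "\<And>w. w \<in> ?S \<Longrightarrow> C w \<ge> 0"
      "\<And>w g L. w \<in> ?S \<Longrightarrow> lip L g \<Longrightarrow> \<bar>g w - g ?z\<bar> \<le> C w * L"
    by metis
  show ?thesis
  proof (intro exI[of _ "2 * sum C ?S"] allI impI ballI)
    fix g L x y assume lip: "lip L g" and xy: "x \<in> ?S" "y \<in> ?S"
    have L: "0 \<le> C w * L" if "w \<in> ?S" for w using C(2)[OF that lip] by linarith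
    have le: "C w * L \<le> sum C ?S * L" if "w \<in> ?S" for w
      unfolding sum_distrib_right using that L finite_shuffle_words
      by (intro member_le_sum) auto
    show "\<bar>g x - g y\<bar> \<le> 2 * sum C ?S * L"
      using C(2)[OF xy(1) lip] C(2)[OF xy(2) lip] le[OF xy(1)] le[OF xy(2)] by simp
  qed
qed

lemma lipschitz_exists: "\<exists>L\<ge>0. lip L g"
proof -
  let ?S = "shuffle_words a b"
  \<comment> \<open>The sum of all difference quotients, as a crude bound for the largest of
    them.\<close>
  define L where "L = (\<Sum>xs\<in>?S. \<Sum>k<a + b. \<bar>g xs - g (swap_next k xs)\<bar> / \<bar>om (take k xs)\<bar>)"
  have "lip L g" unfolding lipschitz_word_def
  proof (intro allI impI)
    fix A R assume mem: "A @ True # False # R \<in> ?S"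
    let ?\<eta> = "A @ True # False # R"
    have k: "length A < a + b" using prefix_bound[OF mem] by simp
    have om: "0 < om A"
      using prefix_bound[OF mem] height_weight_pos[OF c_pos, of A] by (simp add: parabola_def)
    have "\<bar>g ?\<eta> - g (swap_next (length A) ?\<eta>)\<bar> / \<bar>om (take (length A) ?\<eta>)\<bar> \<le>
        (\<Sum>k<a + b. \<bar>g ?\<eta> - g (swap_next k ?\<eta>)\<bar> / \<bar>om (take k ?\<eta>)\<bar>)"
      using k by (intro member_le_sum) auto
    also have "\<dots> \<le> L" unfolding L_def using mem finite_shuffle_words
      by (intro member_le_sum[where f = "\<lambda>xs. \<Sum>k<a + b. \<bar>g xs - g (swap_next k xs)\<bar> / \<bar>om (take k xs)\<bar>"])
         (auto intro!: sum_nonneg)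
    finally show "\<bar>g ?\<eta> - g (A @ False # True # R)\<bar> \<le> L * om A"
      using om by (simp add: swap_next_append field_simps)
  qed
  moreover have "0 \<le> L" unfolding L_def by (intro sum_nonneg) auto
  ultimately show ?thesis by blast
qed

lemma iterates_oscillation:
  "\<exists>C. \<forall>t. \<forall>x\<in>shuffle_words a b. \<forall>y\<in>shuffle_words a b.
    \<bar>(avg_update (a + b) (shuffle_bias q) ^^ t) g x - (avg_update (a + b) (shuffle_bias q) ^^ t) g y\<bar> \<le> C * rate ^ t"
proof -
  obtain L where L: "L \<ge> 0" "lip L g" using lipschitz_exists by blast
  have it: "lip (rate ^ t * L) ((avg_update (a + b) (shuffle_bias q) ^^ t) g)" for t
  proof (induction t)
    case (Suc t)
    show ?case using lipschitz_avg_update[OF Suc] L rate_nonneg by (simp add: mult.assoc)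
  qed (use L in simp)
  obtain C where C: "\<And>g L x y. lip L g \<Longrightarrow> x \<in> shuffle_words a b \<Longrightarrow> y \<in> shuffle_words a b \<Longrightarrow> \<bar>g x - g y\<bar> \<le> C * L"
    using lipschitz_oscillation by blast
  show ?thesis using C[OF it] by (intro exI[of _ "C * L"]) (auto simp: mult_ac)
qed

text \<open>The \<open>N - 1\<close> in the denominator of the gap \<open>1 - rate\<close> cancels
  against that of \<open>dirichlet_eq\<close>, which leaves the order \<open>N^2\<close>. Each swap
  is kept once, seen from the word with True first, and is weighted with its lighter end, in
  accordance with the \<open>min\<close> in \<open>pair_energy\<close>.\<close>

lemma shuffle_poincare:
  fixes g :: "bool list \<Rightarrow> real"
  defines "S \<equiv> shuffle_words a b" and "V \<equiv> list_weight (shuffle_bias q)"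
  shows "wvar S V g \<le> 2 * (real (a + b) ^ 2 / 4) * sum V S *
     (\<Sum>l<a + b - 1. \<Sum>w | w \<in> S \<and> w ! l \<and> \<not> w ! (l + 1). V (swap_next l w) * (g w - g (swap_next l w))\<^sup>2)"
proof -
  interpret adjacent_swaps "shuffle_words a b" "a + b" "shuffle_bias q"
    using shuffle_words_adjacent_swaps q ab by simp
  let ?P = "avg_update (a + b) (shuffle_bias q)" and ?N = "real (a + b)" and ?M = "real (a + b - 1)"
  define D where "D l = (\<Sum>w\<in>S. V w * shuffle_bias q (w ! (l + 1)) (w ! l) * (g w - g (swap_next l w))\<^sup>2)" for l
  define E where "E l = (\<Sum>w | w \<in> S \<and> w ! l \<and> \<not> w ! (l + 1). V (swap_next l w) * (g w - g (swap_next l w))\<^sup>2)" for l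
  have pos: "0 < ?N" "0 < ?M" using ab by auto
  have Vpos: "0 < V w" for w unfolding V_def using list_weight_bias_pos q by simp
  have "(1 - rate) * wvar S V g \<le> 2 * sum V S * (\<Sum>x\<in>S. V x * g x * (g x - ?P g x))"
    unfolding S_def V_def
    by (intro poincare_of_contraction[OF finite_states weight_pos avg_update_self_adjoint
          avg_update_const avg_update_diff iterates_oscillation rate_nonneg])
  also have "\<dots> = 2 * sum V S * ((\<Sum>l<a + b - 1. D l) / (2 * ?M))"
    unfolding S_def V_def dirichlet_eq D_def by simp
  finally have main: "(1 - rate) * wvar S V g \<le> 2 * sum V S * ((\<Sum>l<a + b - 1. D l) / (2 * ?M))" .
  have "wvar S V g \<le> 2 * (?N ^ 2 / 4) * sum V S * (\<Sum>l<a + b - 1. D l / 2)"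
  proof -
    have "w \<le> 2 * (n ^ 2 / 4) * Z * (d / 2)"
      if "(1 - (1 - 4 / (n ^ 2 * m))) * w \<le> 2 * Z * (d / (2 * m))" "0 < m" "0 < n" for w Z d m n :: real
      using that by (simp add: field_simps)
    from this[OF main[unfolded rate_def] pos(2,1)] show ?thesis
      by (simp add: sum_divide_distrib)
  qed
  also have "\<dots> \<le> 2 * (?N ^ 2 / 4) * sum V S * (\<Sum>l<a + b - 1. E l)"
  proof (intro mult_left_mono sum_mono)
    fix l assume "l \<in> {..<a + b - 1}"
    then have l: "l + 1 < a + b" by simp
    define h where "h w = V w * shuffle_bias q (w ! (l + 1)) (w ! l) * (g w - g (swap_next l w))\<^sup>2" for w
    have len: "l + 1 < length w" if "w \<in> S" for w using that l length_states by (simp add: S_def)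
    have hs: "h (swap_next l w) = h w" if "w \<in> S" for w
      using detailed_balance[of w l] involution[of w l] that l
      by (simp add: h_def S_def V_def power2_commute)
    have hle: "h w \<le> V (swap_next l w) * (g w - g (swap_next l w))\<^sup>2" if "w \<in> S" "w ! l" "\<not> w ! (l + 1)" for w
    proof -
      have "V w * shuffle_bias q (w ! (l + 1)) (w ! l) = V (swap_next l w) * q"
        using detailed_balance[of w l] that l
        unfolding swap_next_nth[OF len[OF that(1)]] by (simp add: S_def V_def shuffle_bias_def)
      also have "\<dots> \<le> V (swap_next l w)" using q Vpos by (simp add: mult_left_le less_imp_le)
      finally show ?thesis unfolding h_def by (intro mult_right_mono) auto
    qed
    let ?A = "{w \<in> S. w ! l \<and> \<not> w ! (l + 1)}" and ?B = "{w \<in> S. \<not> w ! l \<and> w ! (l + 1)}"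
    have fS: "finite S" by (simp add: S_def finite_states)
    have "D l = sum h S" by (simp add: D_def h_def)
    also have "\<dots> = sum h (?A \<union> ?B)"
    proof (rule sum.mono_neutral_right[OF fS])
      show "\<forall>w\<in>S - (?A \<union> ?B). h w = 0"
      proof
        fix w assume w: "w \<in> S - (?A \<union> ?B)"
        then have "w ! l = w ! (l + 1)" by auto
        then show "h w = 0" using swap_next_same[of l w] len w by (simp add: h_def)
      qed
    qed auto
    also have "\<dots> = sum h ?A + sum h ?B"
      using fS by (intro sum.union_disjoint) auto
    also have "sum h ?B = sum h ?A"
      by (rule sum.reindex_bij_witness[of _ "swap_next l" "swap_next l"])
         (use closed l involution swap_next_nth[OF len] hs in \<open>auto simp: S_def\<close>)
    also have "sum h ?A \<le> E l" unfolding E_def using hle by (intro sum_mono) auto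
    finally show "D l / 2 \<le> E l" by simp
  qed (auto intro!: mult_nonneg_nonneg sum_nonneg simp: less_imp_le[OF Vpos])
  finally show ?thesis by (simp add: E_def)
qed

end

section \<open>Shuffles and the tree decomposition\<close>

lemma sum_le_inj:
  fixes g :: "'b \<Rightarrow> real"
  assumes "finite T" "inj_on h S" "\<And>s. s \<in> S \<Longrightarrow> h s \<in> T" "\<And>t. t \<in> T \<Longrightarrow> 0 \<le> g t"
    "\<And>s. s \<in> S \<Longrightarrow> f s \<le> g (h s)"
  shows "sum f S \<le> sum g T"
proof -
  have "sum f S \<le> sum (\<lambda>s. g (h s)) S" by (intro sum_mono assms)
  also have "\<dots> = sum g (h ` S)" using sum.reindex[OF assms(2), of g] by simp
  also have "\<dots> \<le> sum g T" using assms by (intro sum_mono2) auto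
  finally show ?thesis .
qed

section \<open>Free exchanges and their energy\<close>

abbreviation exchange :: "'a \<Rightarrow> 'a \<Rightarrow> 'a list \<Rightarrow> 'a list" where
  "exchange i j \<equiv> map (Transposition.transpose i j)"

text \<open>This is how an adjacent swap in the order of the leaves of a subtree appears in the full
  permutation: whatever stands between \<open>i\<close> and \<open>j\<close> lies outside the
  subtree, and since the leaves of a subtree form an interval, it is smaller than \<open>i\<close>
  or larger than \<open>j\<close>. Fixing \<open>i\<close> as the first of the two counts every
  exchange once.\<close>

definition free_pair :: "nat \<Rightarrow> nat \<Rightarrow> nat list \<Rightarrow> bool" where
  "free_pair i j xs \<longleftrightarrow> i < j \<and>
     (\<exists>A ks R. xs = A @ i # ks @ j # R \<and> (\<forall>k\<in>set ks. k < i \<or> j < k))"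

text \<open>The weight \<open>min\<close> treats both ends of the exchange alike and is multiplied
  by the common factor when the order of a subtree is completed to one of the whole tree.\<close>

definition pair_energy :: "nat set \<Rightarrow> (nat \<Rightarrow> nat \<Rightarrow> real) \<Rightarrow> (nat list \<Rightarrow> real) \<Rightarrow> nat \<Rightarrow> nat \<Rightarrow> real" where
  "pair_energy X p f i j = (\<Sum>xs | xs \<in> permutations_of_set X \<and> free_pair i j xs.
     min (list_weight p xs) (list_weight p (exchange i j xs)) *
       (f xs - f (exchange i j xs))\<^sup>2)"

definition free_energy :: "nat set \<Rightarrow> (nat \<Rightarrow> nat \<Rightarrow> real) \<Rightarrow> (nat list \<Rightarrow> real) \<Rightarrow> real" where
  "free_energy X p f = (\<Sum>i\<in>X. \<Sum>j\<in>X. pair_energy X p f i j)"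

section \<open>Shuffles of two lists\<close>

primrec interleave :: "bool list \<Rightarrow> 'a list \<Rightarrow> 'a list \<Rightarrow> 'a list" where
  "interleave [] xs ys = []"
| "interleave (b # w) xs ys =
    (if b then hd xs # interleave w (tl xs) ys else hd ys # interleave w xs (tl ys))"

definition fits :: "bool list \<Rightarrow> 'a list \<Rightarrow> 'a list \<Rightarrow> bool" where
  "fits w xs ys \<longleftrightarrow> count_list w True = length xs \<and> count_list w False = length ys"

lemma interleave_induct [consumes 1, case_names Nil left right]:
  assumes "fits w xs ys" "P [] [] []"
    "\<And>w x xs ys. fits w xs ys \<Longrightarrow> P w xs ys \<Longrightarrow> P (True # w) (x # xs) ys"
    "\<And>w xs y ys. fits w xs ys \<Longrightarrow> P w xs ys \<Longrightarrow> P (False # w) xs (y # ys)"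
  shows "P w xs ys"
  using assms(1)
proof (induction w arbitrary: xs ys)
  case Nil
  then show ?case using assms(2) by (simp add: fits_def)
next
  case (Cons b w)
  then show ?case
    by (cases b; cases xs; cases ys) (auto simp: fits_def intro!: assms(3,4))
qed

lemma mset_interleave: "fits w xs ys \<Longrightarrow> mset (interleave w xs ys) = mset xs + mset ys"
  by (induction rule: interleave_induct) auto

lemma set_interleave: "fits w xs ys \<Longrightarrow> set (interleave w xs ys) = set xs \<union> set ys"
  by (metis mset_interleave set_mset_mset set_mset_union)

lemma prod_list_interleave:
  fixes f :: "'a \<Rightarrow> real"
  shows "fits w xs ys \<Longrightarrow> (\<Prod>z\<leftarrow>interleave w xs ys. f z) = (\<Prod>z\<leftarrow>xs. f z) * (\<Prod>z\<leftarrow>ys. f z)"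
  by (induction rule: interleave_induct) auto

lemma map_interleave: "fits w xs ys \<Longrightarrow> map h (interleave w xs ys) = interleave w (map h xs) (map h ys)"
  by (induction rule: interleave_induct) auto

lemma interleave_components:
  assumes "fits w xs ys" "set xs \<subseteq> X" "set ys \<inter> X = {}"
  shows "filter (\<lambda>z. z \<in> X) (interleave w xs ys) = xs" (is ?A)
    and "filter (\<lambda>z. z \<notin> X) (interleave w xs ys) = ys" (is ?B)
    and "map (\<lambda>z. z \<in> X) (interleave w xs ys) = w" (is ?C)
proof -
  have "?A \<and> ?B \<and> ?C" using assms by (induction rule: interleave_induct) auto
  then show ?A ?B ?C by auto
qed

lemma fits_components: "fits (map P zs) (filter P zs) (filter (\<lambda>z. \<not> P z) zs)"
  unfolding fits_def by (induction zs) auto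

lemma interleave_filter:
  "interleave (map P zs) (filter P zs) (filter (\<lambda>z. \<not> P z) zs) = zs"
  by (induction zs) auto

lemma count_bias: "fits w xs ys \<Longrightarrow> (\<Prod>b\<leftarrow>w. shuffle_bias q True b) = q ^ length ys"
    "fits w xs ys \<Longrightarrow> (\<Prod>b\<leftarrow>w. shuffle_bias q False b) = (1 - q) ^ length xs"
  by (induction rule: interleave_induct) (auto simp: shuffle_bias_def)

lemma prod_list_const: "(\<And>y. y \<in> set ys \<Longrightarrow> f y = (r :: real)) \<Longrightarrow> (\<Prod>y\<leftarrow>ys. f y) = r ^ length ys"
  by (induction ys) auto

text \<open>A pair with one entry in each list contributes \<open>q\<close> or \<open>1 - q\<close>
  according to which list comes first, and that is recorded in the word \<open>w\<close>
  alone.\<close>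

lemma list_weight_interleave:
  assumes "fits w xs ys" "\<And>x y. x \<in> set xs \<Longrightarrow> y \<in> set ys \<Longrightarrow> p x y = q \<and> p y x = 1 - q"
  shows "list_weight p (interleave w xs ys) =
    list_weight p xs * list_weight p ys * list_weight (shuffle_bias q) w"
  using assms
proof (induction rule: interleave_induct)
  case (left w x xs ys)
  have "(\<Prod>y\<leftarrow>ys. p x y) = q ^ length ys" using left by (intro prod_list_const) auto
  then show ?case using left by (simp add: prod_list_interleave count_bias[OF left(1)])
next
  case (right w xs y ys)
  have "(\<Prod>x\<leftarrow>xs. p y x) = (1 - q) ^ length xs" using right by (intro prod_list_const) auto
  then show ?case using right by (simp add: prod_list_interleave count_bias[OF right(1)])
qed simp

lemma filter_eq_appendD:
  "filter P zs = A @ B \<Longrightarrow> \<exists>us vs. zs = us @ vs \<and> filter P us = A \<and> filter P vs = B"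
proof (induction A arbitrary: zs)
  case Nil
  then show ?case by (intro exI[of _ "[]"] exI[of _ zs]) simp
next
  case (Cons a A)
  then obtain us vs where v: "zs = us @ a # vs" "\<forall>u\<in>set us. \<not> P u" "P a" "filter P vs = A @ B"
    by (auto dest!: filter_eq_ConsD)
  from Cons.IH[OF v(4)] obtain us' vs' where "vs = us' @ vs'" "filter P us' = A" "filter P vs' = B" by blast
  then show ?case using v
    by (intro exI[of _ "us @ a # us'"] exI[of _ vs']) (simp add: filter_False)
qed

text \<open>Lifts an exchange from a subtree to a larger tree: the entries dropped by the filter may
  stand between \<open>i\<close> and \<open>j\<close>.\<close>

lemma free_pair_filter:
  assumes "free_pair i j (filter P zs)" "\<And>k. k \<in> set zs \<Longrightarrow> \<not> P k \<Longrightarrow> k < i \<or> j < k"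
  shows "free_pair i j zs"
proof -
  obtain A ks R where ks: "filter P zs = A @ i # ks @ j # R" "\<forall>k\<in>set ks. k < i \<or> j < k" and ij: "i < j"
    using assms(1) by (auto simp: free_pair_def)
  obtain us vs where 1: "zs = us @ vs" "filter P vs = i # ks @ j # R"
    using filter_eq_appendD[OF ks(1)] by blast
  obtain us' vs' where 2: "vs = us' @ i # vs'" "filter P vs' = ks @ j # R"
    using filter_eq_ConsD[OF 1(2)] by auto
  obtain us'' vs'' where 3: "vs' = us'' @ vs''" "filter P us'' = ks" "filter P vs'' = j # R"
    using filter_eq_appendD[OF 2(2)] by blast
  obtain us3 vs3 where 4: "vs'' = us3 @ j # vs3" "\<forall>u\<in>set us3. \<not> P u"
    using filter_eq_ConsD[OF 3(3)] by auto
  have "k < i \<or> j < k" if "k \<in> set (us'' @ us3)" for k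
    using that ks(2) 3(2) assms(2)[of k] 1 2 3 4 by (cases "P k") auto
  then show ?thesis using 1 2 3 4 ij
    unfolding free_pair_def by (intro conjI exI[of _ "us @ us'"] exI[of _ "us'' @ us3"] exI[of _ vs3]) auto
qed

lemma map_transpose_id: "i \<notin> set xs \<Longrightarrow> j \<notin> set xs \<Longrightarrow> exchange i j xs = xs"
  by (rule map_idI) (metis transpose_apply_other)

lemma map_transpose_permutation:
  assumes "xs \<in> permutations_of_set X" "i \<in> X" "j \<in> X"
  shows "exchange i j xs \<in> permutations_of_set X"
proof -
  have "Transposition.transpose i j ` X = X"
    using assms(2,3) by (auto simp: transpose_image_eq)
  then show ?thesis using assms by (auto simp: permutations_of_set_def distinct_map)
qed

lemma swap_next_eq_map_transpose:
  assumes "distinct xs" "l + 1 < length xs"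
  shows "swap_next l xs = exchange (xs ! l) (xs ! (l + 1)) xs"
proof -
  obtain A R where A: "xs = A @ xs ! l # xs ! (l + 1) # R" "length A = l"
    using split_adjacent[OF assms(2)] by blast
  define x y where "x = xs ! l" and "y = xs ! (l + 1)"
  have xs: "xs = A @ x # y # R" using A by (simp add: x_def y_def)
  then have "exchange x y A = A" "exchange x y R = R"
    using assms(1) by (auto intro!: map_transpose_id)
  then have "exchange x y xs = swap_next l xs"
    unfolding xs A(2)[symmetric] swap_next_append by simp
  then show ?thesis by (simp add: x_def y_def)
qed

lemma interleave_swap:
  assumes "fits w xs ys" "l + 1 < length w" "w ! l" "\<not> w ! (l + 1)"
  shows "swap_next l (interleave w xs ys) = interleave (swap_next l w) xs ys"
  using assms
proof (induction arbitrary: l rule: interleave_induct)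
  case (left w x xs ys)
  show ?case
  proof (cases l)
    case 0
    then show ?thesis using left.prems left.hyps
      by (cases w; cases ys) (auto simp: swap_next_def fits_def)
  next
    case (Suc m)
    have "swap_next (Suc m) (z # zs) = z # swap_next m zs" for z :: 'a and zs
      by (simp add: swap_next_def)
    moreover have "swap_next (Suc m) (True # w) = True # swap_next m w"
      by (simp add: swap_next_def)
    ultimately show ?thesis using Suc left by simp
  qed
next
  case (right w xs y ys)
  then obtain m where Suc: "l = Suc m" by (cases l) auto
  have "swap_next (Suc m) (z # zs) = z # swap_next m zs" for z :: 'a and zs
    by (simp add: swap_next_def)
  moreover have "swap_next (Suc m) (False # w) = False # swap_next m w"
    by (simp add: swap_next_def)
  ultimately show ?case using Suc right by simp
qed simp

lemma length_interleave [simp]: "length (interleave w xs ys) = length w"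
  by (induction w arbitrary: xs ys) auto

lemma bij_betw_interleave:
  assumes "finite X" "finite Y" "X \<inter> Y = {}"
  shows "bij_betw (\<lambda>(xs, ys, w). interleave w xs ys)
    (permutations_of_set X \<times> permutations_of_set Y \<times> shuffle_words (card X) (card Y))
    (permutations_of_set (X \<union> Y))"
proof -
  let ?split = "\<lambda>zs. (filter (\<lambda>z. z \<in> X) zs, filter (\<lambda>z. z \<notin> X) zs, map (\<lambda>z. z \<in> X) zs)"
  let ?S = "permutations_of_set X \<times> permutations_of_set Y \<times> shuffle_words (card X) (card Y)"
  have fits: "fits w xs ys" "set xs = X" "set ys = Y" "distinct xs" "distinct ys" if "(xs, ys, w) \<in> ?S" for xs ys w
    using that by (auto simp: fits_def shuffle_words_def permutations_of_set_def distinct_card)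
  show ?thesis
  proof (rule bij_betw_byWitness[where f' = ?split])
    show "\<forall>a\<in>?S. ?split
        (case a of (xs, ys, w) \<Rightarrow> interleave w xs ys) = a"
      using fits assms(3) by (auto simp: interleave_components inf_commute)
    show "\<forall>zs\<in>permutations_of_set (X \<union> Y). (case ?split zs of (xs, ys, w) \<Rightarrow> interleave w xs ys) = zs"
      by (simp add: interleave_filter)
    show "(\<lambda>(xs, ys, w). interleave w xs ys) ` ?S \<subseteq> permutations_of_set (X \<union> Y)"
    proof safe
      fix xs ys w assume *: "xs \<in> permutations_of_set X" "ys \<in> permutations_of_set Y" "w \<in> shuffle_words (card X) (card Y)"
      then have f: "fits w xs ys" "set xs = X" "set ys = Y" "distinct xs" "distinct ys" using fits by auto
      then have "distinct (xs @ ys)" using assms(3) by simp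
      then have "distinct (interleave w xs ys)"
        using mset_interleave[OF f(1)] by (metis mset_append mset_eq_imp_distinct_iff)
      then show "interleave w xs ys \<in> permutations_of_set (X \<union> Y)"
        using f set_interleave[OF f(1)] by (auto simp: permutations_of_set_def)
    qed
    show "?split ` permutations_of_set (X \<union> Y) \<subseteq> ?S"
    proof safe
      fix zs assume zs: "zs \<in> permutations_of_set (X \<union> Y)"
      have s: "set (filter (\<lambda>z. z \<in> X) zs) = X" "set (filter (\<lambda>z. z \<notin> X) zs) = Y"
          "distinct (filter (\<lambda>z. z \<in> X) zs)" "distinct (filter (\<lambda>z. z \<notin> X) zs)"
        using zs assms(3) by (auto simp: permutations_of_set_def)
      then show "filter (\<lambda>z. z \<in> X) zs \<in> permutations_of_set X" "filter (\<lambda>z. z \<notin> X) zs \<in> permutations_of_set Y"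
        by (auto simp: permutations_of_set_def)
      have "length (filter (\<lambda>z. z \<in> X) zs) = card X" "length (filter (\<lambda>z. z \<notin> X) zs) = card Y"
        using s distinct_card by metis+
      then show "map (\<lambda>z. z \<in> X) zs \<in> shuffle_words (card X) (card Y)"
        using fits_components[of "\<lambda>z. z \<in> X" zs] by (simp add: shuffle_words_def fits_def)
    qed
  qed
qed

section \<open>Merging the energies of subtrees\<close>

primrec tree_bias :: "(nat \<Rightarrow> nat \<Rightarrow> real) \<Rightarrow> ltree \<Rightarrow> bool" where
  "tree_bias p (Leaf i) = True"
| "tree_bias p (Branch l q r) = (1/2 \<le> q \<and> q < 1 \<and> tree_bias p l \<and> tree_bias p r \<and>
     (\<forall>i\<in>set (leaves l). \<forall>j\<in>set (leaves r). p i j = q \<and> p j i = 1 - q))"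

lemma leaves_nonempty: "leaves T \<noteq> []"
  by (induction T) auto

lemma pair_energy_nonneg:
  assumes "\<And>xs. xs \<in> permutations_of_set X \<Longrightarrow> 0 \<le> list_weight p xs" "i \<in> X" "j \<in> X"
  shows "0 \<le> pair_energy X p f i j"
  unfolding pair_energy_def
  by (intro sum_nonneg mult_nonneg_nonneg) (auto intro: assms map_transpose_permutation)

lemma free_energy_nonneg:
  assumes "\<And>xs. xs \<in> permutations_of_set X \<Longrightarrow> 0 \<le> list_weight p xs"
  shows "0 \<le> free_energy X p f"
  unfolding free_energy_def by (intro sum_nonneg pair_energy_nonneg assms)

text \<open>Here \<open>e z xs\<close> completes the order \<open>xs\<close> of \<open>Z\<close> by
  the data \<open>z\<close>, at the price of a factor \<open>c z\<close> in the weight. Injectivity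
  sends different terms on the left to different terms on the right, so summing over all completions
  stays within the pairs of \<open>Z\<close>.\<close>

lemma free_energy_embed:
  fixes e :: "'i \<Rightarrow> nat list \<Rightarrow> nat list"
  defines "P \<equiv> (permutations_of_set :: nat set \<Rightarrow> _)"
  assumes ZX: "Z \<subseteq> X" and W: "\<And>xs. xs \<in> P X \<Longrightarrow> 0 \<le> list_weight p xs"
    and inj: "inj_on (\<lambda>(z, xs). e z xs) (I \<times> P Z)"
    and e: "\<And>z xs. z \<in> I \<Longrightarrow> xs \<in> P Z \<Longrightarrow> e z xs \<in> P X \<and> list_weight p (e z xs) = c z * list_weight p xs"
    and c: "\<And>z. z \<in> I \<Longrightarrow> 0 \<le> c z"
    and tr: "\<And>z xs i j. z \<in> I \<Longrightarrow> xs \<in> P Z \<Longrightarrow> i \<in> Z \<Longrightarrow> j \<in> Z \<Longrightarrow>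
      exchange i j (e z xs) = e z (exchange i j xs) \<and>
      (free_pair i j xs \<longrightarrow> free_pair i j (e z xs))"
  shows "(\<Sum>z\<in>I. c z * free_energy Z p (\<lambda>xs. f (e z xs))) \<le> (\<Sum>i\<in>Z. \<Sum>j\<in>Z. pair_energy X p f i j)"
proof -
  let ?t = "\<lambda>i j. exchange i j" and ?W = "list_weight p"
  define h where "h i j = (\<lambda>(z, xs). c z * (min (?W xs) (?W (?t i j xs)) *
    (f (e z xs) - f (e z (?t i j xs)))\<^sup>2))" for i j
  have "(\<Sum>z\<in>I. c z * free_energy Z p (\<lambda>xs. f (e z xs))) =
      (\<Sum>z\<in>I. \<Sum>i\<in>Z. \<Sum>j\<in>Z. \<Sum>xs | xs \<in> P Z \<and> free_pair i j xs. h i j (z, xs))"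
    unfolding free_energy_def pair_energy_def h_def P_def by (simp add: sum_distrib_left)
  also have "\<dots> = (\<Sum>i\<in>Z. \<Sum>z\<in>I. \<Sum>j\<in>Z. \<Sum>xs | xs \<in> P Z \<and> free_pair i j xs. h i j (z, xs))"
    by (rule sum.swap)
  also have "\<dots> = (\<Sum>i\<in>Z. \<Sum>j\<in>Z. \<Sum>z\<in>I. \<Sum>xs | xs \<in> P Z \<and> free_pair i j xs. h i j (z, xs))"
    by (intro sum.cong refl sum.swap)
  also have "\<dots> \<le> (\<Sum>i\<in>Z. \<Sum>j\<in>Z. pair_energy X p f i j)"
  proof (intro sum_mono)
    fix i j assume ij: "i \<in> Z" "j \<in> Z"
    have tP: "?t i j xs \<in> P A" if "xs \<in> P A" "Z \<subseteq> A" for xs A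
      unfolding P_def by (rule map_transpose_permutation) (use that ij in \<open>auto simp: P_def\<close>)
    have "(\<Sum>z\<in>I. \<Sum>xs | xs \<in> P Z \<and> free_pair i j xs. h i j (z, xs)) =
        sum (h i j) (I \<times> {xs. xs \<in> P Z \<and> free_pair i j xs})"
      by (simp add: sum.cartesian_product)
    also have "\<dots> \<le> pair_energy X p f i j" unfolding pair_energy_def
    proof (rule sum_le_inj[where h = "\<lambda>(z, xs). e z xs"])
      show "inj_on (\<lambda>(z, xs). e z xs) (I \<times> {xs. xs \<in> P Z \<and> free_pair i j xs})"
        by (rule inj_on_subset[OF inj]) auto
      fix s assume "s \<in> I \<times> {xs. xs \<in> P Z \<and> free_pair i j xs}"
      then obtain z xs where s: "s = (z, xs)" and m: "z \<in> I" "xs \<in> P Z" "free_pair i j xs" by auto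
      show "(case s of (z, xs) \<Rightarrow> e z xs) \<in> {xs \<in> permutations_of_set X. free_pair i j xs}"
        using e[OF m(1,2)] tr[OF m(1,2) ij] m(3) by (simp add: s P_def)
      have "min (c z * ?W xs) (c z * ?W (?t i j xs)) = c z * min (?W xs) (?W (?t i j xs))"
        using c[OF m(1)] by (simp add: min_mult_distrib_left)
      then show "h i j s \<le> min (?W (case s of (z, xs) \<Rightarrow> e z xs)) (?W (?t i j (case s of (z, xs) \<Rightarrow> e z xs))) *
          (f (case s of (z, xs) \<Rightarrow> e z xs) - f (?t i j (case s of (z, xs) \<Rightarrow> e z xs)))\<^sup>2"
        using e[OF m(1,2)] e[OF m(1) tP[OF m(2) order_refl]] tr[OF m(1,2) ij] by (simp add: h_def s)
    next
      fix t assume "t \<in> {xs \<in> permutations_of_set X. free_pair i j xs}"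
      then show "0 \<le> min (?W t) (?W (?t i j t)) * (f t - f (?t i j t))\<^sup>2"
        using W[of t] W[OF tP[OF _ ZX]] by (simp add: P_def)
    qed simp
    finally show "(\<Sum>z\<in>I. \<Sum>xs | xs \<in> P Z \<and> free_pair i j xs. h i j (z, xs)) \<le> pair_energy X p f i j" .
  qed
  finally show ?thesis .
qed

text \<open>The three sums are charged to disjoint sets of pairs: both entries in \<open>X\<close>,
  both in \<open>Y\<close>, or one in each. Therefore they add up with constant 1, and the induction
  over the tree does not accumulate factors.\<close>

lemma free_energy_merge:
  fixes X Y :: "nat set" and p q f
  defines "F \<equiv> (\<lambda>(xs, ys, w). f (interleave w xs ys))"
    and "V \<equiv> list_weight (shuffle_bias q)" and "W \<equiv> list_weight p"
    and "P \<equiv> (permutations_of_set :: nat set \<Rightarrow> _)" and "\<Omega> \<equiv> shuffle_words (card X) (card Y)"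
  assumes fin: "finite X" "finite Y" and less: "\<And>x y. x \<in> X \<Longrightarrow> y \<in> Y \<Longrightarrow> x < y"
    and pq: "\<And>x y. x \<in> X \<Longrightarrow> y \<in> Y \<Longrightarrow> p x y = q \<and> p y x = 1 - q" and q: "1/2 \<le> q" "q < 1"
    and Wpos: "\<And>xs. xs \<in> P (X \<union> Y) \<Longrightarrow> 0 \<le> W xs"
      "\<And>xs. xs \<in> P X \<Longrightarrow> 0 \<le> W xs" "\<And>xs. xs \<in> P Y \<Longrightarrow> 0 \<le> W xs"
  shows "(\<Sum>z\<in>P Y \<times> \<Omega>. (case z of (ys, w) \<Rightarrow> W ys * V w) * free_energy X p (\<lambda>xs. F (xs, z))) +
     (\<Sum>xs\<in>P X. W xs * (\<Sum>w\<in>\<Omega>. V w * free_energy Y p (\<lambda>ys. F (xs, ys, w)))) +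
     (\<Sum>xs\<in>P X. W xs * (\<Sum>ys\<in>P Y. W ys *
        (\<Sum>l<card X + card Y - 1. \<Sum>w | w \<in> \<Omega> \<and> w ! l \<and> \<not> w ! (l + 1).
           V (swap_next l w) * (F (xs, ys, w) - F (xs, ys, swap_next l w))\<^sup>2)))
     \<le> free_energy (X \<union> Y) p f"
proof -
  define E where "E i j zs = min (W zs) (W (exchange i j zs)) *
     (f zs - f (exchange i j zs))\<^sup>2" for i j zs
  define G where "G = pair_energy (X \<union> Y) p f"
  have disj: "X \<inter> Y = {}" using less by fastforce
  have bij: "bij_betw (\<lambda>(xs, ys, w). interleave w xs ys) (P X \<times> P Y \<times> \<Omega>) (P (X \<union> Y))"
    unfolding P_def \<Omega>_def by (rule bij_betw_interleave[OF fin disj])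
  have inj: "inj_on (\<lambda>(xs, ys, w). interleave w xs ys) (P X \<times> P Y \<times> \<Omega>)"
    using bij by (rule bij_betw_imp_inj_on)
  have mem: "interleave w xs ys \<in> P (X \<union> Y)" if "xs \<in> P X" "ys \<in> P Y" "w \<in> \<Omega>" for xs ys w
    using bij_betwE[OF bij] that by auto
  have fits: "fits w xs ys" and sets: "set xs = X" "set ys = Y"
    if "xs \<in> P X" "ys \<in> P Y" "w \<in> \<Omega>" for xs ys w
    using that by (auto simp: fits_def P_def \<Omega>_def shuffle_words_def permutations_of_set_def distinct_card)
  have Wm: "W (interleave w xs ys) = W xs * W ys * V w" if "xs \<in> P X" "ys \<in> P Y" "w \<in> \<Omega>" for xs ys w
    unfolding W_def V_def
    by (rule list_weight_interleave[OF fits[OF that]]) (use pq sets[OF that] in auto)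
  have Vpos: "0 < V w" for w unfolding V_def using q by (intro list_weight_bias_pos) auto
  have finP: "finite (P Z)" for Z by (simp add: P_def)
  have fin\<Omega>: "finite \<Omega>" by (simp add: \<Omega>_def finite_shuffle_words)
  have E_nn: "0 \<le> E i j zs" if "zs \<in> P (X \<union> Y)" "i \<in> X \<union> Y" "j \<in> X \<union> Y" for i j zs
    unfolding E_def using Wpos(1) that map_transpose_permutation[OF that[unfolded P_def]]
    by (intro mult_nonneg_nonneg) (auto simp: P_def)
  have G_nn: "0 \<le> G i j" if "i \<in> X \<union> Y" "j \<in> X \<union> Y" for i j
    unfolding G_def by (rule pair_energy_nonneg) (use Wpos that in \<open>auto simp: P_def W_def\<close>)
  have finG: "finite {zs. zs \<in> P (X \<union> Y) \<and> free_pair i j zs}" for i j using finP by simp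

  have 1: "(\<Sum>z\<in>P Y \<times> \<Omega>. (case z of (ys, w) \<Rightarrow> W ys * V w) * free_energy X p (\<lambda>xs. F (xs, z)))
      \<le> (\<Sum>i\<in>X. \<Sum>j\<in>X. G i j)"
  proof -
    have "(\<Sum>z\<in>P Y \<times> \<Omega>. (case z of (ys, w) \<Rightarrow> W ys * V w) *
        free_energy X p (\<lambda>xs. f ((case z of (ys, w) \<Rightarrow> \<lambda>xs. interleave w xs ys) xs))) \<le> (\<Sum>i\<in>X. \<Sum>j\<in>X. G i j)"
      unfolding G_def
    proof (rule free_energy_embed)
      show "inj_on (\<lambda>(z, xs). (case z of (ys, w) \<Rightarrow> \<lambda>xs. interleave w xs ys) xs)
          ((P Y \<times> \<Omega>) \<times> permutations_of_set X)"
        using inj by (auto simp: inj_on_def P_def)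
      fix z xs assume "z \<in> P Y \<times> \<Omega>" "xs \<in> permutations_of_set X"
      then obtain ys w where z: "z = (ys, w)" and m: "xs \<in> P X" "ys \<in> P Y" "w \<in> \<Omega>" by (auto simp: P_def)
      let ?e = "\<lambda>xs. (case z of (ys, w) \<Rightarrow> \<lambda>xs. interleave w xs ys) xs"
      show "?e xs \<in> permutations_of_set (X \<union> Y) \<and> list_weight p (?e xs) =
          (case z of (ys, w) \<Rightarrow> W ys * V w) * list_weight p xs"
        using mem[OF m] Wm[OF m] by (simp add: z P_def W_def mult_ac)
      fix i j assume ij: "i \<in> X" "j \<in> X"
      have "filter (\<lambda>z. z \<in> X) (interleave w xs ys) = xs"
        using interleave_components(1)[OF fits[OF m]] sets[OF m] disj by auto
      then have "free_pair i j xs \<Longrightarrow> free_pair i j (interleave w xs ys)"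
        by (rule_tac free_pair_filter[where P = "\<lambda>z. z \<in> X"])
           (use less ij set_interleave[OF fits[OF m]] sets[OF m] in auto)
      moreover have "exchange i j ys = ys"
        using sets[OF m] disj ij by (intro map_transpose_id) auto
      ultimately show "exchange i j (?e xs) = ?e (exchange i j xs) \<and>
          (free_pair i j xs \<longrightarrow> free_pair i j (?e xs))"
        using map_interleave[OF fits[OF m], of "Transposition.transpose i j"] by (simp add: z)
    qed (use Wpos Vpos in \<open>auto simp: P_def W_def less_imp_le\<close>)
    then show ?thesis by (simp add: F_def case_prod_beta)
  qed

  have 2: "(\<Sum>xs\<in>P X. W xs * (\<Sum>w\<in>\<Omega>. V w * free_energy Y p (\<lambda>ys. F (xs, ys, w))))
      \<le> (\<Sum>i\<in>Y. \<Sum>j\<in>Y. G i j)"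
  proof -
    have "(\<Sum>z\<in>P X \<times> \<Omega>. (case z of (xs, w) \<Rightarrow> W xs * V w) *
        free_energy Y p (\<lambda>ys. f ((case z of (xs, w) \<Rightarrow> \<lambda>ys. interleave w xs ys) ys))) \<le> (\<Sum>i\<in>Y. \<Sum>j\<in>Y. G i j)"
      unfolding G_def
    proof (rule free_energy_embed)
      show "inj_on (\<lambda>(z, ys). (case z of (xs, w) \<Rightarrow> \<lambda>ys. interleave w xs ys) ys)
          ((P X \<times> \<Omega>) \<times> permutations_of_set Y)"
        using inj by (auto simp: inj_on_def P_def)
      fix z ys assume "z \<in> P X \<times> \<Omega>" "ys \<in> permutations_of_set Y"
      then obtain xs w where z: "z = (xs, w)" and m: "xs \<in> P X" "ys \<in> P Y" "w \<in> \<Omega>" by (auto simp: P_def)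
      let ?e = "\<lambda>ys. (case z of (xs, w) \<Rightarrow> \<lambda>ys. interleave w xs ys) ys"
      show "?e ys \<in> permutations_of_set (X \<union> Y) \<and> list_weight p (?e ys) =
          (case z of (xs, w) \<Rightarrow> W xs * V w) * list_weight p ys"
        using mem[OF m] Wm[OF m] by (simp add: z P_def W_def mult_ac)
      fix i j assume ij: "i \<in> Y" "j \<in> Y"
      have "filter (\<lambda>z. z \<notin> X) (interleave w xs ys) = ys"
        using interleave_components(2)[OF fits[OF m]] sets[OF m] disj by auto
      then have "free_pair i j ys \<Longrightarrow> free_pair i j (interleave w xs ys)"
        by (rule_tac free_pair_filter[where P = "\<lambda>z. z \<notin> X"])
           (use less ij set_interleave[OF fits[OF m]] sets[OF m] in auto)
      moreover have "exchange i j xs = xs"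
        using sets[OF m] disj ij by (intro map_transpose_id) auto
      ultimately show "exchange i j (?e ys) = ?e (exchange i j ys) \<and>
          (free_pair i j ys \<longrightarrow> free_pair i j (?e ys))"
        using map_interleave[OF fits[OF m], of "Transposition.transpose i j"] by (simp add: z)
    qed (use Wpos Vpos in \<open>auto simp: P_def W_def less_imp_le\<close>)
    moreover have "(\<Sum>xs\<in>P X. W xs * (\<Sum>w\<in>\<Omega>. V w * free_energy Y p (\<lambda>ys. F (xs, ys, w)))) =
      (\<Sum>xs\<in>P X. \<Sum>w\<in>\<Omega>. W xs * V w * free_energy Y p (\<lambda>ys. f (interleave w xs ys)))"
      by (simp add: sum_distrib_left mult.assoc F_def)
    ultimately show ?thesis by (simp add: sum.cartesian_product case_prod_beta)
  qed

  have 3: "(\<Sum>xs\<in>P X. W xs * (\<Sum>ys\<in>P Y. W ys *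
        (\<Sum>l<card X + card Y - 1. \<Sum>w | w \<in> \<Omega> \<and> w ! l \<and> \<not> w ! (l + 1).
           V (swap_next l w) * (F (xs, ys, w) - F (xs, ys, swap_next l w))\<^sup>2)))
     \<le> (\<Sum>i\<in>X. \<Sum>j\<in>Y. G i j)"
  proof -
    let ?N = "card X + card Y"
    define I where "I = (SIGMA s : P X \<times> P Y \<times> {..<?N - 1}.
        {w. w \<in> \<Omega> \<and> w ! snd (snd s) \<and> \<not> w ! (snd (snd s) + 1)})"
    define J where "J = (SIGMA s : X \<times> Y. {zs. zs \<in> P (X \<union> Y) \<and> free_pair (fst s) (snd s) zs})"
    define a where "a = (\<lambda>((xs, ys, l), w). W xs * W ys * V (swap_next l w) *
       (F (xs, ys, w) - F (xs, ys, swap_next l w))\<^sup>2)"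
    define b where "b = (\<lambda>((i, j), zs). E i j zs)"
    \<comment> \<open>The target shows the permutation and the exchanged pair; since entries are
      distinct, the position \<open>l\<close> can be recovered from the first entry of the
      pair.\<close>
    define h where "h = (\<lambda>((xs :: nat list, ys, l), w). let zs = interleave w xs ys in ((zs ! l, zs ! (l + 1)), zs))"
    have "(\<Sum>xs\<in>P X. W xs * (\<Sum>ys\<in>P Y. W ys *
        (\<Sum>l<?N - 1. \<Sum>w | w \<in> \<Omega> \<and> w ! l \<and> \<not> w ! (l + 1).
           V (swap_next l w) * (F (xs, ys, w) - F (xs, ys, swap_next l w))\<^sup>2))) =
      (\<Sum>xs\<in>P X. \<Sum>ys\<in>P Y. \<Sum>l<?N - 1. \<Sum>w | w \<in> \<Omega> \<and> w ! l \<and> \<not> w ! (l + 1). a ((xs, ys, l), w))"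
      by (simp add: sum_distrib_left a_def mult.assoc)
    also have "\<dots> = (\<Sum>s\<in>P X \<times> P Y \<times> {..<?N - 1}.
        \<Sum>w | w \<in> \<Omega> \<and> w ! snd (snd s) \<and> \<not> w ! (snd (snd s) + 1). a (s, w))"
      by (simp add: sum.cartesian_product case_prod_beta)
    also have "\<dots> = sum a I"
      unfolding I_def using finP fin\<Omega> by (subst sum.Sigma) auto
    also have "\<dots> \<le> sum b J"
    proof (rule sum_le_inj)
      show "finite J" unfolding J_def using fin finG by (intro finite_SigmaI) auto
      have key: "zs ! l \<in> X \<and> zs ! (l + 1) \<in> Y \<and> free_pair (zs ! l) (zs ! (l + 1)) zs \<and> l + 1 < length zs \<and>
          exchange (zs ! l) (zs ! (l + 1)) zs = interleave (swap_next l w) xs ys \<and>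
          swap_next l w \<in> \<Omega> \<and> l + 1 < length w"
        if "xs \<in> P X" "ys \<in> P Y" "l < ?N - 1" "w \<in> \<Omega>" "w ! l" "\<not> w ! (l + 1)" "zs = interleave w xs ys"
        for xs ys l w zs
      proof -
        note m = that(1,2,4)
        have lw: "length w = ?N" using that by (simp add: \<Omega>_def shuffle_words_def length_eq_counts)
        then have l: "l + 1 < length w" "l + 1 < length zs" using that by auto
        have mw: "map (\<lambda>z. z \<in> X) zs = w"
          unfolding that(7) using interleave_components(3)[OF fits[OF m]] sets[OF m] disj by auto
        have "zs ! l \<in> X" "zs ! (l + 1) \<notin> X"
          using that(5,6) l mw by (metis nth_map add_lessD1)+
        moreover have "set zs = X \<union> Y" "distinct zs"
          using mem[OF m] that(7) by (auto simp: P_def permutations_of_set_def)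
        ultimately have xy: "zs ! l \<in> X" "zs ! (l + 1) \<in> Y" using l nth_mem[of "l + 1" zs] by auto
        obtain A R where A: "zs = A @ zs ! l # zs ! (l + 1) # R"
          using split_adjacent[OF l(2)] by metis
        have "free_pair (zs ! l) (zs ! (l + 1)) zs"
          unfolding free_pair_def using less[OF xy] A by (intro conjI exI[of _ A] exI[of _ "[]"] exI[of _ R]) auto
        moreover have "exchange (zs ! l) (zs ! (l + 1)) zs = interleave (swap_next l w) xs ys"
          using swap_next_eq_map_transpose[OF \<open>distinct zs\<close> l(2)] interleave_swap[OF fits[OF m] l(1) that(5,6)] that(7)
          by simp
        moreover have "swap_next l w \<in> \<Omega>"
          using that l by (simp add: \<Omega>_def shuffle_words_def count_list_swap_next)
        ultimately show ?thesis using xy l by simp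
      qed
      show "inj_on h I"
      proof (rule inj_onI)
        fix s s' assume s: "s \<in> I" "s' \<in> I" "h s = h s'"
        obtain xs ys l w xs' ys' l' w' where e: "s = ((xs, ys, l), w)" "s' = ((xs', ys', l'), w')"
          by (metis prod.collapse)
        have m: "xs \<in> P X" "ys \<in> P Y" "l < ?N - 1" "w \<in> \<Omega>" "w ! l" "\<not> w ! (l + 1)"
          "xs' \<in> P X" "ys' \<in> P Y" "l' < ?N - 1" "w' \<in> \<Omega>" "w' ! l'" "\<not> w' ! (l' + 1)"
          using s(1,2) by (auto simp: I_def e)
        define zs where "zs = interleave w xs ys"
        have zs: "interleave w' xs' ys' = zs" "zs ! l = zs ! l'"
          using s(3) by (auto simp: h_def e zs_def Let_def)
        have eq: "(xs, ys, w) = (xs', ys', w')"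
          using inj_onD[OF inj, of "(xs, ys, w)" "(xs', ys', w')"] zs m by (simp add: zs_def)
        have "distinct zs" using mem[OF m(1,2,4)] by (simp add: zs_def P_def permutations_of_set_def)
        then have "l = l'"
          using key[OF m(1-6) zs_def] key[OF m(7-12) zs(1)[symmetric]] zs(2) nth_eq_iff_index_eq[of zs l l']
          by auto
        then show "s = s'" using eq e by simp
      qed
      show "h s \<in> J" "a s \<le> b (h s)" if "s \<in> I" for s
      proof -
        obtain xs ys l w where e: "s = ((xs, ys, l), w)" by (metis prod.collapse)
        have m: "xs \<in> P X" "ys \<in> P Y" "l < ?N - 1" "w \<in> \<Omega>" "w ! l" "\<not> w ! (l + 1)"
          using that by (auto simp: I_def e)
        define zs where "zs = interleave w xs ys"
        note k = key[OF m zs_def]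
        show "h s \<in> J" using k mem[OF m(1,2,4)] by (simp add: h_def e J_def Let_def zs_def)
        \<comment> \<open>As \<open>q\<close> is at least 1/2, the word with True first is the
          heavier one, so the \<open>min\<close> in \<open>E\<close> is attained at the swapped
          word.\<close>
        have "V (swap_next l w) \<le> V w"
        proof -
          obtain A R where A: "w = A @ w ! l # w ! (l + 1) # R" "length A = l"
            using split_adjacent k by metis
          then have w: "w = A @ True # False # R" using m by simp
          have "V w * (1 - q) = V (swap_next l w) * q"
            using list_weight_swap[of "shuffle_bias q" A True False R] swap_next_append[of A True False R] A(2) w
            by (simp add: V_def shuffle_bias_def)
          moreover have "V w * (1 - q) \<le> V w * q" using q Vpos[of w] by (intro mult_left_mono) auto
          ultimately show ?thesis using q by simp
        qed
        moreover have "0 \<le> W xs * W ys" using Wpos(2)[OF m(1)] Wpos(3)[OF m(2)] by simp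
        ultimately have "W xs * W ys * V (swap_next l w) \<le> W xs * W ys * V w"
          by (rule mult_left_mono)
        then have "a s = b (h s)"
          unfolding a_def b_def h_def e E_def Let_def prod.case zs_def[symmetric] using k
          by (simp add: zs_def Wm[OF m(1,2,4)] Wm[OF m(1,2)] F_def min_def)
        then show "a s \<le> b (h s)" by simp
      qed
      show "0 \<le> b t" if "t \<in> J" for t using that E_nn by (auto simp: J_def b_def)
    qed
    also have "sum b J = (\<Sum>i\<in>X. \<Sum>j\<in>Y. G i j)"
    proof -
      have "(\<Sum>s\<in>X \<times> Y. \<Sum>zs | zs \<in> P (X \<union> Y) \<and> free_pair (fst s) (snd s) zs. b (s, zs)) = sum b J"
        unfolding J_def using fin finG by (subst sum.Sigma) auto
      then show ?thesis
        by (simp add: G_def pair_energy_def P_def W_def E_def b_def sum.cartesian_product case_prod_beta)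
    qed
    finally show ?thesis .
  qed

  have "free_energy (X \<union> Y) p f = (\<Sum>i\<in>X \<union> Y. \<Sum>j\<in>X \<union> Y. G i j)"
    by (simp add: free_energy_def G_def)
  also have "\<dots> = (\<Sum>i\<in>X. \<Sum>j\<in>X. G i j) + (\<Sum>i\<in>X. \<Sum>j\<in>Y. G i j) +
      (\<Sum>i\<in>Y. \<Sum>j\<in>X. G i j) + (\<Sum>i\<in>Y. \<Sum>j\<in>Y. G i j)"
    using fin disj by (simp add: sum.union_disjoint sum.distrib)
  finally have "free_energy (X \<union> Y) p f = \<dots>" .
  moreover have "0 \<le> (\<Sum>i\<in>Y. \<Sum>j\<in>X. G i j)" using G_nn by (intro sum_nonneg) auto
  ultimately show ?thesis using 1 2 3 by linarith
qed

text \<open>A shuffle is a product of three independent parts, so \<open>wvar_prod_le\<close> is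
  used twice and \<open>free_energy_merge\<close> collects the energies. The constant is stated with
  an upper bound \<open>n\<close> for the number of leaves, so that both subtrees and the node
  itself have the same one.\<close>

lemma tree_poincare:
  assumes "tree_bias p T" "sorted_wrt (<) (leaves T)" "length (leaves T) \<le> n"
    "\<And>i j. i \<in> set (leaves T) \<Longrightarrow> j \<in> set (leaves T) \<Longrightarrow> i \<noteq> j \<Longrightarrow> 0 < p i j"
  shows "wvar (permutations_of_set (set (leaves T))) (list_weight p) f \<le>
    2 * (real n ^ 2 / 4) * sum (list_weight p) (permutations_of_set (set (leaves T))) *
      free_energy (set (leaves T)) p f"
  using assms
proof (induction T arbitrary: f)
  case (Leaf i)
  have "wvar (permutations_of_set {i}) (list_weight p) f = 0" by (simp add: wvar_def)
  moreover have "0 \<le> free_energy {i} p f" by (intro free_energy_nonneg) simp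
  ultimately show ?case by simp
next
  case (Branch l q r)
  define X Y where "X = set (leaves l)" and "Y = set (leaves r)"
  define K where "K = 2 * (real n ^ 2 / 4)"
  let ?P = "permutations_of_set :: nat set \<Rightarrow> _" and ?W = "list_weight p" and ?V = "list_weight (shuffle_bias q)"
  let ?\<Omega> = "shuffle_words (card X) (card Y)"
  let ?VW = "\<lambda>(ys, w). ?W ys * ?V w"
  let ?F = "\<lambda>(xs, ys, w). f (interleave w xs ys)"
  have less: "x < y" if "x \<in> X" "y \<in> Y" for x y
    using Branch.prems(2) that by (auto simp: X_def Y_def sorted_wrt_append)
  have pq: "p x y = q \<and> p y x = 1 - q" if "x \<in> X" "y \<in> Y" for x y
    using Branch.prems(1) that by (auto simp: X_def Y_def)
  have q: "1/2 \<le> q" "q < 1" using Branch.prems(1) by auto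
  have fin: "finite X" "finite Y" by (auto simp: X_def Y_def)
  have disj: "X \<inter> Y = {}" using less by fastforce
  have sorted: "sorted_wrt (<) (leaves l)" "sorted_wrt (<) (leaves r)"
    using Branch.prems(2) by (auto simp: sorted_wrt_append)
  then have cards: "card X = length (leaves l)" "card Y = length (leaves r)"
    unfolding X_def Y_def by (auto intro!: distinct_card simp: strict_sorted_iff)
  then have cpos: "1 \<le> card X" "1 \<le> card Y" and cn: "card X + card Y \<le> n"
    using leaves_nonempty[of l] leaves_nonempty[of r] Branch.prems(3)
    by (auto simp: Suc_le_eq)
  have Wpos: "0 < ?W xs" if "xs \<in> ?P Z" "Z \<subseteq> X \<union> Y" for xs Z
    using that Branch.prems(4) by (intro list_weight_pos) (auto simp: permutations_of_set_def X_def Y_def)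
  have Vpos: "0 < ?V w" for w using q by (intro list_weight_bias_pos) auto
  have Wn: "0 \<le> ?W xs" if "xs \<in> ?P X \<or> xs \<in> ?P Y \<or> xs \<in> ?P (X \<union> Y)" for xs
    using that Wpos[of xs X] Wpos[of xs Y] Wpos[of xs "X \<union> Y"] by (auto intro: less_imp_le)
  have Vn: "0 \<le> ?V w" for w using Vpos[of w] by simp
  have IHX: "wvar (?P X) ?W g \<le> K * sum ?W (?P X) * free_energy X p g" for g
    unfolding X_def K_def using Branch.prems sorted by (intro Branch.IH(1)) auto
  have IHY: "wvar (?P Y) ?W g \<le> K * sum ?W (?P Y) * free_energy Y p g" for g
    unfolding Y_def K_def using Branch.prems sorted by (intro Branch.IH(2)) auto
  define D where "D g = (\<Sum>k<card X + card Y - 1. \<Sum>w | w \<in> ?\<Omega> \<and> w ! k \<and> \<not> w ! (k + 1).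
      ?V (swap_next k w) * (g w - g (swap_next k w))\<^sup>2)" for g
  have D_nn: "0 \<le> D g" for g
    unfolding D_def by (intro sum_nonneg mult_nonneg_nonneg Vn zero_le_power2)
  define Zx Zy Zw where "Zx = sum ?W (?P X)" and "Zy = sum ?W (?P Y)" and "Zw = sum ?V ?\<Omega>"
  have Z_nn: "0 \<le> Zx" "0 \<le> Zy" "0 \<le> Zw" "0 \<le> K"
    unfolding Zx_def Zy_def Zw_def K_def using Wn Vn by (simp_all add: sum_nonneg)
  have SP: "wvar ?\<Omega> ?V g \<le> K * Zw * D g" for g
  proof -
    interpret biased_shuffle "card X" "card Y" q using q cpos by unfold_locales auto
    have "wvar ?\<Omega> ?V g \<le> 2 * (real (card X + card Y) ^ 2 / 4) * Zw * D g"
      using shuffle_poincare[of g] by (simp add: Zw_def D_def)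
    also have "\<dots> \<le> K * Zw * D g"
      unfolding K_def using cn Z_nn D_nn by (intro mult_right_mono mult_left_mono divide_right_mono power_mono) auto
    finally show ?thesis .
  qed
  have ZVW: "sum ?VW (?P Y \<times> ?\<Omega>) = Zy * Zw"
    by (simp add: Zy_def Zw_def sum_product sum.cartesian_product)
  let ?Q = "\<lambda>(xs, z). ?W xs * ?VW z"
  have bij: "bij_betw (\<lambda>(xs, ys, w). interleave w xs ys) (?P X \<times> ?P Y \<times> ?\<Omega>) (?P (X \<union> Y))"
    by (rule bij_betw_interleave[OF fin disj])
  have WQ: "?W (case s of (xs, ys, w) \<Rightarrow> interleave w xs ys) = ?Q s" if s: "s \<in> ?P X \<times> ?P Y \<times> ?\<Omega>" for s
  proof -
    obtain xs ys w where e: "s = (xs, ys, w)" by (metis prod.collapse)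
    then have "fits w xs ys" "set xs = X" "set ys = Y"
      using s by (auto simp: fits_def shuffle_words_def permutations_of_set_def distinct_card)
    then show ?thesis using list_weight_interleave[of w xs ys p q] pq e by (simp add: mult.assoc)
  qed
  have Z: "sum ?W (?P (X \<union> Y)) = Zx * (Zy * Zw)"
  proof -
    have "sum ?W (?P (X \<union> Y)) = sum ?Q (?P X \<times> ?P Y \<times> ?\<Omega>)"
      by (subst sum.reindex_bij_betw[OF bij, symmetric]) (intro sum.cong refl WQ)
    also have "\<dots> = Zx * (Zy * Zw)"
      unfolding ZVW[symmetric] Zx_def sum_product sum.cartesian_product by (simp add: case_prod_beta)
    finally show ?thesis .
  qed
  let ?B = "\<lambda>xs. Zw * (\<Sum>w\<in>?\<Omega>. ?V w * (K * Zy * free_energy Y p (\<lambda>ys. ?F (xs, ys, w)))) +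
         Zy * (\<Sum>ys\<in>?P Y. ?W ys * (K * Zw * D (\<lambda>w. ?F (xs, ys, w))))"
  have "wvar (?P (X \<union> Y)) ?W f = wvar (?P X \<times> ?P Y \<times> ?\<Omega>) ?Q (\<lambda>s. f (case s of (xs, ys, w) \<Rightarrow> interleave w xs ys))"
    by (rule wvar_reindex[OF bij, of ?W ?Q]) (rule WQ)
  also have "\<dots> = wvar (?P X \<times> ?P Y \<times> ?\<Omega>) ?Q ?F"
    by (rule arg_cong[where f = "wvar (?P X \<times> ?P Y \<times> ?\<Omega>) ?Q"]) (auto simp: fun_eq_iff)
  also have "\<dots> \<le> (Zy * Zw) * (\<Sum>z\<in>?P Y \<times> ?\<Omega>. ?VW z * wvar (?P X) ?W (\<lambda>xs. ?F (xs, z))) +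
      Zx * (\<Sum>xs\<in>?P X. ?W xs * wvar (?P Y \<times> ?\<Omega>) ?VW (\<lambda>z. ?F (xs, z)))"
    unfolding ZVW[symmetric] Zx_def
    by (intro wvar_prod_le) (auto simp: Wn Vn)
  also have "\<dots> \<le> (Zy * Zw) * (\<Sum>z\<in>?P Y \<times> ?\<Omega>. ?VW z * (K * Zx * free_energy X p (\<lambda>xs. ?F (xs, z)))) +
      Zx * (\<Sum>xs\<in>?P X. ?W xs * ?B xs)"
  proof (intro add_mono mult_left_mono sum_mono)
    show "wvar (?P X) ?W (\<lambda>xs. ?F (xs, z)) \<le> K * Zx * free_energy X p (\<lambda>xs. ?F (xs, z))" for z
      unfolding Zx_def by (rule IHX)
    show "0 \<le> ?VW z" if "z \<in> ?P Y \<times> ?\<Omega>" for z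
      using that by (auto simp: Wn Vn)
    fix xs assume xs: "xs \<in> ?P X"
    have "wvar (?P Y \<times> ?\<Omega>) ?VW (\<lambda>z. ?F (xs, z)) \<le>
         Zw * (\<Sum>w\<in>?\<Omega>. ?V w * wvar (?P Y) ?W (\<lambda>ys. ?F (xs, ys, w))) +
         Zy * (\<Sum>ys\<in>?P Y. ?W ys * wvar ?\<Omega> ?V (\<lambda>w. ?F (xs, ys, w)))"
      unfolding Zw_def Zy_def
      by (intro wvar_prod_le) (auto simp: Wn Vn)
    also have "\<dots> \<le> ?B xs"
      using Z_nn Wn Vn IHY SP
      by (intro add_mono mult_left_mono sum_mono) (simp_all add: Zy_def)
    finally show "wvar (?P Y \<times> ?\<Omega>) ?VW (\<lambda>z. ?F (xs, z)) \<le>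
         ?B xs" .
    show "0 \<le> ?W xs" using Wn xs by simp
  qed (use Z_nn in auto)
  also have "\<dots> = K * (Zx * (Zy * Zw)) * (
     (\<Sum>z\<in>?P Y \<times> ?\<Omega>. ?VW z * free_energy X p (\<lambda>xs. ?F (xs, z))) +
     (\<Sum>xs\<in>?P X. ?W xs * (\<Sum>w\<in>?\<Omega>. ?V w * free_energy Y p (\<lambda>ys. ?F (xs, ys, w)))) +
     (\<Sum>xs\<in>?P X. ?W xs * (\<Sum>ys\<in>?P Y. ?W ys * D (\<lambda>w. ?F (xs, ys, w)))))"
  proof -
    have c: "(\<Sum>i\<in>I. a i * (k * e * b i)) = k * e * (\<Sum>i\<in>I. a i * b i)" for a b :: "'c \<Rightarrow> real" and k e I
      by (simp add: sum_distrib_left mult_ac)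
    have d: "(\<Sum>i\<in>I. a i * (u * (k * v * b i) + v * (k * u * b' i))) =
       k * u * v * ((\<Sum>i\<in>I. a i * b i) + (\<Sum>i\<in>I. a i * b' i))" for a b b' :: "'c \<Rightarrow> real" and k u v I
      by (simp add: sum_distrib_left sum.distrib[symmetric] algebra_simps)
    show ?thesis unfolding c d by (simp add: algebra_simps)
  qed
  also have "\<dots> \<le> K * (Zx * (Zy * Zw)) * free_energy (X \<union> Y) p f"
    unfolding D_def
    by (intro mult_left_mono free_energy_merge[OF fin less pq q])
       (use Z_nn in \<open>simp_all add: Wn\<close>)
  finally show ?case unfolding Z[symmetric] by (simp add: K_def X_def Y_def)
qed

section \<open>Comparison with nearest neighbor swaps\<close>

primrec move_right :: "nat \<Rightarrow> nat \<Rightarrow> 'a list \<Rightarrow> 'a list" where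
  "move_right z 0 xs = xs"
| "move_right z (Suc r) xs = swap_next (z + r) (move_right z r xs)"

lemma length_move_right [simp]: "length (move_right z r xs) = length xs"
  by (induction r) auto

lemma mset_move_right: "z + r < length xs \<Longrightarrow> mset (move_right z r xs) = mset xs"
  by (induction r) (simp_all add: mset_swap_next)

lemma move_right_append:
  "r \<le> length S \<Longrightarrow> move_right (length B) r (B @ a # S @ R) = B @ take r S @ a # drop r S @ R"
proof (induction r)
  case (Suc r)
  then have d: "drop r S = S ! r # drop (Suc r) S" by (simp add: Cons_nth_drop_Suc)
  have t: "take (Suc r) S = take r S @ [S ! r]" using Suc.prems by (simp add: take_Suc_conv_app_nth)
  have l: "length B + r = length (B @ take r S)" using Suc.prems by simp
  show ?case
    using Suc swap_next_append[of "B @ take r S" a "S ! r" "drop (Suc r) S @ R"]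
    by (simp add: d t l del: length_append)
qed simp

text \<open>A composition of involutions; it lets the start of a move be recovered from any state on
  its way.\<close>

lemma inj_on_move_right:
  assumes "z + r < N" shows "inj_on (move_right z r) {xs. length xs = N}"
  using assms
proof (induction r)
  case (Suc r)
  have inj: "inj_on (move_right z r) {xs :: 'a list. length xs = N}"
    by (rule Suc.IH) (use Suc.prems in simp)
  have inv: "swap_next (z + r) (swap_next (z + r) (move_right z r zs)) = move_right z r zs"
    if "length zs = N" for zs :: "'a list"
    by (rule swap_next_swap_next) (use Suc.prems that in simp)
  show ?case
  proof (rule inj_onI)
    fix xs ys :: "'a list"
    assume l: "xs \<in> {xs. length xs = N}" "ys \<in> {xs. length xs = N}"
      and e: "move_right z (Suc r) xs = move_right z (Suc r) ys"
    have "move_right z r xs = swap_next (z + r) (move_right z (Suc r) xs)" using inv[of xs] l by simp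
    also have "\<dots> = move_right z r ys" unfolding e using inv[of ys] l by simp
    finally show "xs = ys" using inj l by (blast dest: inj_onD)
  qed
qed (simp add: inj_on_def)

text \<open>
  The effect on \<open>ks @ [c]\<close> of letting \<open>c\<close> jump left over the entries \<open>\<ge> \<theta>\<close> one at a time, each of them
  taking the place that \<open>c\<close> leaves.
\<close>

primrec rotate_large :: "nat \<Rightarrow> nat \<Rightarrow> nat list \<Rightarrow> nat list" where
  "rotate_large \<theta> c [] = [c]"
| "rotate_large \<theta> c (k # ks) = (if k < \<theta> then k # rotate_large \<theta> c ks else c # rotate_large \<theta> k ks)"

lemma length_rotate_large [simp]: "length (rotate_large \<theta> c ks) = Suc (length ks)"
  by (induction ks arbitrary: c) auto

lemma mset_rotate_large [simp]: "mset (rotate_large \<theta> c ks) = add_mset c (mset ks)"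
  by (induction ks arbitrary: c) (auto simp: add_mset_commute)

lemma set_rotate_large [simp]: "set (rotate_large \<theta> c ks) = insert c (set ks)"
  by (metis mset_rotate_large set_mset_add_mset_insert set_mset_mset)

text \<open>The entry \<open>c\<close> takes the place of the first large entry, or the end; what
  follows depends on the displaced entry but not on \<open>c\<close>. This is why consecutive stages
  of the path differ by one exchange.\<close>

lemma rotate_large_split: "\<exists>Y. \<forall>c. rotate_large \<theta> c ks = takeWhile (\<lambda>k. k < \<theta>) ks @ c # Y"
  by (induction ks) auto

text \<open>The list can be decoded from the left: the carried entry is never below \<theta>, so a
  head below \<theta> is an entry left in place, and any other head is the carried one.\<close>

lemma rotate_large_inj:
  assumes "rotate_large \<theta> c ks = rotate_large \<theta> c' ks'" "\<theta> \<le> c" "\<theta> \<le> c'"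
  shows "c = c' \<and> ks = ks'"
  using assms
proof (induction ks arbitrary: c c' ks')
  case Nil
  from arg_cong[OF Nil(1), of length] have "ks' = []" by simp
  then show ?case using Nil by simp
next
  case (Cons k ks)
  have "length ks' = length (k # ks)"
    using arg_cong[OF Cons(2), of length] unfolding length_rotate_large by simp
  then obtain k' ks'' where ks': "ks' = k' # ks''" by (cases ks') auto
  show ?case
    using Cons.prems Cons.IH[of c c' ks''] Cons.IH[of k k' ks''] unfolding ks'
    by (auto split: if_splits)
qed

lemma telescope_move_right:
  fixes f :: "'a list \<Rightarrow> real"
  shows "f xs - f (move_right z k xs) =
    (\<Sum>r<k. f (move_right z r xs) - f (move_right z (Suc r) xs))"
  by (induction k) simp_all

abbreviation jump :: "('a list \<Rightarrow> real) \<Rightarrow> nat \<Rightarrow> 'a list \<Rightarrow> real" where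
  "jump f l xs \<equiv> f xs - f (swap_next l xs)"

text \<open>Both ends are moved to the common state \<open>B @ S @ b # a # R\<close>, the first by
  \<open>length S + 1\<close> swaps of \<open>a\<close>, the second by \<open>length S\<close> swaps
  of \<open>b\<close>. So each half of the path is a rightward move from one of the ends.\<close>

lemma exchange_path:
  fixes f :: "'a list \<Rightarrow> real" and B S R :: "'a list"
  defines "z \<equiv> length B"
  shows "\<bar>f (B @ a # S @ b # R) - f (B @ b # S @ a # R)\<bar> \<le>
    (\<Sum>r\<le>length S. \<bar>jump f (z + r) (move_right z r (B @ a # S @ b # R))\<bar> +
       \<bar>jump f (z + r) (move_right z r (B @ b # S @ a # R))\<bar>)"
proof -
  let ?k = "length S" and ?xs = "B @ a # S @ b # R" and ?ys = "B @ b # S @ a # R"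
  have e1: "move_right z (Suc ?k) ?xs = B @ S @ b # a # R"
    using move_right_append[of "length (S @ [b])" "S @ [b]" B a R] by (simp add: z_def)
  have e2: "move_right z ?k ?ys = B @ S @ b # a # R"
    using move_right_append[of ?k S B b "a # R"] by (simp add: z_def)
  have "f ?xs - f ?ys = (f ?xs - f (move_right z (Suc ?k) ?xs)) - (f ?ys - f (move_right z ?k ?ys))"
    unfolding e1 e2 by simp
  then have e: "f ?xs - f ?ys =
      (\<Sum>r<Suc ?k. jump f (z + r) (move_right z r ?xs)) - (\<Sum>r<?k. jump f (z + r) (move_right z r ?ys))"
    unfolding telescope_move_right by simp
  have "\<bar>f ?xs - f ?ys\<bar> \<le> (\<Sum>r<Suc ?k. \<bar>jump f (z + r) (move_right z r ?xs)\<bar>)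
      + (\<Sum>r<?k. \<bar>jump f (z + r) (move_right z r ?ys)\<bar>)"
    unfolding e by (intro order_trans[OF abs_triangle_ineq4] add_mono sum_abs)
  \<comment> \<open>The shorter sum is padded by one nonnegative term, so that both run over the
    same \<open>r\<close>.\<close>
  also have "\<dots> \<le> (\<Sum>r<Suc ?k. \<bar>jump f (z + r) (move_right z r ?xs)\<bar>)
      + (\<Sum>r<Suc ?k. \<bar>jump f (z + r) (move_right z r ?ys)\<bar>)"
    by (rule add_left_mono) simp
  finally show ?thesis unfolding lessThan_Suc_atMost sum.distrib .
qed

lemma permutations_of_set_mset_cong:
  "xs \<in> permutations_of_set X \<Longrightarrow> mset ys = mset xs \<Longrightarrow> ys \<in> permutations_of_set X"
  using mset_eq_setD[of ys xs] mset_eq_imp_distinct_iff[of ys xs]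
  by (simp add: permutations_of_set_def)

lemma prod_list_distrib:
  fixes g h :: "'a \<Rightarrow> real"
  shows "(\<Prod>x\<leftarrow>xs. g x * h x) = (\<Prod>x\<leftarrow>xs. g x) * (\<Prod>x\<leftarrow>xs. h x)"
  by (induction xs) auto

lemma prod_list_mono:
  fixes g h :: "'a \<Rightarrow> real"
  shows "(\<And>x. x \<in> set xs \<Longrightarrow> 0 \<le> g x \<and> g x \<le> h x) \<Longrightarrow>
    0 \<le> (\<Prod>x\<leftarrow>xs. g x) \<and> (\<Prod>x\<leftarrow>xs. g x) \<le> (\<Prod>x\<leftarrow>xs. h x)"
proof (induction xs)
  case (Cons x xs)
  then have "0 \<le> (\<Prod>x\<leftarrow>xs. g x) \<and> (\<Prod>x\<leftarrow>xs. g x) \<le> (\<Prod>x\<leftarrow>xs. h x)" by simp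
  moreover have "0 \<le> g x \<and> g x \<le> h x" using Cons.prems by simp
  ultimately show ?case by (simp add: mult_mono)
qed simp

lemma prod_list_nonneg_real: "\<forall>x\<in>set xs. (0 :: real) \<le> g x \<Longrightarrow> 0 \<le> (\<Prod>x\<leftarrow>xs. g x)"
  by (induction xs) auto

text \<open>Interchanges the sum over the exchanges \<open>t\<close> with the sum over the steps
  \<open>u\<close> of their paths. The flag of \<open>J\<close> tells the two halves of
  \<open>exchange_path\<close> apart; each costs \<open>E u\<close>, which doubles the factor
  \<open>2 * N\<close>.\<close>

lemma congestion_bound:
  fixes c d :: "'t \<Rightarrow> real" and J :: "bool \<Rightarrow> 'u \<Rightarrow> 't \<Rightarrow> real"
  assumes fin: "finite T" "finite Q" and c: "\<And>t. t \<in> T \<Longrightarrow> 0 \<le> c t" and N: "0 \<le> N"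
    and path: "\<And>t. t \<in> T \<Longrightarrow> d t \<le> 2 * N * (\<Sum>u | u \<in> Q \<and> R t u. J True u t + J False u t)"
    and edge: "\<And>u b. u \<in> Q \<Longrightarrow> (\<Sum>t | t \<in> T \<and> R t u. c t * J b u t) \<le> E u"
  shows "(\<Sum>t\<in>T. c t * d t) \<le> 4 * N * sum E Q"
proof -
  have "(\<Sum>t\<in>T. c t * d t) \<le> (\<Sum>t\<in>T. c t * (2 * N * (\<Sum>u | u \<in> Q \<and> R t u. J True u t + J False u t)))"
    using path c by (intro sum_mono mult_left_mono) auto
  also have "\<dots> = 2 * N * (\<Sum>t\<in>T. \<Sum>u | u \<in> Q \<and> R t u. c t * J True u t + c t * J False u t)"
    by (simp add: sum_distrib_left algebra_simps)
  also have "(\<Sum>t\<in>T. \<Sum>u | u \<in> Q \<and> R t u. c t * J True u t + c t * J False u t) =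
      (\<Sum>u\<in>Q. \<Sum>t | t \<in> T \<and> R t u. c t * J True u t + c t * J False u t)"
    by (rule sum.swap_restrict[OF fin])
  also have "2 * N * \<dots> \<le> 2 * N * (\<Sum>u\<in>Q. 2 * E u)"
  proof (intro mult_left_mono sum_mono)
    fix u assume "u \<in> Q"
    then show "(\<Sum>t | t \<in> T \<and> R t u. c t * J True u t + c t * J False u t) \<le> 2 * E u"
      using edge[of u True] edge[of u False] by (simp add: sum.distrib)
  qed (use N in simp)
  finally show ?thesis by (simp flip: sum_distrib_left)
qed

section \<open>Nearest neighbor energies, and weights along the paths\<close>

definition edge_energy :: "nat set \<Rightarrow> (nat \<Rightarrow> nat \<Rightarrow> real) \<Rightarrow> (nat list \<Rightarrow> real) \<Rightarrow> nat \<Rightarrow> real" where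
  "edge_energy X p f l = (\<Sum>xs\<in>permutations_of_set X.
     min (list_weight p xs) (list_weight p (swap_next l xs)) * (jump f l xs)\<^sup>2)"

definition nn_energy :: "nat set \<Rightarrow> (nat \<Rightarrow> nat \<Rightarrow> real) \<Rightarrow> (nat list \<Rightarrow> real) \<Rightarrow> real" where
  "nn_energy X p f = (\<Sum>l<card X - 1. edge_energy X p f l)"

text \<open>The alternative of weak monotonicity in the second index, together with its
  complementary form. The alternative in the first index is reduced to it by
  \<open>mirror\<close>.\<close>

locale monotone_bias =
  fixes X :: "nat set" and p :: "nat \<Rightarrow> nat \<Rightarrow> real"
  assumes finX: "finite X"
    and pos: "a \<in> X \<Longrightarrow> b \<in> X \<Longrightarrow> a \<noteq> b \<Longrightarrow> 0 < p a b"
    and half: "a \<in> X \<Longrightarrow> b \<in> X \<Longrightarrow> a < b \<Longrightarrow> p b a \<le> p a b"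
    and mono: "a \<in> X \<Longrightarrow> b \<in> X \<Longrightarrow> c \<in> X \<Longrightarrow> a < b \<Longrightarrow> b \<le> c \<Longrightarrow> p a b \<le> p a c"
    and mono': "a \<in> X \<Longrightarrow> b \<in> X \<Longrightarrow> c \<in> X \<Longrightarrow> a < b \<Longrightarrow> b \<le> c \<Longrightarrow> p c a \<le> p b a"
begin

abbreviation "P \<equiv> permutations_of_set X"
abbreviation "W \<equiv> list_weight p"
abbreviation "n \<equiv> card X"

lemma W_pos: "xs \<in> P \<Longrightarrow> 0 < W xs"
  using pos by (intro list_weight_pos) (auto simp: permutations_of_set_def)

lemma length_P: "xs \<in> P \<Longrightarrow> length xs = n"
  by (auto simp: permutations_of_set_def distinct_card)

lemma swap_next_P: "xs \<in> P \<Longrightarrow> l + 1 < n \<Longrightarrow> swap_next l xs \<in> P"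
  using permutations_of_set_mset_cong mset_swap_next length_P by metis

lemma edge_energy_nonneg:
  assumes "l + 1 < n" shows "0 \<le> edge_energy X p f l"
  unfolding edge_energy_def
  by (intro sum_nonneg mult_nonneg_nonneg)
     (auto intro!: less_imp_le W_pos swap_next_P[OF _ assms, unfolded One_nat_def])

lemma nn_energy_nonneg: "0 \<le> nn_energy X p f"
  unfolding nn_energy_def by (intro sum_nonneg edge_energy_nonneg) auto

lemma edge_energy_ge:
  assumes l: "l + 1 < n" and inj: "inj_on h T"
    and T: "\<And>t. t \<in> T \<Longrightarrow> h t \<in> P \<and> c t \<le> W (h t) \<and> c t \<le> W (swap_next l (h t))"
  shows "(\<Sum>t\<in>T. c t * (jump f l (h t))\<^sup>2) \<le> edge_energy X p f l"
  unfolding edge_energy_def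
proof (rule sum_le_inj[OF _ inj])
  show "0 \<le> min (W xs) (W (swap_next l xs)) * (jump f l xs)\<^sup>2" if "xs \<in> P" for xs
    using W_pos[OF that] W_pos[OF swap_next_P[OF that l]] by simp
  show "c t * (jump f l (h t))\<^sup>2 \<le> min (W (h t)) (W (swap_next l (h t))) * (jump f l (h t))\<^sup>2" if "t \<in> T" for t
    using T[OF that] by (intro mult_right_mono) auto
qed (use T in auto)

text \<open>Each step puts a smaller entry in front of a larger one, which \<open>half\<close>
  favors.\<close>

lemma W_move:
  assumes "B @ a # S1 @ R \<in> P" "\<forall>s\<in>set S1. s < a"
  shows "W (B @ a # S1 @ R) \<le> W (B @ S1 @ a # R)"
  using assms
proof (induction S1 arbitrary: B)
  case (Cons s S1)
  have X: "s \<in> X" "a \<in> X" "s < a" using Cons.prems by (auto simp: permutations_of_set_def)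
  have m: "(B @ [s]) @ a # S1 @ R \<in> P"
    by (rule permutations_of_set_mset_cong[OF Cons.prems(1)]) simp
  have "W (B @ a # s # S1 @ R) * p s a = W (B @ s # a # S1 @ R) * p a s" by (rule list_weight_swap)
  also have "\<dots> \<le> W (B @ s # a # S1 @ R) * p s a"
    using half[OF X(1,2,3)] W_pos[OF m] by (intro mult_left_mono) auto
  finally have "W (B @ a # s # S1 @ R) \<le> W (B @ s # a # S1 @ R)" using pos[of s a] X by simp
  also have "\<dots> \<le> W (B @ s # S1 @ a # R)" using Cons.IH[OF m] Cons.prems by simp
  finally show ?case by simp
qed simp

text \<open>This is where monotonicity enters. Relative to each smaller \<open>s\<close> in between,
  the larger entry \<open>b\<close> gains at least as much by coming after \<open>s\<close> as
  \<open>c\<close> does, and it loses at least as much by coming before \<open>s\<close>. Pairs with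
  entries of \<open>B\<close> and \<open>R\<close> keep their order up to a rearrangement of equal
  factors.\<close>

lemma W_exchange:
  assumes P: "B @ b # S @ c # R \<in> P" and S: "\<forall>s\<in>set S. s < c" and cb: "c < b"
  shows "W (B @ b # S @ c # R) \<le> W (B @ c # S @ b # R)"
proof -
  have X: "b \<in> X" "c \<in> X" "set S \<subseteq> X" using P by (auto simp: permutations_of_set_def)
  define Q where "Q = W S * (\<Prod>s\<leftarrow>S. \<Prod>y\<leftarrow>R. p s y) * (\<Prod>y\<leftarrow>R. p b y) * (\<Prod>y\<leftarrow>R. p c y) * W R"
  have e: "W (x # S @ y # R) = ((\<Prod>s\<leftarrow>S. p x s) * (\<Prod>s\<leftarrow>S. p s y) * p x y) * Q"
    if "x = b \<and> y = c \<or> x = c \<and> y = b" for x y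
    using that by (auto simp: Q_def list_weight_append prod_list_distrib mult_ac)
  have "W (b # S @ c # R) \<le> W (c # S @ b # R)"
  proof -
    have "0 \<le> (\<Prod>s\<leftarrow>S. p b s) \<and> (\<Prod>s\<leftarrow>S. p b s) \<le> (\<Prod>s\<leftarrow>S. p c s)"
      using X S cb pos mono' by (intro prod_list_mono) (auto intro!: less_imp_le[OF pos] dest!: subsetD)
    moreover have "0 \<le> (\<Prod>s\<leftarrow>S. p s c) \<and> (\<Prod>s\<leftarrow>S. p s c) \<le> (\<Prod>s\<leftarrow>S. p s b)"
      using X S cb pos mono by (intro prod_list_mono) (auto intro!: less_imp_le[OF pos] dest!: subsetD)
    moreover have "0 \<le> p b c" "p b c \<le> p c b" using X cb pos[of b c] half[of c b] by auto
    ultimately have le: "(\<Prod>s\<leftarrow>S. p b s) * (\<Prod>s\<leftarrow>S. p s c) * p b c \<le> (\<Prod>s\<leftarrow>S. p c s) * (\<Prod>s\<leftarrow>S. p s b) * p c b"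
      by (intro mult_mono mult_nonneg_nonneg) auto
    have "0 < W (b # S @ c # R)"
      using P pos by (intro list_weight_pos) (auto simp: permutations_of_set_def)
    moreover have "0 \<le> (\<Prod>s\<leftarrow>S. p b s) * (\<Prod>s\<leftarrow>S. p s c) * p b c"
      using \<open>0 \<le> (\<Prod>s\<leftarrow>S. p b s) \<and> _\<close> \<open>0 \<le> (\<Prod>s\<leftarrow>S. p s c) \<and> _\<close> \<open>0 \<le> p b c\<close> by simp
    ultimately have "0 \<le> Q" using e[of b c] by (metis less_eq_real_def zero_less_mult_pos not_less mult_nonneg_nonpos)
    then have "((\<Prod>s\<leftarrow>S. p b s) * (\<Prod>s\<leftarrow>S. p s c) * p b c) * Q \<le> ((\<Prod>s\<leftarrow>S. p c s) * (\<Prod>s\<leftarrow>S. p s b) * p c b) * Q"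
      using le by (intro mult_right_mono)
    then show ?thesis by (simp only: e[of b c] e[of c b] refl simp_thms)
  qed
  moreover have "0 \<le> W B * (\<Prod>x\<leftarrow>B. \<Prod>y\<leftarrow>b # S @ c # R. p x y)"
  proof -
    have "0 < p x y" if "x \<in> set B" "y \<in> set (b # S @ c # R)" for x y
      using that P by (intro pos) (auto simp: permutations_of_set_def)
    then have "0 \<le> (\<Prod>x\<leftarrow>B. \<Prod>y\<leftarrow>b # S @ c # R. p x y)"
      by (intro prod_list_nonneg_real ballI) (auto intro: less_imp_le)
    moreover have "0 < W B" using P pos by (intro list_weight_pos) (auto simp: permutations_of_set_def)
    ultimately show ?thesis by simp
  qed
  moreover have "(\<Prod>y\<leftarrow>c # S @ b # R. p x y) = (\<Prod>y\<leftarrow>b # S @ c # R. p x y)" for x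
    by (rule prod_list_mset_cong) simp
  ultimately show ?thesis
    unfolding list_weight_append[of p B] by (simp only: mult_left_mono)
qed

text \<open>Up to the crossing of \<open>a\<close> and \<open>b\<close> the state is reached from
  the given end by moving \<open>a\<close> over smaller entries. The state just after the crossing
  is reached in the same way from the other end by moving \<open>b\<close>.\<close>

lemma W_exchange_path:
  assumes P: "B @ a # S @ b # R \<in> P" and S: "\<forall>s\<in>set S. s < a \<and> s < b" and r: "r \<le> length S"
    and c: "c \<le> W (B @ a # S @ b # R)" "c \<le> W (B @ b # S @ a # R)"
    and h_def: "h = move_right (length B) r (B @ a # S @ b # R)"
  shows "h \<in> P \<and> c \<le> W h \<and> c \<le> W (swap_next (length B + r) h)"
proof -
  have len: "length B + length S + 2 \<le> n" using length_P[OF P] by simp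
  have P': "B @ b # S @ a # R \<in> P" by (rule permutations_of_set_mset_cong[OF P]) simp
  have hP: "h \<in> P" unfolding h_def
    by (rule permutations_of_set_mset_cong[OF P]) (use r len length_P[OF P] in \<open>simp add: mset_move_right\<close>)
  have step: "W (B @ x # S @ y # R) \<le> W (B @ take k S @ x # drop k S @ y # R)"
    if "B @ x # S @ y # R \<in> P" "\<forall>s\<in>set S. s < x" for x y k
    using W_move[of B x "take k S" "drop k S @ y # R"] that
    by (simp add: append_assoc[symmetric] del: append_assoc) (meson in_set_takeD)
  have h: "h = B @ take r S @ a # drop r S @ b # R"
    unfolding h_def by (rule move_right_append[OF r])
  have "c \<le> W h" unfolding h using step[of a b r] P S c by force
  moreover have "c \<le> W (swap_next (length B + r) h)"
  proof (cases "r < length S")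
    case True
    have "swap_next (length B + r) h = move_right (length B) (Suc r) (B @ a # S @ b # R)"
      by (simp add: h_def)
    also have "\<dots> = B @ take (Suc r) S @ a # drop (Suc r) S @ b # R"
      using True by (intro move_right_append) simp
    finally show ?thesis using step[of a b "Suc r"] P S c by force
  next
    case False
    then have "h = (B @ S) @ a # b # R" "length B + r = length (B @ S)" using h r by auto
    then have "swap_next (length B + r) h = B @ S @ b # a # R"
      using swap_next_append[of "B @ S" a b R] by simp
    then show ?thesis using step[of b a "length S"] P' S c by force
  qed
  ultimately show ?thesis using hP by simp
qed

text \<open>Stage \<open>length us\<close> is the initial list and in stage 0 the jumping is
  complete, so \<open>s\<close> falls along the path. The same definition serves the leftward leg of
  \<open>j\<close> and, read backwards from the exchanged permutation, the rightward leg of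
  \<open>i\<close>.\<close>

definition stage :: "nat \<Rightarrow> nat \<times> nat list \<times> nat list \<times> nat \<times> nat list \<Rightarrow> nat list" where
  "stage s = (\<lambda>(\<theta>, A, us, c, R). (A @ take s us) @ rotate_large \<theta> c (drop s us) @ R)"

text \<open>Addresses of swaps on the path: \<open>s\<close> is the place of a large entry that
  \<open>c\<close> jumps over between the stages \<open>Suc s\<close> and \<open>s\<close>, and
  \<open>r\<close> counts the swaps in \<open>exchange_path\<close>, up to the number of small
  entries skipped.\<close>

definition active :: "nat \<Rightarrow> nat list \<Rightarrow> (nat \<times> nat) set" where
  "active \<theta> us = {(s, r). s < length us \<and> \<not> us ! s < \<theta> \<and>
     r \<le> length (takeWhile (\<lambda>k. k < \<theta>) (drop (Suc s) us))}"

lemma mset_stage: "mset (stage s (\<theta>, A, us, c, R)) = mset (A @ us @ c # R)"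
proof -
  have "mset us = mset (take s us) + mset (drop s us)" by (metis append_take_drop_id mset_append)
  then show ?thesis by (simp add: stage_def)
qed

lemma active_subset: "active \<theta> us \<subseteq> (SIGMA s : {..<length us}. {..<length us - s})"
proof -
  have le: "length (takeWhile (\<lambda>k. k < \<theta>) (drop (Suc s) us)) \<le> length us - Suc s" for s
    using length_takeWhile_le[of "\<lambda>k. k < \<theta>" "drop (Suc s) us"] by simp
  then have "r < length us - s"
    if "s < length us" "r \<le> length (takeWhile (\<lambda>k. k < \<theta>) (drop (Suc s) us))" for s r
    using that le[of s] by linarith
  then show ?thesis unfolding active_def by auto
qed

text \<open>
  At a position \<open>s + r\<close> the only active block is the one that starts at the last large entry up to it.
\<close>

lemma card_active: "card (active \<theta> us) \<le> length us"
proof -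
  let ?Q = "\<lambda>k. k < \<theta>"
  have no: False if a: "(s, r) \<in> active \<theta> us" "(s', r') \<in> active \<theta> us" "s + r = s' + r'" "s < s'" for s r s' r'
  proof -
    have r: "r \<le> length (takeWhile ?Q (drop (Suc s) us))" "\<not> ?Q (us ! s')" "s' < length us"
      using a by (auto simp: active_def)
    have lt: "s' - Suc s < length (takeWhile ?Q (drop (Suc s) us))" using r a by simp
    then have "?Q (takeWhile ?Q (drop (Suc s) us) ! (s' - Suc s))"
      by (meson nth_mem set_takeWhileD)
    moreover have "takeWhile ?Q (drop (Suc s) us) ! (s' - Suc s) = us ! s'"
      using lt r a by (simp add: takeWhile_nth)
    ultimately show False using r by simp
  qed
  have "inj_on (\<lambda>(s, r). s + r) (active \<theta> us)"
    using no by (auto simp: inj_on_def) (metis add_left_cancel linorder_neqE_nat)+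
  moreover have "(\<lambda>(s, r). s + r) ` active \<theta> us \<subseteq> {..<length us}" using active_subset by fastforce
  ultimately show ?thesis using card_inj_on_le[of _ "active \<theta> us" "{..<length us}"] by fastforce
qed

lemma stage_step:
  assumes s: "s < length us" "\<not> us ! s < \<theta>" and c: "\<theta> \<le> c"
  defines "S \<equiv> takeWhile (\<lambda>k. k < \<theta>) (drop (Suc s) us)"
  obtains Y where "stage s (\<theta>, A, us, c, R) = (A @ take s us) @ c # S @ us ! s # Y"
    "stage (Suc s) (\<theta>, A, us, c, R) = (A @ take s us) @ us ! s # S @ c # Y"
    "\<forall>k\<in>set S. k < c \<and> k < us ! s"
proof -
  have d: "drop s us = us ! s # drop (Suc s) us" using s by (simp add: Cons_nth_drop_Suc)
  have t: "take (Suc s) us = take s us @ [us ! s]" using s by (simp add: take_Suc_conv_app_nth)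
  obtain Y where Y: "\<And>c. rotate_large \<theta> c (drop (Suc s) us) = S @ c # Y"
    unfolding S_def using rotate_large_split by blast
  have S: "\<forall>k\<in>set S. k < \<theta>" unfolding S_def by (auto dest: set_takeWhileD)
  show ?thesis
  proof (rule that[of "Y @ R"])
    show "stage s (\<theta>, A, us, c, R) = (A @ take s us) @ c # S @ us ! s # Y @ R"
      using s by (simp add: stage_def d Y)
    show "stage (Suc s) (\<theta>, A, us, c, R) = (A @ take s us) @ us ! s # S @ c # Y @ R"
      by (simp add: stage_def t Y)
  qed (use S s c in fastforce)
qed

lemma stage_small:
  assumes "s < length us" "us ! s < \<theta>"
  shows "stage (Suc s) (\<theta>, A, us, c, R) = stage s (\<theta>, A, us, c, R)"
proof -
  have "drop s us = us ! s # drop (Suc s) us" using assms by (simp add: Cons_nth_drop_Suc)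
  moreover have "take (Suc s) us = take s us @ [us ! s]" using assms by (simp add: take_Suc_conv_app_nth)
  ultimately show ?thesis using assms by (simp add: stage_def)
qed

text \<open>With \<open>s\<close> falling, each jump puts \<open>c\<close> in front of a larger
  entry across smaller ones, so \<open>W_exchange\<close> applies. The condition concerns only
  entries already passed, which lets the leftward leg be followed until just before the exchange
  with \<open>i\<close>.\<close>

lemma W_stage:
  assumes P: "A @ us @ c # R \<in> P" and c: "\<theta> \<le> c" and us: "\<forall>k\<in>set (drop s us). k < \<theta> \<or> c < k"
    and s: "s \<le> length us"
  shows "W (A @ us @ c # R) \<le> W (stage s (\<theta>, A, us, c, R))"
  using s us
proof (induction rule: inc_induct)
  case base
  then show ?case by (simp add: stage_def)
next
  case (step s)
  let ?t = "(\<theta>, A, us, c, R)"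
  have d: "drop s us = us ! s # drop (Suc s) us" using step by (simp add: Cons_nth_drop_Suc)
  have "W (stage (Suc s) ?t) \<le> W (stage s ?t)"
  proof (cases "us ! s < \<theta>")
    case True
    then show ?thesis using stage_small step by simp
  next
    case False
    obtain Y where Y: "stage s ?t = (A @ take s us) @ c # takeWhile (\<lambda>k. k < \<theta>) (drop (Suc s) us) @ us ! s # Y"
      "stage (Suc s) ?t = (A @ take s us) @ us ! s # takeWhile (\<lambda>k. k < \<theta>) (drop (Suc s) us) @ c # Y"
      "\<forall>k\<in>set (takeWhile (\<lambda>k. k < \<theta>) (drop (Suc s) us)). k < c \<and> k < us ! s"
      using stage_step[OF _ False c] step by metis
    have "stage (Suc s) ?t \<in> P" by (rule permutations_of_set_mset_cong[OF P mset_stage])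
    then show ?thesis
      unfolding Y(1,2) by (rule W_exchange) (use Y(3) step.prems False d in auto)
  qed
  then show ?case using step d by simp
qed

lemma stage_path:
  assumes c: "\<theta> \<le> c" and t_def: "t = (\<theta>, A, us, c, R)" and z_def: "z = (\<lambda>s. length A + s)" and n: "length us \<le> n"
  shows "(f (stage (length us) t) - f (stage 0 t))\<^sup>2 \<le>
     2 * real n * (\<Sum>(s, r)\<in>active \<theta> us. (jump f (z s + r) (move_right (z s) r (stage (Suc s) t)))\<^sup>2 +
        (jump f (z s + r) (move_right (z s) r (stage s t)))\<^sup>2)"
proof -
  define a b where "a s r = \<bar>jump f (z s + r) (move_right (z s) r (stage (Suc s) t))\<bar>"
    and "b s r = \<bar>jump f (z s + r) (move_right (z s) r (stage s t))\<bar>" for s r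
  define I where "I s = {r. (s, r) \<in> active \<theta> us}" for s
  have act: "active \<theta> us = (SIGMA s : {..<length us}. I s)" by (auto simp: I_def active_def)
  have finI: "finite (I s)" for s unfolding I_def by (auto simp: active_def)
  have step: "\<bar>f (stage (Suc s) t) - f (stage s t)\<bar> \<le> (\<Sum>r\<in>I s. a s r + b s r)" if s: "s < length us" for s
  proof (cases "us ! s < \<theta>")
    case True
    then show ?thesis using stage_small[OF s True] by (simp add: t_def a_def b_def sum_nonneg)
  next
    case False
    let ?S = "takeWhile (\<lambda>k. k < \<theta>) (drop (Suc s) us)"
    obtain Y where Y: "stage s t = (A @ take s us) @ c # ?S @ us ! s # Y"
        "stage (Suc s) t = (A @ take s us) @ us ! s # ?S @ c # Y"
      using stage_step[OF s False c] unfolding t_def by metis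
    have z: "z s = length (A @ take s us)" using s by (simp add: z_def)
    have "I s = {..length ?S}" using False s by (auto simp: I_def active_def)
    then show ?thesis
      unfolding a_def b_def Y z using exchange_path[of f "A @ take s us" "us ! s" ?S c Y] by simp
  qed
  have "\<bar>f (stage (length us) t) - f (stage 0 t)\<bar> \<le> (\<Sum>s<length us. \<bar>f (stage (Suc s) t) - f (stage s t)\<bar>)"
    using sum_lessThan_telescope[of "\<lambda>s. f (stage s t)" "length us"] sum_abs by metis
  also have "\<dots> \<le> (\<Sum>s<length us. \<Sum>r\<in>I s. a s r + b s r)" using step by (intro sum_mono) auto
  also have "\<dots> = (\<Sum>(s, r)\<in>active \<theta> us. a s r + b s r)"
    unfolding act using finI by (subst sum.Sigma) auto
  finally have "(f (stage (length us) t) - f (stage 0 t))\<^sup>2 \<le> (\<Sum>(s, r)\<in>active \<theta> us. a s r + b s r)\<^sup>2"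
    by (metis abs_ge_zero power2_abs power_mono)
  \<comment> \<open>By \<open>card_active\<close> this costs a factor \<open>n\<close>, although the
    pairs \<open>(s, r)\<close> range over a set of quadratic size.\<close>
  also have "\<dots> \<le> card (active \<theta> us) * (\<Sum>u\<in>active \<theta> us. (case u of (s, r) \<Rightarrow> a s r + b s r)\<^sup>2)"
    by (rule sum_square_le)
  also have "\<dots> \<le> real n * (\<Sum>u\<in>active \<theta> us. 2 * (case u of (s, r) \<Rightarrow> (a s r)\<^sup>2 + (b s r)\<^sup>2))"
  proof (intro mult_mono sum_mono)
    show "real (card (active \<theta> us)) \<le> real n" using card_active[of \<theta> us] n by simp
    show "(case u of (s, r) \<Rightarrow> a s r + b s r)\<^sup>2 \<le> 2 * (case u of (s, r) \<Rightarrow> (a s r)\<^sup>2 + (b s r)\<^sup>2)" for u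
      using sum_squares_bound[of "a (fst u) (snd u)" "b (fst u) (snd u)"]
      by (simp add: case_prod_beta power2_sum)
  qed (auto intro!: sum_nonneg)
  also have "\<dots> = 2 * real n * (\<Sum>(s, r)\<in>active \<theta> us. (a s r)\<^sup>2 + (b s r)\<^sup>2)"
    by (subst sum_distrib_left[symmetric]) (simp add: case_prod_beta)
  finally show ?thesis by (simp add: a_def b_def)
qed

lemma stage_active:
  assumes P: "A @ us @ c # R \<in> P" and c: "\<theta> \<le> c" and sr: "(s, r) \<in> active \<theta> us"
    and w: "w \<le> W (stage s (\<theta>, A, us, c, R))" "w \<le> W (stage (Suc s) (\<theta>, A, us, c, R))"
    and s': "s' = s \<or> s' = Suc s"
    and h_def: "h = move_right (length A + s) r (stage s' (\<theta>, A, us, c, R))"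
  shows "h \<in> P \<and> w \<le> W h \<and> w \<le> W (swap_next (length A + s + r) h)"
proof -
  let ?t = "(\<theta>, A, us, c, R)" and ?S = "takeWhile (\<lambda>k. k < \<theta>) (drop (Suc s) us)"
  have s: "s < length us" "\<not> us ! s < \<theta>" "r \<le> length ?S" using sr by (auto simp: active_def)
  obtain Y where Y: "stage s ?t = (A @ take s us) @ c # ?S @ us ! s # Y"
        "stage (Suc s) ?t = (A @ take s us) @ us ! s # ?S @ c # Y"
        "\<forall>k\<in>set ?S. k < c \<and> k < us ! s"
    using stage_step[OF s(1,2) c] by metis
  have z: "length A + s = length (A @ take s us)" using s by simp
  have S': "\<forall>k\<in>set ?S. k < us ! s \<and> k < c" using Y(3) by auto
  have st: "stage k ?t \<in> P" for k by (rule permutations_of_set_mset_cong[OF P mset_stage])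
  show ?thesis
    using s'
  proof
    assume "s' = s"
    then show ?thesis
      unfolding h_def z
      using W_exchange_path[OF st[of s, unfolded Y(1)] Y(3) s(3) w[unfolded Y(1,2)] refl] Y(1)
      by simp
  next
    assume "s' = Suc s"
    then show ?thesis
      unfolding h_def z
      using W_exchange_path[OF st[of "Suc s", unfolded Y(2)] S' s(3) w(2,1)[unfolded Y(1,2)] refl] Y(2)
      by simp
  qed
qed

section \<open>Congestion of the paths\<close>

lemma inj_on_move_right_comp:
  assumes "inj_on h T" "\<And>t. t \<in> T \<Longrightarrow> h t \<in> P" "z + r < n"
  shows "inj_on (\<lambda>t. move_right z r (h t)) T"
proof (rule inj_onI)
  fix t t' assume t: "t \<in> T" "t' \<in> T" and e: "move_right z r (h t) = move_right z r (h t')"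
  have "h t = h t'"
    by (rule inj_onD[OF inj_on_move_right[OF assms(3)] e]) (simp_all add: length_P assms(2) t)
  then show "t = t'" using assms(1) t by (auto dest: inj_onD)
qed

lemma nn_energy_shift:
  assumes "z + k < n" shows "(\<Sum>r<k. edge_energy X p f (z + r)) \<le> nn_energy X p f"
  unfolding nn_energy_def
  by (rule sum_le_inj[where h = "\<lambda>r. z + r"]) (use assms edge_energy_nonneg in auto)

text \<open>One factor \<open>n\<close> is that of \<open>stage_path\<close>; the other counts the
  values of \<open>s\<close>, since a position \<open>x + s + r\<close> may be charged for each of
  them. For fixed \<open>(s, r)\<close> and fixed half, injectivity of the stage ensures that a
  permutation is charged only once.\<close>

lemma stage_energy:
  fixes \<theta> c :: "'t \<Rightarrow> nat" and A us R :: "'t \<Rightarrow> nat list"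
  defines "\<rho> \<equiv> \<lambda>s t. stage s (\<theta> t, A t, us t, c t, R t)"
  assumes fin: "finite T"
    and T: "\<And>t. t \<in> T \<Longrightarrow> length (A t) = x \<and> length (us t) = m \<and> \<theta> t \<le> c t \<and> A t @ us t @ c t # R t \<in> P"
    and inj: "\<And>s. s \<le> m \<Longrightarrow> inj_on (\<rho> s) T"
    and w: "\<And>s t. t \<in> T \<Longrightarrow> 0 \<le> w t" "\<And>s t. t \<in> T \<Longrightarrow> s \<le> m \<Longrightarrow> w t \<le> W (\<rho> s t)"
  shows "(\<Sum>t\<in>T. w t * (f (\<rho> m t) - f (\<rho> 0 t))\<^sup>2) \<le> 4 * real n ^ 2 * nn_energy X p f"
proof (cases "T = {}")
  case True
  then show ?thesis using nn_energy_nonneg by simp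
next
  case False
  then obtain t0 where "t0 \<in> T" by blast
  then have xm: "x + m < n" using T length_P by fastforce
  let ?Q = "SIGMA s : {..<m}. {..<m - s}" and ?E = "edge_energy X p f"
  define act where "act t = active (\<theta> t) (us t)" for t
  define J where "J b = (\<lambda>(s, r) t. (jump f (x + s + r) (move_right (x + s) r
      (\<rho> (if b then Suc s else s) t)))\<^sup>2)" for b
  have path: "(f (\<rho> m t) - f (\<rho> 0 t))\<^sup>2 \<le> 2 * real n * (\<Sum>u | u \<in> ?Q \<and> u \<in> act t. J True u t + J False u t)"
    if t: "t \<in> T" for t
  proof -
    have "act t = {u \<in> ?Q. u \<in> act t}"
      using active_subset[of "\<theta> t" "us t"] T[OF t] unfolding act_def by blast
    moreover have "(f (\<rho> m t) - f (\<rho> 0 t))\<^sup>2 \<le> 2 * real n * (\<Sum>u\<in>act t. J True u t + J False u t)"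
      using stage_path[of "\<theta> t" "c t" _ "A t" "us t" "R t", OF _ refl refl, of f] T[OF t] xm
      by (simp add: act_def \<rho>_def J_def case_prod_beta)
    ultimately show ?thesis by simp
  qed
  have edge: "(\<Sum>t | t \<in> T \<and> u \<in> act t. w t * J b u t) \<le> ?E (x + fst u + snd u)"
    if u: "u \<in> ?Q" for u b
  proof -
    obtain s r where e: "u = (s, r)" by (metis prod.collapse)
    have sr: "s < m" "r < m - s" using u by (auto simp: e)
    then have len: "x + s + r + 1 < n" using xm by simp
    define s' where "s' = (if b then Suc s else s)"
    have s': "s' \<le> m" "s' = s \<or> s' = Suc s" using sr by (auto simp: s'_def)
    have st: "\<rho> k t \<in> P" if "t \<in> T" for k t
      unfolding \<rho>_def using T[OF that] permutations_of_set_mset_cong mset_stage by blast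
    have "inj_on (\<lambda>t. move_right (x + s) r (\<rho> s' t)) T"
      by (rule inj_on_move_right_comp) (use inj[OF s'(1)] len st in auto)
    then have "(\<Sum>t | t \<in> T \<and> u \<in> act t. w t *
        (jump f (x + s + r) (move_right (x + s) r (\<rho> s' t)))\<^sup>2) \<le> ?E (x + s + r)"
    proof (intro edge_energy_ge[OF len])
      fix t assume t: "t \<in> {t \<in> T. u \<in> act t}"
      then have "t \<in> T" "w t \<le> W (\<rho> s t)" "w t \<le> W (\<rho> (Suc s) t)" using w(2)[of t] sr by auto
      then show "move_right (x + s) r (\<rho> s' t) \<in> P \<and> w t \<le> W (move_right (x + s) r (\<rho> s' t)) \<and>
         w t \<le> W (swap_next (x + s + r) (move_right (x + s) r (\<rho> s' t)))"
        using stage_active[of "A t" "us t" "c t" "R t" "\<theta> t" s r "w t" s'] t T[of t] s'(2)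
        by (simp add: e \<rho>_def act_def)
    qed (auto intro: inj_on_subset)
    then show ?thesis by (simp add: e J_def s'_def)
  qed
  have "(\<Sum>t\<in>T. w t * (f (\<rho> m t) - f (\<rho> 0 t))\<^sup>2) \<le> 4 * real n * (\<Sum>u\<in>?Q. ?E (x + fst u + snd u))"
    by (rule congestion_bound[OF fin _ _ _ path edge]) (use w in auto)
  also have "(\<Sum>u\<in>?Q. ?E (x + fst u + snd u)) = (\<Sum>s<m. \<Sum>r<m - s. ?E (x + s + r))"
    by (subst sum.Sigma) (auto simp: case_prod_beta)
  also have "4 * real n * \<dots> \<le> 4 * real n * (real n * nn_energy X p f)"
  proof (intro mult_left_mono)
    have "(\<Sum>s<m. \<Sum>r<m - s. ?E (x + s + r)) \<le> (\<Sum>s<m. nn_energy X p f)"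
      by (intro sum_mono nn_energy_shift) (use xm in auto)
    also have "\<dots> \<le> real n * nn_energy X p f"
      using xm nn_energy_nonneg by (simp add: mult_right_mono)
    finally show "(\<Sum>s<m. \<Sum>r<m - s. ?E (x + s + r)) \<le> real n * nn_energy X p f" .
  qed auto
  finally show ?thesis by (simp add: power2_eq_square)
qed

text \<open>Fixing the lengths \<open>x\<close> and \<open>m\<close> fixes the positions of the
  exchanged entries, which the decoding of a stage presupposes.\<close>

definition windows :: "nat \<Rightarrow> nat \<Rightarrow> (nat list \<times> nat \<times> nat list \<times> nat \<times> nat list) set" where
  "windows x m = {(A, i, ks, j, R). length A = x \<and> length ks = m \<and> i < j \<and>
     A @ i # ks @ j # R \<in> P \<and> (\<forall>k\<in>set ks. k < i \<or> j < k)}"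

lemma finite_windows: "finite (windows x m)"
proof -
  have "inj_on (\<lambda>(A, i, ks, j, R). A @ i # ks @ j # R) (windows x m)"
    by (auto simp: inj_on_def windows_def)
  then show ?thesis by (rule inj_on_finite[where B = P]) (auto simp: windows_def)
qed

text \<open>In the stages with positive index \<open>i\<close> still stands in its place, so the
  threshold can be read off and \<open>rotate_large_inj\<close> decodes the rest.\<close>

lemma inj_on_leftward_stage:
  assumes "s \<le> m"
  shows "inj_on (\<lambda>(A, i, ks, j, R). stage (Suc s) (i, A, i # ks, j, R)) (windows x m)"
proof (rule inj_onI, clarsimp)
  fix A i ks j R A' i' ks' j' R'
  assume w: "(A, i, ks, j, R) \<in> windows x m" "(A', i', ks', j', R') \<in> windows x m"
    and e: "stage (Suc s) (i, A, i # ks, j, R) = stage (Suc s) (i', A', i' # ks', j', R')"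
  have l: "length A = length A'" "length ks = length ks'" "length ks = m" "i \<le> j" "i' \<le> j'"
    using w by (auto simp: windows_def)
  then have e1: "A = A'" "i = i'" "take s ks = take s ks'" "R = R'"
    and e2: "rotate_large i j (drop s ks) = rotate_large i' j' (drop s ks')"
    using e assms by (auto simp: stage_def append_eq_append_conv)
  then have "j = j'" "drop s ks = drop s ks'" using rotate_large_inj[of i j] l by auto
  then show "A = A' \<and> i = i' \<and> ks = ks' \<and> j = j' \<and> R = R'"
    using e1 by (metis append_take_drop_id)
qed

lemma inj_on_rightward_stage:
  assumes "s \<le> m"
  shows "inj_on (\<lambda>(A, i, ks, j, R). stage s (i, A @ [j], ks, i, R)) (windows x m)"
proof (rule inj_onI, clarsimp)
  fix A i ks j R A' i' ks' j' R'
  assume w: "(A, i, ks, j, R) \<in> windows x m" "(A', i', ks', j', R') \<in> windows x m"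
    and e: "stage s (i, A @ [j], ks, i, R) = stage s (i', A' @ [j'], ks', i', R')"
  have l: "length A = length A'" "length ks = length ks'" "length ks = m"
    using w by (auto simp: windows_def)
  then have e1: "A = A'" "j = j'" "take s ks = take s ks'" "R = R'"
    and e2: "rotate_large i i (drop s ks) = rotate_large i' i' (drop s ks')"
    using e assms by (auto simp: stage_def append_eq_append_conv)
  \<comment> \<open>Here the threshold is itself the carried entry and is not visible at a fixed
    place. Two different candidates would occur in each other's \<open>ks\<close>; lying below the
    common \<open>j\<close>, each would be smaller than the other.\<close>
  have i: "i = i'"
  proof (rule ccontr)
    assume ne: "i \<noteq> i'"
    have "insert i (set (drop s ks)) = insert i' (set (drop s ks'))"
      using arg_cong[OF e2, of set] by simp
    then have "i \<in> set ks'" "i' \<in> set ks" using ne in_set_dropD by fast+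
    moreover have "\<forall>k\<in>set ks. k < i \<or> j < k" "\<forall>k\<in>set ks'. k < i' \<or> j < k" "i < j" "i' < j"
      using w e1 by (auto simp: windows_def)
    ultimately show False using less_trans less_asym by blast
  qed
  then have "drop s ks = drop s ks'" using rotate_large_inj[of i i] e2 by auto
  then show "A = A' \<and> i = i' \<and> ks = ks' \<and> j = j' \<and> R = R'"
    using e1 i by (metis append_take_drop_id)
qed

text \<open>The path consists of two legs with cost 4 each, and splitting the square of the sum
  doubles them: \<open>16 = 2 * (4 + 4)\<close>.\<close>

lemma window_energy:
  "(\<Sum>(A, i, ks, j, R)\<in>windows x m. min (W (A @ i # ks @ j # R)) (W (A @ j # ks @ i # R)) *
     (f (A @ i # ks @ j # R) - f (A @ j # ks @ i # R))\<^sup>2) \<le> 16 * real n ^ 2 * nn_energy X p f"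
proof -
  let ?T = "windows x m"
  define w u v where "w = (\<lambda>(A, i, ks, j, R). min (W (A @ i # ks @ j # R)) (W (A @ j # ks @ i # R)))"
    and "u s = (\<lambda>(A, i, ks, j, R). stage s (i, A, i # ks, j, R))"
    and "v s = (\<lambda>(A, i, ks, j, R). stage s (i, A @ [j], ks, i, R))"
    for s
  \<comment> \<open>The leftward leg ends with the exchange of \<open>j\<close> and
    \<open>i\<close>, where \<open>i\<close> becomes the carried entry; from the other side the leg
    of \<open>i\<close> ends in the same permutation.\<close>
  have meet: "u 0 t = v 0 t" for t by (simp add: u_def v_def stage_def split: prod.split)
  have flipped: "A @ j # ks @ i # R \<in> P" if "(A, i, ks, j, R) \<in> ?T" for A i ks j R
    by (rule permutations_of_set_mset_cong[of "A @ i # ks @ j # R"]) (use that in \<open>auto simp: windows_def\<close>)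
  have w_nn: "0 \<le> w t" if "t \<in> ?T" for t
  proof -
    obtain A i ks j R where e: "t = (A, i, ks, j, R)" by (metis prod.collapse)
    then have "A @ i # ks @ j # R \<in> P" using that by (simp add: windows_def)
    from W_pos[OF this] W_pos[OF flipped[OF that[unfolded e]]] show ?thesis by (simp add: w_def e)
  qed
  have wv: "w t \<le> W (v s t)" if "t \<in> ?T" "s \<le> m" for s t
  proof -
    obtain A i ks j R where e: "t = (A, i, ks, j, R)" by (metis prod.collapse)
    have *: "\<forall>k\<in>set ks. k < i \<or> j < k" "i < j" "length ks = m" using that by (auto simp: e windows_def)
    have "\<forall>k\<in>set (drop s ks). k < i \<or> i < k" using *(1,2) by (meson in_set_dropD less_trans)
    then have "W ((A @ [j]) @ ks @ i # R) \<le> W (stage s (i, A @ [j], ks, i, R))"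
      by (intro W_stage) (use *(3) that(2) flipped[OF that(1)[unfolded e]] in simp_all)
    then show ?thesis by (simp add: w_def v_def e)
  qed
  have wu: "w t \<le> W (u s t)" if "t \<in> ?T" "s \<le> Suc m" for s t
  proof (cases s)
    \<comment> \<open>The exchange with \<open>i\<close> may lose weight, so the meeting point is
      bounded through the other leg.\<close>
    case 0
    then show ?thesis using meet wv[OF that(1), of 0] by simp
  next
    case (Suc s')
    obtain A i ks j R where e: "t = (A, i, ks, j, R)" by (metis prod.collapse)
    have *: "\<forall>k\<in>set ks. k < i \<or> j < k" "i < j" "length ks = m" "A @ i # ks @ j # R \<in> P"
      using that by (auto simp: e windows_def)
    have "\<forall>k\<in>set (drop s (i # ks)). k < i \<or> j < k" using *(1) Suc by (simp add: in_set_dropD)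
    then have "W (A @ (i # ks) @ j # R) \<le> W (stage s (i, A, i # ks, j, R))"
      by (intro W_stage) (use * that(2) in simp_all)
    then show ?thesis by (simp add: w_def u_def e)
  qed
  have inj_v: "inj_on (v s) ?T" if "s \<le> m" for s
    unfolding v_def by (rule inj_on_rightward_stage[OF that])
  have inj_u: "inj_on (u s) ?T" if "s \<le> Suc m" for s
  proof (cases s)
    case 0
    then show ?thesis using inj_v[of 0] meet by (simp add: inj_on_def)
  next
    case (Suc s')
    then show ?thesis unfolding u_def using inj_on_leftward_stage[of s' m x] that by simp
  qed
  have left: "(\<Sum>t\<in>?T. w t * (f (u (Suc m) t) - f (u 0 t))\<^sup>2) \<le> 4 * real n ^ 2 * nn_energy X p f"
    using stage_energy[OF finite_windows, of x m "\<lambda>(A, i, ks, j, R). A" x "\<lambda>(A, i, ks, j, R). i # ks" "Suc m"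
      "\<lambda>(A, i, ks, j, R). i" "\<lambda>(A, i, ks, j, R). j" "\<lambda>(A, i, ks, j, R). R" w f] inj_u w_nn wu
    by (simp add: u_def case_prod_beta' windows_def)
  have "length (fst t) = x \<and> length (fst (snd (snd t))) = m" if "t \<in> ?T" for t
    using that by (auto simp: windows_def)
  then have right: "(\<Sum>t\<in>?T. w t * (f (v m t) - f (v 0 t))\<^sup>2) \<le> 4 * real n ^ 2 * nn_energy X p f"
    using stage_energy[OF finite_windows, of x m "\<lambda>(A, i, ks, j, R). A @ [j]" "Suc x" "\<lambda>(A, i, ks, j, R). ks" m
      "\<lambda>(A, i, ks, j, R). i" "\<lambda>(A, i, ks, j, R). i" "\<lambda>(A, i, ks, j, R). R" w f] inj_v w_nn wv flipped
    by (simp add: v_def case_prod_beta')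
  have "(\<Sum>(A, i, ks, j, R)\<in>?T. min (W (A @ i # ks @ j # R)) (W (A @ j # ks @ i # R)) *
     (f (A @ i # ks @ j # R) - f (A @ j # ks @ i # R))\<^sup>2) = (\<Sum>t\<in>?T. w t * (f (u (Suc m) t) - f (v m t))\<^sup>2)"
    by (intro sum.cong refl) (auto simp: w_def u_def v_def stage_def windows_def)
  also have "\<dots> \<le> (\<Sum>t\<in>?T. w t * (2 * (f (u (Suc m) t) - f (u 0 t))\<^sup>2 + 2 * (f (v m t) - f (v 0 t))\<^sup>2))"
  proof (intro sum_mono mult_left_mono w_nn)
    have "(a - b)\<^sup>2 \<le> 2 * (a - e)\<^sup>2 + 2 * (b - e)\<^sup>2" for a b e :: real
      using zero_le_power2[of "(a - e) + (b - e)"] by (simp add: power2_eq_square algebra_simps)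
    then show "(f (u (Suc m) t) - f (v m t))\<^sup>2 \<le> 2 * (f (u (Suc m) t) - f (u 0 t))\<^sup>2 + 2 * (f (v m t) - f (v 0 t))\<^sup>2" for t
      unfolding meet .
  qed
  also have "\<dots> = 2 * (\<Sum>t\<in>?T. w t * (f (u (Suc m) t) - f (u 0 t))\<^sup>2) + 2 * (\<Sum>t\<in>?T. w t * (f (v m t) - f (v 0 t))\<^sup>2)"
    by (simp add: sum_distrib_left sum.distrib[symmetric] algebra_simps)
  finally show ?thesis using left right by simp
qed

lemma free_energy_le_nn_energy: "free_energy X p f \<le> 16 * real n ^ 4 * nn_energy X p f"
proof -
  define F where "F = (\<lambda>(A, i, ks, j, R). min (W (A @ i # ks @ j # R)) (W (A @ j # ks @ i # R)) *
     (f (A @ i # ks @ j # R) - f (A @ j # ks @ i # R))\<^sup>2)"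
  define T where "T = (SIGMA s : {..<n} \<times> {..<n}. windows (fst s) (snd s))"
  define Q where "Q = (SIGMA s : X \<times> X. {xs. xs \<in> P \<and> free_pair (fst s) (snd s) xs})"
  define G where "G = (\<lambda>((i, j), xs). min (W xs) (W (exchange i j xs)) *
       (f xs - f (exchange i j xs))\<^sup>2)"
  have finT: "finite T" unfolding T_def by (auto simp: finite_windows)
  have finQ: "finite Q" unfolding Q_def using finX by (intro finite_SigmaI) auto
  have F_nn: "0 \<le> F t" if "t \<in> windows x m" for t x m
  proof -
    obtain A i ks j R where e: "t = (A, i, ks, j, R)" by (metis prod.collapse)
    have P: "A @ i # ks @ j # R \<in> P" using that by (simp add: windows_def e)
    have "A @ j # ks @ i # R \<in> P" by (rule permutations_of_set_mset_cong[OF P]) simp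
    then show ?thesis using W_pos[OF P] W_pos[of "A @ j # ks @ i # R"] by (simp add: F_def e)
  qed
  have "free_energy X p f = (\<Sum>s\<in>X \<times> X. \<Sum>xs | xs \<in> P \<and> free_pair (fst s) (snd s) xs. G (s, xs))"
    by (simp add: free_energy_def pair_energy_def G_def sum.cartesian_product case_prod_beta)
  also have "\<dots> = sum G Q" unfolding Q_def using finX by (subst sum.Sigma) auto
  also have "\<dots> \<le> sum (\<lambda>(s, t). F t) T"
  proof (rule sum_le_included[where i = "\<lambda>(s, (A, i, ks, j, R)). ((i, j), A @ i # ks @ j # R)", OF finQ finT])
    show "\<forall>y\<in>T. 0 \<le> (case y of (s, t) \<Rightarrow> F t)" using F_nn by (auto simp: T_def)
    show "\<forall>q\<in>Q. \<exists>y\<in>T. (case y of (s, A, i, ks, j, R) \<Rightarrow> ((i, j), A @ i # ks @ j # R)) = q \<and>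
        G q \<le> (case y of (s, t) \<Rightarrow> F t)"
    proof
      fix q assume "q \<in> Q"
      then obtain i j xs where q: "q = ((i, j), xs)" "xs \<in> P" "free_pair i j xs" by (auto simp: Q_def)
      then obtain A ks R where w: "xs = A @ i # ks @ j # R" "\<forall>k\<in>set ks. k < i \<or> j < k" "i < j"
        by (auto simp: free_pair_def)
      have t: "(A, i, ks, j, R) \<in> windows (length A) (length ks)"
        using q w by (auto simp: windows_def)
      have "length A < n" "length ks < n" using length_P[OF q(2)] w by auto
      then have "((length A, length ks), (A, i, ks, j, R)) \<in> T" using t by (simp add: T_def)
      moreover have "distinct xs" using q by (simp add: permutations_of_set_def)
      then have "exchange i j xs = A @ j # ks @ i # R"
        using w by (simp add: map_transpose_id)
      then have "G q = F (A, i, ks, j, R)"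
        unfolding q(1) using w by (simp add: G_def F_def)
      ultimately show "\<exists>y\<in>T. (case y of (s, A, i, ks, j, R) \<Rightarrow> ((i, j), A @ i # ks @ j # R)) = q \<and>
        G q \<le> (case y of (s, t) \<Rightarrow> F t)"
        using w(1) q(1) by (intro bexI[of _ "((length A, length ks), (A, i, ks, j, R))"]) auto
    qed
  qed
  also have "\<dots> = (\<Sum>s\<in>{..<n} \<times> {..<n}. \<Sum>t\<in>windows (fst s) (snd s). F t)"
    unfolding T_def using finite_windows by (subst sum.Sigma) auto
  also have "\<dots> \<le> (\<Sum>s\<in>{..<n} \<times> {..<n}. 16 * real n ^ 2 * nn_energy X p f)"
    unfolding F_def by (intro sum_mono window_energy)
  also have "\<dots> = 16 * real n ^ 4 * nn_energy X p f" by (simp add: power2_eq_square power4_eq_xxxx)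
  finally show ?thesis .
qed

end

section \<open>The mirrored ordering and the tree probabilities\<close>

lemma perm_weight_eq: "perm_weight p xs = list_weight p xs"
proof (induction xs rule: rev_induct)
  case Nil
  then show ?case by (simp add: perm_weight_def)
next
  case (snoc x xs)
  have "perm_weight p (xs @ [x]) = perm_weight p xs * (\<Prod>i<length xs. p (xs ! i) x)"
    unfolding perm_weight_def by (simp add: nth_append)
  also have "(\<Prod>i<length xs. p (xs ! i) x) = (\<Prod>y\<leftarrow>xs. p y x)"
    by (simp add: prod.list_conv_set_nth atLeast0LessThan)
  finally show ?case using snoc by (simp add: list_weight_append)
qed

text \<open>Reversing both the labels and the list keeps pairs in increasing order as they are,
  preserves the weights with respect to \<open>mirror_bias\<close>, and turns monotonicity in the
  first index into monotonicity in the second.\<close>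

definition mirror :: "nat \<Rightarrow> nat list \<Rightarrow> nat list" where
  "mirror n xs = rev (map (\<lambda>k. n + 1 - k) xs)"

definition mirror_bias :: "nat \<Rightarrow> (nat \<Rightarrow> nat \<Rightarrow> real) \<Rightarrow> nat \<Rightarrow> nat \<Rightarrow> real" where
  "mirror_bias n p a b = p (n + 1 - b) (n + 1 - a)"

lemma mirror_mirror: "set xs \<subseteq> {1..n} \<Longrightarrow> mirror n (mirror n xs) = xs"
  by (induction xs) (auto simp: mirror_def rev_map)

lemma mirror_permutation:
  assumes "xs \<in> permutations_of_set {1..n}" shows "mirror n xs \<in> permutations_of_set {1..n}"
proof -
  have "inj_on (\<lambda>k. n + 1 - k) {1..n}" by (auto simp: inj_on_def)
  moreover have "(\<lambda>k. n + 1 - k) ` {1..n} = {1..n}"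
  proof (intro subset_antisym subsetI)
    fix k assume "k \<in> {1..n}"
    then show "k \<in> (\<lambda>k. n + 1 - k) ` {1..n}" by (intro image_eqI[of _ _ "n + 1 - k"]) auto
  qed auto
  ultimately show ?thesis using assms by (auto simp: permutations_of_set_def mirror_def distinct_map)
qed

lemma list_weight_mirror:
  "set xs \<subseteq> {1..n} \<Longrightarrow> list_weight (mirror_bias n p) (mirror n xs) = list_weight p xs"
proof (induction xs)
  case (Cons x xs)
  have "(\<Prod>y\<leftarrow>mirror n xs. mirror_bias n p y (n + 1 - x)) = (\<Prod>y\<leftarrow>map (\<lambda>k. n + 1 - k) xs. mirror_bias n p y (n + 1 - x))"
    by (rule prod_list_mset_cong) (simp add: mirror_def)
  also have "\<dots> = (\<Prod>y\<leftarrow>xs. p x y)"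
  proof -
    have "mirror_bias n p (n + 1 - y) (n + 1 - x) = p x y" if "y \<in> set xs" for y
    proof -
      have "x \<le> n" "y \<le> n" using that Cons.prems by auto
      then show ?thesis by (simp add: mirror_bias_def)
    qed
    then show ?thesis by (simp add: comp_def cong: map_cong)
  qed
  finally have "(\<Prod>y\<leftarrow>mirror n xs. mirror_bias n p y (n + 1 - x)) = (\<Prod>y\<leftarrow>xs. p x y)" .
  moreover have "mirror n (x # xs) = mirror n xs @ [n + 1 - x]" by (simp add: mirror_def)
  ultimately show ?case using Cons by (simp add: list_weight_append)
qed (simp add: mirror_def)

lemma mirror_swap_next:
  assumes "l + 1 < length xs"
  shows "swap_next (length xs - 2 - l) (mirror n xs) = mirror n (swap_next l xs)"
proof -
  obtain A R where A: "xs = A @ xs ! l # xs ! (l + 1) # R" "length A = l"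
    using split_adjacent[OF assms] by blast
  define a b where "a = xs ! l" and "b = xs ! (l + 1)"
  have xs: "xs = A @ a # b # R" using A(1) by (simp add: a_def b_def)
  have s: "swap_next l xs = A @ b # a # R" unfolding xs A(2)[symmetric] by (rule swap_next_append)
  have "length xs - 2 - l = length (mirror n R)" using xs A(2) by (simp add: mirror_def)
  moreover have "mirror n xs = mirror n R @ (n + 1 - b) # (n + 1 - a) # mirror n A"
    by (simp add: xs mirror_def)
  ultimately have "swap_next (length xs - 2 - l) (mirror n xs) = mirror n R @ (n + 1 - a) # (n + 1 - b) # mirror n A"
    by (simp only: swap_next_append)
  also have "\<dots> = mirror n (swap_next l xs)" by (simp add: s mirror_def)
  finally show ?thesis .
qed

lemma nn_energy_mirror:
  "nn_energy {1..n} (mirror_bias n p) (\<lambda>xs. f (mirror n xs)) \<le> nn_energy {1..n} p f"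
proof -
  let ?P = "permutations_of_set {1..n}" and ?W' = "list_weight (mirror_bias n p)"
  have sub: "set xs \<subseteq> {1..n}" "length xs = n" if "xs \<in> ?P" for xs
    using that by (auto simp: permutations_of_set_def distinct_card dest: distinct_card)
  have "edge_energy {1..n} (mirror_bias n p) (\<lambda>xs. f (mirror n xs)) l = edge_energy {1..n} p f (n - 2 - l)"
    if l: "l + 1 < n" for l
    unfolding edge_energy_def
  proof (rule sum.reindex_bij_witness[of _ "mirror n" "mirror n"])
    fix xs assume xs: "xs \<in> ?P"
    have sw: "swap_next l xs \<in> ?P"
      using xs mset_swap_next[of l xs] l sub(2)[OF xs] by (auto intro: permutations_of_set_mset_cong)
    have "list_weight p (mirror n xs) = ?W' xs" "list_weight p (mirror n (swap_next l xs)) = ?W' (swap_next l xs)"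
      using list_weight_mirror[of "mirror n xs" n p] list_weight_mirror[of "mirror n (swap_next l xs)" n p]
        mirror_mirror sub(1) mirror_permutation xs sw by auto
    moreover have "swap_next (n - 2 - l) (mirror n xs) = mirror n (swap_next l xs)"
      using mirror_swap_next[of l xs n] l sub(2)[OF xs] by simp
    ultimately show "min (list_weight p (mirror n xs)) (list_weight p (swap_next (n - 2 - l) (mirror n xs))) *
        (jump f (n - 2 - l) (mirror n xs))\<^sup>2 =
        min (?W' xs) (?W' (swap_next l xs)) * (jump (\<lambda>xs. f (mirror n xs)) l xs)\<^sup>2" by simp
  qed (use mirror_permutation mirror_mirror sub in auto)
  then have "nn_energy {1..n} (mirror_bias n p) (\<lambda>xs. f (mirror n xs)) = (\<Sum>l<n - 1. edge_energy {1..n} p f (n - 2 - l))"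
    unfolding nn_energy_def by (intro sum.cong) auto
  also have "\<dots> = (\<Sum>l<n - 1. edge_energy {1..n} p f l)"
    by (rule sum.reindex_bij_witness[of _ "\<lambda>l. n - 2 - l" "\<lambda>l. n - 2 - l"]) auto
  finally show ?thesis by (simp add: nn_energy_def)
qed

lemma free_energy_mirror:
  "free_energy {1..n} p f = free_energy {1..n} (mirror_bias n p) (\<lambda>xs. f (mirror n xs))"
proof -
  let ?P = "permutations_of_set {1..n}" and ?W' = "list_weight (mirror_bias n p)" and ?X = "{1..n}"
  let ?m = "\<lambda>k. n + 1 - k"
  define Q where "Q = (SIGMA s : ?X \<times> ?X. {xs. xs \<in> ?P \<and> free_pair (fst s) (snd s) xs})"
  define E where "E p f = (\<lambda>((i, j), xs). min (list_weight p xs) (list_weight p (exchange i j xs)) *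
       (f xs - f (exchange i j xs))\<^sup>2)" for p and f :: "nat list \<Rightarrow> real"
  define h where "h = (\<lambda>((i, j), xs). ((?m j, ?m i), mirror n xs))"
  have fe: "free_energy ?X p f = sum (E p f) Q" for p f
  proof -
    have "free_energy ?X p f = (\<Sum>s\<in>?X \<times> ?X. \<Sum>xs | xs \<in> ?P \<and> free_pair (fst s) (snd s) xs. E p f (s, xs))"
      by (simp add: free_energy_def pair_energy_def E_def sum.cartesian_product case_prod_beta)
    also have "\<dots> = sum (E p f) Q" unfolding Q_def by (subst sum.Sigma) auto
    finally show ?thesis .
  qed
  have sub: "set xs \<subseteq> ?X" if "xs \<in> ?P" for xs using that by (auto simp: permutations_of_set_def)
  have hQ: "h q \<in> Q" if q: "q \<in> Q" for q
  proof -
    obtain i j xs where e: "q = ((i, j), xs)" by (metis prod.collapse)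
    have m: "i \<in> ?X" "j \<in> ?X" "xs \<in> ?P" "free_pair i j xs" using q by (auto simp: Q_def e)
    obtain A ks R where w: "xs = A @ i # ks @ j # R" "\<forall>k\<in>set ks. k < i \<or> j < k" "i < j"
      using m(4) by (auto simp: free_pair_def)
    have ks: "k \<in> ?X" if "k \<in> set ks" for k using sub[OF m(3)] that w(1) by auto
    have "?m k < ?m j \<or> ?m i < ?m k" if "k \<in> set ks" for k
    proof -
      have "k < i \<or> j < k" "k \<le> n" "i \<le> n" "j \<le> n" using ks[OF that] w(2) m(1,2) that by auto
      then show ?thesis by linarith
    qed
    then have "free_pair (?m j) (?m i) (mirror n xs)"
      unfolding free_pair_def using w m(1,2)
      by (intro conjI exI[of _ "mirror n R"] exI[of _ "mirror n ks"] exI[of _ "mirror n A"])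
         (auto simp: mirror_def)
    then show ?thesis using m mirror_permutation by (auto simp: Q_def h_def e)
  qed
  have hh: "h (h q) = q" if "q \<in> Q" for q
    using that mirror_mirror sub by (auto simp: h_def Q_def)
  have Eh: "E (mirror_bias n p) (\<lambda>xs. f (mirror n xs)) (h q) = E p f q" if q: "q \<in> Q" for q
  proof -
    obtain i j xs where e: "q = ((i, j), xs)" by (metis prod.collapse)
    have m: "i \<in> ?X" "j \<in> ?X" "xs \<in> ?P" using q by (auto simp: Q_def e)
    let ?t = "exchange i j xs"
    have tP: "?t \<in> ?P" by (rule map_transpose_permutation[OF m(3,1,2)])
    have "Transposition.transpose (?m j) (?m i) (?m k) = ?m (Transposition.transpose i j k)" if "k \<in> ?X" for k
      using that m(1,2) by (auto simp: Transposition.transpose_def)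
    then have "exchange (?m j) (?m i) (mirror n xs) = mirror n ?t"
      using sub[OF m(3)] by (auto simp: mirror_def rev_map[symmetric])
    then show ?thesis
      using list_weight_mirror[OF sub[OF m(3)]] list_weight_mirror[OF sub[OF tP]]
        mirror_mirror[OF sub[OF m(3)]] mirror_mirror[OF sub[OF tP]]
      by (simp add: E_def h_def e)
  qed
  have "sum (E p f) Q = sum (E (mirror_bias n p) (\<lambda>xs. f (mirror n xs))) Q"
    by (rule sum.reindex_bij_witness[of _ h h]) (use hQ hh Eh in auto)
  then show ?thesis unfolding fe .
qed

lemma chain_le:
  fixes g :: "nat \<Rightarrow> real"
  assumes "\<And>k. b \<le> k \<Longrightarrow> k < c \<Longrightarrow> g k \<le> g (Suc k)" "b \<le> c" shows "g b \<le> g c"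
  using assms(2,1) by (induction rule: dec_induct) (auto intro: order_trans)

lemma free_energy_le_weakly_monotone:
  assumes wm: "weakly_monotone n p"
    and comp: "\<And>a b. a \<in> {1..n} \<Longrightarrow> b \<in> {1..n} \<Longrightarrow> a \<noteq> b \<Longrightarrow> p a b + p b a = 1"
    and pos: "\<And>a b. a \<in> {1..n} \<Longrightarrow> b \<in> {1..n} \<Longrightarrow> a \<noteq> b \<Longrightarrow> 0 < p a b"
  shows "free_energy {1..n} p f \<le> 16 * real n ^ 4 * nn_energy {1..n} p f"
proof -
  have half: "p b a \<le> p a b" if "a \<in> {1..n}" "b \<in> {1..n}" "a < b" for a b
    using wm that comp[of a b] by (fastforce simp: weakly_monotone_def)
  have compl: "p c a \<le> p b a" if "p a b \<le> p a c" "a \<in> {1..n}" "b \<in> {1..n}" "c \<in> {1..n}" "a < b" "b \<le> c" for a b c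
    using that comp[of a b] comp[of a c] by auto
  have compl': "p a b \<le> p a c" if "p c a \<le> p b a" "a \<in> {1..n}" "b \<in> {1..n}" "c \<in> {1..n}" "a \<noteq> b" "a \<noteq> c" for a b c
    using that comp[of a b] comp[of a c] by auto
  consider "\<forall>i j. 1 \<le> i \<and> i < j \<and> j \<le> n - 1 \<longrightarrow> p i (j + 1) \<ge> p i j"
    | "\<forall>i j. 2 \<le> i \<and> i < j \<and> j \<le> n \<longrightarrow> p (i - 1) j \<ge> p i j"
    using wm by (auto simp: weakly_monotone_def)
  then show ?thesis
  proof cases
    case 1
    have mono: "p a b \<le> p a c" if "a \<in> {1..n}" "b \<in> {1..n}" "c \<in> {1..n}" "a < b" "b \<le> c" for a b c
      by (rule chain_le[OF _ that(5)]) (use 1 that in auto)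
    interpret monotone_bias "{1..n}" p
      by unfold_locales (use half pos mono compl in auto)
    show ?thesis using free_energy_le_nn_energy[of f] by simp
  next
    case 2
    have mono: "p a c \<le> p b c" if "a \<in> {1..n}" "b \<in> {1..n}" "c \<in> {1..n}" "a < c" "b \<le> a" for a b c
    proof -
      have "- p b c \<le> - p a c"
        by (rule chain_le[OF _ that(5), of "\<lambda>k. - p k c"]) (use 2[rule_format, of "Suc _" c] that in auto)
      then show ?thesis by simp
    qed
    have mono': "p c b \<le> p c a" if "a \<in> {1..n}" "b \<in> {1..n}" "c \<in> {1..n}" "a < c" "b \<le> a" for a b c
      using mono[OF that] that comp[of a c] comp[of b c] by auto
    let ?q = "mirror_bias n p"
    interpret monotone_bias "{1..n}" ?q
    proof
      fix a b c assume "a \<in> {1..n}" "b \<in> {1..n}" "c \<in> {1..n}" "a < b" "b \<le> c"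
      then show "?q a b \<le> ?q a c" "?q c a \<le> ?q b a"
        unfolding mirror_bias_def
        using mono[of "n + 1 - b" "n + 1 - c" "n + 1 - a"] mono'[of "n + 1 - b" "n + 1 - c" "n + 1 - a"] by auto
    next
      fix a b assume ab: "a \<in> {1..n}" "b \<in> {1..n}"
      then show "0 < ?q a b" if "a \<noteq> b" unfolding mirror_bias_def using that by (intro pos) auto
      show "?q b a \<le> ?q a b" if "a < b" unfolding mirror_bias_def using that ab by (intro half) auto
    qed simp
    have "free_energy {1..n} p f = free_energy {1..n} ?q (\<lambda>xs. f (mirror n xs))" by (rule free_energy_mirror)
    also have "\<dots> \<le> 16 * real n ^ 4 * nn_energy {1..n} ?q (\<lambda>xs. f (mirror n xs))"
      using free_energy_le_nn_energy[of "\<lambda>xs. f (mirror n xs)"] by simp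
    also have "\<dots> \<le> 16 * real n ^ 4 * nn_energy {1..n} p f"
      by (intro mult_left_mono nn_energy_mirror) simp
    finally show ?thesis .
  qed
qed

section \<open>Lowest common ancestors and the probabilities of the tree\<close>

lemma self_subtree: "T \<in> subtrees T"
  by (cases T) auto

lemma leaves_subtree: "u \<in> subtrees T \<Longrightarrow> set (leaves u) \<subseteq> set (leaves T)"
  by (induction T) auto

lemma subtree_trans: "u \<in> subtrees v \<Longrightarrow> v \<in> subtrees T \<Longrightarrow> u \<in> subtrees T"
  by (induction T) auto

lemma subtree_size: "u \<in> subtrees T \<Longrightarrow> u = T \<or> size u < size T"
  by (induction T) auto

lemma labels_subtree: "u \<in> subtrees T \<Longrightarrow> internal_labels u \<subseteq> internal_labels T"
  by (induction T) auto

text \<open>Leaves being distinct, subtrees in different children of a node share no leaf. On the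
  way down from the root \<open>u\<close> and the branch thus stay together until one of them is
  reached, and the branch cannot come strictly first, as neither of its children contains both
  \<open>i\<close> and \<open>j\<close>.\<close>

lemma branch_subtree_of_common_ancestor:
  assumes "distinct (leaves T)" "Branch l q r \<in> subtrees T" "u \<in> subtrees T"
    "i \<in> set (leaves u)" "j \<in> set (leaves u)" "i \<in> set (leaves l)" "j \<in> set (leaves r)"
  shows "Branch l q r \<in> subtrees u"
  using assms
proof (induction T)
  case (Branch a p b)
  have disj: "set (leaves a) \<inter> set (leaves b) = {}" using Branch.prems(1) by simp
  have up: "k \<in> set (leaves c)" if "v \<in> subtrees c" "k \<in> set (leaves v)" for v c k
    using leaves_subtree that by blast
  have mem: "i \<in> set (leaves (Branch l q r))" using Branch.prems by simp
  consider "u = Branch a p b" | "u \<in> subtrees a" | "u \<in> subtrees b" using Branch.prems(3) by auto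
  then show ?case
  proof cases
    case 1
    then show ?thesis using Branch.prems(2) by simp
  next
    case 2
    have "Branch l q r \<noteq> Branch a p b" using up[OF 2 Branch.prems(5)] Branch.prems(7) disj by auto
    moreover have "Branch l q r \<notin> subtrees b" using up[OF 2 Branch.prems(4)] up[OF _ mem] disj by auto
    ultimately show ?thesis using Branch 2 by auto
  next
    case 3
    have "Branch l q r \<noteq> Branch a p b" using up[OF 3 Branch.prems(4)] Branch.prems(6) disj by auto
    moreover have "Branch l q r \<notin> subtrees a" using up[OF 3 Branch.prems(4)] up[OF _ mem] disj by auto
    ultimately show ?thesis using Branch 3 by auto
  qed
qed simp

lemma lca_branch:
  assumes "distinct (leaves T)" "Branch l q r \<in> subtrees T" "i \<in> set (leaves l)" "j \<in> set (leaves r)"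
  shows "lca T i j = Branch l q r"
  unfolding lca_def
proof (rule the_equality)
  show B: "Branch l q r \<in> common_ancestors T i j \<and> (\<forall>u\<in>common_ancestors T i j. Branch l q r \<in> subtrees u)"
    using assms branch_subtree_of_common_ancestor[OF assms(1,2)] by (auto simp: common_ancestors_def)
  fix v assume v: "v \<in> common_ancestors T i j \<and> (\<forall>u\<in>common_ancestors T i j. v \<in> subtrees u)"
  then have "v \<in> subtrees (Branch l q r)" "Branch l q r \<in> subtrees v" using B by auto
  then show "v = Branch l q r" using subtree_size by (metis less_asym)
qed

text \<open>Supplies the hypothesis of \<open>tree_poincare\<close> in its inductive form; the
  probabilities stay those of the whole tree while the induction runs over its subtrees. Every
  internal node separates some pair of leaves, so the bound on \<open>tree_prob\<close> forces
  \<open>q < 1\<close>.\<close>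

lemma tree_bias_tree_prob:
  assumes dist: "sorted_wrt (<) (leaves T)" and lab: "\<forall>q\<in>internal_labels T. 1/2 \<le> q"
    and less1: "\<And>i j. i \<in> set (leaves T) \<Longrightarrow> j \<in> set (leaves T) \<Longrightarrow> i < j \<Longrightarrow> tree_prob T i j < 1"
  shows "tree_bias (tree_prob T) T"
proof -
  have "v \<in> subtrees T \<Longrightarrow> sorted_wrt (<) (leaves v) \<Longrightarrow> tree_bias (tree_prob T) v" for v
  proof (induction v)
    case (Branch l q r)
    have d: "distinct (leaves T)" using dist by (simp add: strict_sorted_iff)
    have sub: "l \<in> subtrees T" "r \<in> subtrees T"
      using Branch.prems subtree_trans[of _ "Branch l q r" T] self_subtree by auto
    have pq: "tree_prob T i j = q \<and> tree_prob T j i = 1 - q" if "i \<in> set (leaves l)" "j \<in> set (leaves r)" for i j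
    proof -
      have "i < j" using Branch.prems that by (auto simp: sorted_wrt_append)
      then show ?thesis using lca_branch[OF d Branch.prems(1) that] by (simp add: tree_prob_def)
    qed
    obtain i j where ij: "i \<in> set (leaves l)" "j \<in> set (leaves r)"
      using leaves_nonempty[of l] leaves_nonempty[of r] by (meson last_in_set)
    have "i < j" using Branch.prems ij by (auto simp: sorted_wrt_append)
    then have "q < 1"
      using less1[of i j] pq[OF ij] leaves_subtree[OF Branch.prems(1)] ij by auto
    moreover have "1/2 \<le> q" using lab labels_subtree[OF Branch.prems(1)] by auto
    ultimately show ?case using Branch sub pq by (simp add: sorted_wrt_append)
  qed simp
  then show ?thesis using self_subtree dist by blast
qed

lemma tree_prob_complementary: "i \<noteq> j \<Longrightarrow> tree_prob T i j + tree_prob T j i = 1"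
  by (auto simp: tree_prob_def)

section \<open>Mixing of the nearest neighbor chain\<close>

context adjacent_swaps
begin

lemma Z_pos: "xs \<in> S \<Longrightarrow> 0 < sum W S"
  using finite_states weight_pos by (intro sum_pos) auto

text \<open>By convexity the squared norm of the averaged function is at most the average of the
  squared norms after single updates, and by \<open>heat_bath_norm\<close> that average is the
  quadratic form of \<open>avg_update\<close>.\<close>

lemma wvar_avg_update:
  "wvar S W (avg_update N p g) \<le> wvar S W g - 2 * sum W S * dirichlet g"
proof -
  let ?P = "avg_update N p" and ?M = "real (N - 1)"
  have M: "0 < ?M" using N2 by simp
  have mean: "(\<Sum>xs\<in>S. W xs * ?P g xs) = (\<Sum>xs\<in>S. W xs * g xs)"
    using avg_update_self_adjoint[of "\<lambda>_. 1" g] by (simp add: avg_update_const)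
  have sq: "(?P g xs)\<^sup>2 \<le> (\<Sum>l<N - 1. (heat_bath p l g xs)\<^sup>2) / ?M" for xs
  proof -
    have "(\<Sum>l<N - 1. heat_bath p l g xs)\<^sup>2 \<le> ?M * (\<Sum>l<N - 1. (heat_bath p l g xs)\<^sup>2)"
      using sum_square_le[of "\<lambda>l. heat_bath p l g xs" "{..<N - 1}"] by simp
    moreover have "(h / m)\<^sup>2 \<le> q / m" if "h\<^sup>2 \<le> m * q" "0 < m" for h m q :: real
    proof -
      have "h\<^sup>2 / (m * m) \<le> m * q / (m * m)" using that by (intro divide_right_mono) auto
      then show ?thesis using that by (simp add: power_divide power2_eq_square)
    qed
    ultimately show ?thesis using M unfolding avg_update_def by blast
  qed
  have "(\<Sum>xs\<in>S. W xs * (?P g xs)\<^sup>2) \<le> (\<Sum>xs\<in>S. W xs * ((\<Sum>l<N - 1. (heat_bath p l g xs)\<^sup>2) / ?M))"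
    using sq weight_pos by (intro sum_mono mult_left_mono) (auto intro: less_imp_le)
  also have "\<dots> = (\<Sum>l<N - 1. \<Sum>xs\<in>S. W xs * (heat_bath p l g xs)\<^sup>2) / ?M"
    by (subst sum.swap) (simp add: sum_distrib_left sum_divide_distrib)
  also have "\<dots> = (\<Sum>l<N - 1. \<Sum>xs\<in>S. W xs * g xs * heat_bath p l g xs) / ?M"
    by (intro arg_cong2[where f = "(/)"] sum.cong[OF refl] heat_bath_norm refl) auto
  also have "\<dots> = (\<Sum>xs\<in>S. W xs * g xs * ?P g xs)"
    by (subst sum.swap) (simp add: avg_update_def sum_distrib_left sum_divide_distrib)
  finally have "(\<Sum>xs\<in>S. W xs * (?P g xs)\<^sup>2) \<le> (\<Sum>xs\<in>S. W xs * g xs * ?P g xs)" .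
  then have "2 * sum W S * (\<Sum>xs\<in>S. W xs * (?P g xs)\<^sup>2) \<le> 2 * sum W S * (\<Sum>xs\<in>S. W xs * g xs * ?P g xs)"
    using weight_pos by (intro mult_left_mono) (auto intro: sum_nonneg less_imp_le)
  then show ?thesis unfolding wvar_eq mean
    by (simp add: algebra_simps sum_subtractf power2_eq_square)
qed

lemma wvar_iterate:
  assumes poin: "\<And>g. wvar S W g \<le> K * (2 * sum W S * dirichlet g)"
    and K: "1 \<le> K"
  shows "wvar S W ((avg_update N p ^^ t) g) \<le> (1 - 1 / K) ^ t * wvar S W g"
proof (induction t)
  case (Suc t)
  let ?h = "(avg_update N p ^^ t) g"
  have "wvar S W ?h / K \<le> 2 * sum W S * dirichlet ?h"
    using poin[of ?h] K by (simp add: field_simps)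
  then have "wvar S W (avg_update N p ?h) \<le> (1 - 1 / K) * wvar S W ?h"
    using wvar_avg_update[of ?h] by (simp add: algebra_simps)
  also have "\<dots> \<le> (1 - 1 / K) * ((1 - 1 / K) ^ t * wvar S W g)"
    using Suc K by (intro mult_left_mono) auto
  finally show ?case by (simp add: mult.assoc)
qed simp

end

section \<open>Convergence of the nearest neighbor chain in total variation\<close>

locale nn_chain =
  fixes n :: nat and p :: "nat \<Rightarrow> nat \<Rightarrow> real"
  assumes n2: "2 \<le> n"
    and comp: "a \<in> {1..n} \<Longrightarrow> b \<in> {1..n} \<Longrightarrow> a \<noteq> b \<Longrightarrow> p a b + p b a = 1"
    and pos: "a \<in> {1..n} \<Longrightarrow> b \<in> {1..n} \<Longrightarrow> a \<noteq> b \<Longrightarrow> 0 < p a b"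
begin

abbreviation "\<S> \<equiv> permutations_of_set {1..n}"

lemma perm_props: "xs \<in> \<S> \<Longrightarrow> length xs = n \<and> distinct xs \<and> set xs = {1..n}"
  by (auto simp: permutations_of_set_def distinct_card dest: distinct_card)

lemma perm_entries:
  assumes "xs \<in> \<S>" "l + 1 < n"
  shows "xs ! l \<in> {1..n}" "xs ! (l + 1) \<in> {1..n}" "xs ! l \<noteq> xs ! (l + 1)"
proof -
  have "length xs = n" "distinct xs" "set xs = {1..n}" using perm_props[OF assms(1)] by auto
  moreover from this have "xs ! l \<in> set xs" "xs ! (l + 1) \<in> set xs" using assms by auto
  ultimately show "xs ! l \<in> {1..n}" "xs ! (l + 1) \<in> {1..n}" "xs ! l \<noteq> xs ! (l + 1)"
    using assms by (auto simp: nth_eq_iff_index_eq)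
qed

lemma swap_next_perm: "xs \<in> \<S> \<Longrightarrow> l + 1 < n \<Longrightarrow> swap_next l xs \<in> \<S>"
  using permutations_of_set_mset_cong mset_swap_next perm_props by metis

sublocale adjacent_swaps \<S> n p
proof
  show "0 < list_weight p xs" if "xs \<in> \<S>" for xs
    using perm_props[OF that] pos by (intro list_weight_pos) auto
  show "p (xs ! l) (xs ! (l + 1)) + p (xs ! (l + 1)) (xs ! l) = 1"
    if "xs \<in> \<S>" "l + 1 < n" "xs ! l \<noteq> xs ! (l + 1)" for xs l
    using comp perm_entries[OF that(1,2)] by auto
  show "0 < p (xs ! l) (xs ! (l + 1))"
    if "xs \<in> \<S>" "l + 1 < n" "xs ! l \<noteq> xs ! (l + 1)" for xs l
    using pos perm_entries[OF that(1,2)] by auto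
qed (use n2 perm_props swap_next_perm in auto)

lemma positions_nonempty: "finite {..<n - 1}" "{..<n - 1} \<noteq> {}"
proof -
  have "0 \<in> {..<n - 1}" using n2 by simp
  then show "{..<n - 1} \<noteq> {}" by blast
qed simp

lemma pmf_nn_step:
  assumes "xs \<in> \<S>"
  shows "pmf (nn_step n p xs) ys = avg_update n p (\<lambda>zs. indicator {zs} ys) xs"
proof -
  have "pmf (nn_step n p xs) ys =
    (\<Sum>i<n - 1. pmf (bind_pmf (bernoulli_pmf (p (xs ! (i + 1)) (xs ! i)))
       (\<lambda>b. return_pmf (if b then swap_next i xs else xs))) ys) / real (n - 1)"
    unfolding nn_step_def pmf_bind[of "pmf_of_set _"] integral_pmf_of_set[OF positions_nonempty(2,1)] card_lessThan ..
  also have "\<dots> = (\<Sum>i<n - 1. heat_bath p i (\<lambda>zs. indicator {zs} ys) xs) / real (n - 1)"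
  proof (intro arg_cong2[where f = "(/)"] sum.cong refl)
    fix i assume "i \<in> {..<n - 1}"
    then have i: "i + 1 < n" by simp
    note e = perm_entries[OF assms i]
    have "0 \<le> p (xs ! (i + 1)) (xs ! i)" "p (xs ! (i + 1)) (xs ! i) \<le> 1"
      using pos[OF e(2,1)] pos[OF e(1,2)] comp[OF e(1,2)] e(3) by auto
    then show "pmf (bind_pmf (bernoulli_pmf (p (xs ! (i + 1)) (xs ! i)))
       (\<lambda>b. return_pmf (if b then swap_next i xs else xs))) ys = heat_bath p i (\<lambda>zs. indicator {zs} ys) xs"
      by (auto simp: pmf_bind heat_bath_def indicator_def)
  qed
  finally show ?thesis by (simp add: avg_update_def)
qed

lemma set_nn_step: "xs \<in> \<S> \<Longrightarrow> set_pmf (nn_step n p xs) \<subseteq> \<S>"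
  unfolding nn_step_def set_bind_pmf set_pmf_of_set[OF positions_nonempty(2,1)]
  using swap_next_perm by auto

lemma set_chain_dist: "xs \<in> \<S> \<Longrightarrow> set_pmf (chain_dist (nn_step n p) t xs) \<subseteq> \<S>"
proof (induction t)
  case (Suc t)
  then show ?case using set_nn_step by (auto simp: chain_dist_def set_bind_pmf)
qed (simp add: chain_dist_def)

text \<open>By reversibility the density with respect to the weights evolves by the same operator.\<close>

lemma pmf_chain_dist:
  assumes "xs \<in> \<S>" "ys \<in> \<S>"
  shows "pmf (chain_dist (nn_step n p) t xs) ys =
     W ys * (avg_update n p ^^ t) (\<lambda>zs. indicator {xs} zs / W xs) ys"
  using assms(2)
proof (induction t arbitrary: ys)
  case 0
  then show ?case using weight_pos[OF assms(1)] by (auto simp: chain_dist_def indicator_def)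
next
  case (Suc t)
  let ?u = "(avg_update n p ^^ t) (\<lambda>zs. indicator {xs} zs / W xs)"
  have "pmf (chain_dist (nn_step n p) (Suc t) xs) ys =
      measure_pmf.expectation (chain_dist (nn_step n p) t xs) (\<lambda>zs. pmf (nn_step n p zs) ys)"
    by (simp add: chain_dist_def pmf_bind)
  also have "\<dots> = (\<Sum>zs\<in>\<S>. pmf (nn_step n p zs) ys * pmf (chain_dist (nn_step n p) t xs) zs)"
    using set_chain_dist[OF assms(1)] by (intro integral_measure_pmf_real) auto
  also have "\<dots> = (\<Sum>zs\<in>\<S>. W zs * ?u zs * avg_update n p (\<lambda>zs. indicator {zs} ys) zs)"
    using Suc.IH by (intro sum.cong refl) (simp add: pmf_nn_step)
  also have "\<dots> = (\<Sum>zs\<in>\<S>. W zs * avg_update n p ?u zs * indicator {zs} ys)"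
    by (rule avg_update_self_adjoint)
  also have "\<dots> = (\<Sum>zs\<in>\<S>. if zs = ys then W zs * avg_update n p ?u zs else 0)"
    by (intro sum.cong refl) (auto simp: indicator_def)
  also have "\<dots> = W ys * avg_update n p ?u ys" using Suc.prems by simp
  finally show ?case by simp
qed

abbreviation "deviation t xs \<equiv> \<Sum>ys\<in>\<S>. \<bar>pmf (chain_dist (nn_step n p) t xs) ys - nn_stationary n p ys\<bar>"

text \<open>Cauchy-Schwarz bounds total variation by the chi-square distance, which is the variance
  of the density \<open>v\<close>. For the point mass at \<open>xs\<close> the initial
  \<open>wvar\<close> is at most \<open>2 * sum W \<S> / W xs\<close>.\<close>

lemma tv_bound:
  assumes poin: "\<And>g. wvar \<S> W g \<le> K * (2 * sum W \<S> * dirichlet g)"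
    and K: "1 \<le> K" and xs: "xs \<in> \<S>"
  shows "(1/2 * deviation t xs)\<^sup>2
     \<le> exp (- real t / K) * (sum W \<S> / W xs)"
proof -
  let ?Z = "sum W \<S>"
  define u where "u = (\<lambda>zs. indicator {xs} zs / W xs :: real)"
  define v where "v = (avg_update n p ^^ t) u"
  have Z: "0 < ?Z" using Z_pos[OF xs] .
  have Wx: "0 < W xs" using weight_pos[OF xs] .
  have "sum (pmf (chain_dist (nn_step n p) t xs)) \<S> = 1"
    by (rule sum_pmf_eq_1) (use set_chain_dist[OF xs] in auto)
  then have mass: "(\<Sum>ys\<in>\<S>. W ys * v ys) = 1"
    unfolding v_def u_def using pmf_chain_dist[OF xs] by simp
  have wv: "wvar \<S> W v = 2 * ?Z * (\<Sum>ys\<in>\<S>. W ys * (v ys - 1 / ?Z)\<^sup>2)"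
  proof -
    have "wvar \<S> W v = wvar \<S> W (\<lambda>ys. v ys - 1 / ?Z)" by (simp add: wvar_def)
    also have "\<dots> = 2 * ?Z * (\<Sum>ys\<in>\<S>. W ys * (v ys - 1 / ?Z)\<^sup>2) - 2 * (\<Sum>ys\<in>\<S>. W ys * (v ys - 1 / ?Z))\<^sup>2"
      by (rule wvar_eq)
    also have "(\<Sum>ys\<in>\<S>. W ys * (v ys - 1 / ?Z)) = 0"
      using mass Z by (simp add: right_diff_distrib sum_subtractf flip: sum_divide_distrib)
    finally show ?thesis by simp
  qed
  have e: "deviation t xs =
      (\<Sum>ys\<in>\<S>. W ys * 1 * \<bar>v ys - 1 / ?Z\<bar>)"
  proof (intro sum.cong refl)
    fix ys assume ys: "ys \<in> \<S>"
    have "pmf (chain_dist (nn_step n p) t xs) ys - nn_stationary n p ys = W ys * (v ys - 1 / ?Z)"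
      using pmf_chain_dist[OF xs ys] by (simp add: v_def u_def nn_stationary_def perm_weight_eq right_diff_distrib)
    then show "\<bar>pmf (chain_dist (nn_step n p) t xs) ys - nn_stationary n p ys\<bar> = W ys * 1 * \<bar>v ys - 1 / ?Z\<bar>"
      using weight_pos[OF ys] by (simp add: abs_mult)
  qed
  have bd: "(\<Sum>ys\<in>\<S>. W ys * 1 * \<bar>v ys - 1 / ?Z\<bar>)\<^sup>2 \<le> ?Z * (\<Sum>ys\<in>\<S>. W ys * (v ys - 1 / ?Z)\<^sup>2)"
    using weighted_cauchy_schwarz[of \<S> W "\<lambda>_. 1" "\<lambda>ys. \<bar>v ys - 1 / ?Z\<bar>"] weight_pos
    by (simp add: less_imp_le)
  have "(1/2 * a)\<^sup>2 \<le> 2 * z * b / 8" if "a\<^sup>2 \<le> z * b" for a z b :: real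
    using that by (simp add: power_mult_distrib power2_eq_square mult_ac)
  from this[OF bd] have "(1/2 * deviation t xs)\<^sup>2
      \<le> wvar \<S> W v / 8"
    unfolding wv e .
  \<comment> \<open>A factor 4 is given away, so that the remaining 1/2 cancels the 2 in the bound
    for \<open>wvar \<S> W u\<close>.\<close>
  also have "\<dots> \<le> wvar \<S> W v / 2"
    using wvar_nonneg[of \<S> W v] weight_pos by (simp add: less_imp_le)
  finally have A: "(1/2 * deviation t xs)\<^sup>2
      \<le> wvar \<S> W v / 2" .
  have B: "wvar \<S> W v \<le> (1 - 1 / K) ^ t * wvar \<S> W u"
    unfolding v_def by (rule wvar_iterate[OF poin K])
  have "(1 - 1 / K) ^ t \<le> exp (- 1 / K) ^ t"
    using K exp_ge_add_one_self[of "- 1 / K"] by (intro power_mono) auto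
  also have "exp (- 1 / K) ^ t = exp (- real t / K)"
    by (simp add: exp_of_nat_mult[symmetric])
  finally have C: "(1 - 1 / K) ^ t \<le> exp (- real t / K)" .
  have "(\<Sum>ys\<in>\<S>. W ys * (u ys)\<^sup>2) = (\<Sum>ys\<in>\<S>. if ys = xs then 1 / W xs else 0)"
    using Wx by (intro sum.cong refl) (auto simp: u_def indicator_def power2_eq_square)
  then have "wvar \<S> W u \<le> 2 * (?Z / W xs)" unfolding wvar_eq using xs by simp
  then have "(1 - 1 / K) ^ t * wvar \<S> W u \<le> exp (- real t / K) * (2 * (?Z / W xs))"
    using C wvar_nonneg[of \<S> W u] weight_pos by (intro mult_mono) (auto simp: less_imp_le)
  also have "\<dots> = 2 * (exp (- real t / K) * (?Z / W xs))" by simp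
  finally show ?thesis using A B by linarith
qed

end

section \<open>Extreme weights and the mixing time\<close>

lemma list_weight_le_1:
  assumes "\<And>x y. x \<in> set xs \<Longrightarrow> y \<in> set xs \<Longrightarrow> x \<noteq> y \<Longrightarrow> 0 \<le> p x y \<and> p x y \<le> 1" "distinct xs"
  shows "0 \<le> list_weight p xs \<and> list_weight p xs \<le> 1"
  using assms
proof (induction xs)
  case (Cons x xs)
  have "0 \<le> (\<Prod>y\<leftarrow>xs. p x y) \<and> (\<Prod>y\<leftarrow>xs. p x y) \<le> (\<Prod>y\<leftarrow>xs. 1)"
    using Cons.prems by (intro prod_list_mono) auto
  moreover have "(\<Prod>y\<leftarrow>xs. 1 :: real) = 1" by (induction xs) auto
  ultimately show ?case using Cons by (auto intro: mult_le_one)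
qed simp

text \<open>Each entry contributes at most \<open>n\<close> factors. For a permutation the exponent
  is \<open>n^2\<close>, whose logarithm gives the last factor \<open>n^2\<close> of the mixing
  time.\<close>

lemma list_weight_ge:
  assumes "\<And>x y. x \<in> set xs \<Longrightarrow> y \<in> set xs \<Longrightarrow> x \<noteq> y \<Longrightarrow> \<delta> \<le> p x y" "distinct xs"
    "length xs \<le> n" "0 \<le> \<delta>" "\<delta> \<le> 1"
  shows "\<delta> ^ (n * length xs) \<le> list_weight p xs"
  using assms
proof (induction xs)
  case (Cons x xs)
  have "0 \<le> (\<Prod>y\<leftarrow>xs. \<delta>) \<and> (\<Prod>y\<leftarrow>xs. \<delta>) \<le> (\<Prod>y\<leftarrow>xs. p x y)"
    using Cons.prems by (intro prod_list_mono) auto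
  moreover have "(\<Prod>y\<leftarrow>xs. \<delta>) = \<delta> ^ length xs" by (induction xs) auto
  moreover have "\<delta> ^ n \<le> \<delta> ^ length xs" using Cons.prems by (intro power_decreasing) auto
  ultimately have 1: "\<delta> ^ n \<le> (\<Prod>y\<leftarrow>xs. p x y)" by linarith
  have 2: "\<delta> ^ (n * length xs) \<le> list_weight p xs" using Cons by simp
  have "\<delta> ^ (n * length (x # xs)) = \<delta> ^ n * \<delta> ^ (n * length xs)" by (simp add: power_add)
  also have "\<dots> \<le> (\<Prod>y\<leftarrow>xs. p x y) * list_weight p xs"
    using 1 2 Cons.prems(4) by (intro mult_mono) (auto intro: order_trans[OF zero_le_power])
  finally show ?case by simp
qed simp

lemma nn_mixing_time_le:
  fixes \<delta> \<epsilon> :: real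
  assumes n: "3 \<le> n" and leaves: "leaves T = [1..<n + 1]"
    and lab: "\<forall>q \<in> internal_labels T. 1/2 \<le> q \<and> q \<le> 1" and wm: "weakly_monotone n (tree_prob T)"
    and bd: "\<forall>i j. 1 \<le> i \<and> i < j \<and> j \<le> n \<longrightarrow> tree_prob T i j \<le> 1 - \<delta>" and \<delta>: "0 < \<delta>"
    and \<epsilon>: "0 < \<epsilon>" "\<epsilon> < 1"
  shows "ereal_of_enat (nn_mixing_time n (tree_prob T) \<epsilon>)
     \<le> ereal ((16 * (3 + \<bar>ln \<delta>\<bar>) + 1) * real n ^ 9 * ln (real n / \<epsilon>))"
proof -
  define p where "p = tree_prob T"
  have comp: "p a b + p b a = 1" if "a \<noteq> b" for a b
    unfolding p_def using that by (rule tree_prob_complementary)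
  have half: "1/2 \<le> p a b" "p a b \<le> 1 - \<delta>" if "a \<in> {1..n}" "b \<in> {1..n}" "a < b" for a b
    using wm bd that by (auto simp: weakly_monotone_def p_def)
  have \<delta>2: "\<delta> \<le> 1/2" using half[of 1 2] n by simp
  have low: "\<delta> \<le> p a b" if "a \<in> {1..n}" "b \<in> {1..n}" "a \<noteq> b" for a b
    using half[of a b] half[of b a] comp[of a b] \<delta>2 that by (cases "a < b") auto
  have up: "p a b \<le> 1" if "a \<in> {1..n}" "b \<in> {1..n}" "a \<noteq> b" for a b
    using low[of b a] comp[of a b] \<delta> that by auto
  have pos: "0 < p a b" if "a \<in> {1..n}" "b \<in> {1..n}" "a \<noteq> b" for a b
    using low[OF that] \<delta> by linarith
  interpret nn_chain n p
    by unfold_locales (use n comp pos in auto)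
  have set_leaves: "set (leaves T) = {1..n}" using leaves by auto
  have sorted: "sorted_wrt (<) (leaves T)" unfolding leaves by (rule sorted_wrt_upt)
  have tb: "tree_bias p T" unfolding p_def
  proof (rule tree_bias_tree_prob[OF sorted])
    show "tree_prob T i j < 1" if "i \<in> set (leaves T)" "j \<in> set (leaves T)" "i < j" for i j
      using half(2)[of i j] that set_leaves \<delta> by (simp add: p_def)
  qed (use lab in auto)
  have wm': "weakly_monotone n p" using wm by (simp add: p_def)
  define K where "K = 16 * real n ^ 7"
  have "1 \<le> real n ^ 7" using n by (intro one_le_power) simp
  then have K: "1 \<le> K" unfolding K_def by linarith
  have Zpos: "0 \<le> sum W \<S>" using weight_pos by (intro sum_nonneg) (auto intro: less_imp_le)
  have poin: "wvar \<S> W g \<le> K * (2 * sum W \<S> * dirichlet g)" for g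
  proof -
    define D where "D = (\<Sum>l<n - 1. \<Sum>xs\<in>\<S>. W xs * p (xs ! (l + 1)) (xs ! l) * (g xs - g (swap_next l xs))\<^sup>2)"
    have nnD: "nn_energy {1..n} p g \<le> 2 * D"
    proof -
      have "nn_energy {1..n} p g \<le> (\<Sum>l<n - 1. \<Sum>xs\<in>\<S>. 2 * (W xs * p (xs ! (l + 1)) (xs ! l) * (g xs - g (swap_next l xs))\<^sup>2))"
        unfolding nn_energy_def edge_energy_def card_atLeastAtMost
      proof (simp only: diff_Suc_1 add_diff_cancel_right', intro sum_mono)
        fix l xs assume lx: "l \<in> {..<n - 1}" "xs \<in> \<S>"
        then have l: "l + 1 < n" by simp
        have "min (W xs) (W (swap_next l xs)) \<le> 2 * (W xs * p (xs ! (l + 1)) (xs ! l))"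
          using flux_ge_min[OF lx(2) l perm_entries(3)[OF lx(2) l]] by simp
        then show "min (W xs) (W (swap_next l xs)) * (jump g l xs)\<^sup>2 \<le>
            2 * (W xs * p (xs ! (l + 1)) (xs ! l) * (g xs - g (swap_next l xs))\<^sup>2)"
          using mult_right_mono[of _ _ "(jump g l xs)\<^sup>2"] by (fastforce simp: mult.assoc)
      qed
      then show ?thesis by (simp add: D_def sum_distrib_left)
    qed
    have "wvar \<S> W g \<le> 2 * (real n ^ 2 / 4) * sum W \<S> * free_energy {1..n} p g"
      using tree_poincare[OF tb sorted, of n g] pos unfolding set_leaves by (simp add: leaves)
    also have "\<dots> \<le> 2 * (real n ^ 2 / 4) * sum W \<S> * (16 * real n ^ 4 * (2 * D))"
      using Zpos free_energy_le_weakly_monotone[OF wm' comp pos, of g] nnD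
      by (intro mult_left_mono order_trans[OF free_energy_le_weakly_monotone[OF wm' comp pos]]) auto
    also have "\<dots> = 16 * real n ^ 6 * sum W \<S> * D" by (simp add: power2_eq_square power_def numeral_eq_Suc)
    \<comment> \<open>Replaces \<open>n - 1\<close> by \<open>n\<close>, so that the constant
      becomes the pure power in \<open>K\<close>.\<close>
    also have "\<dots> \<le> 16 * real n ^ 6 * sum W \<S> * (real n / real (n - 1) * D)"
    proof (intro mult_left_mono)
      have "0 \<le> D" unfolding D_def
      proof (intro sum_nonneg mult_nonneg_nonneg)
        fix l xs assume "l \<in> {..<n - 1}" and xs: "xs \<in> \<S>"
        then have "l + 1 < n" by simp
        from perm_entries[OF xs this] show "0 \<le> p (xs ! (l + 1)) (xs ! l)" by (intro less_imp_le pos) auto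
        show "0 \<le> W xs" using weight_pos[OF xs] by simp
      qed simp
      moreover have "1 \<le> real n / real (n - 1)" using n by (simp add: field_simps)
      ultimately show "D \<le> real n / real (n - 1) * D" by (metis mult_1 mult_right_mono)
    qed (use Zpos in auto)
    also have "\<dots> = K * (2 * sum W \<S> * (D / (2 * real (n - 1))))"
      by (simp add: K_def power_def numeral_eq_Suc)
    also have "D / (2 * real (n - 1)) = dirichlet g"
      unfolding dirichlet_eq D_def ..
    finally show ?thesis .
  qed
  define L where "L = ln (real n / \<epsilon>)"
  \<comment> \<open>As e is less than 3, \<open>n >= 3\<close> gives \<open>ln n >= 1\<close>; then
    all terms of the exponent can be absorbed into multiples of \<open>n^2 * L\<close>.\<close>
  have ln3: "1 \<le> ln (real n)"
  proof -
    have "exp 1 \<le> real n" using exp_le n by linarith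
    then show ?thesis using n by (subst ln_ge_iff) auto
  qed
  have L: "L = ln (real n) + ln (1 / \<epsilon>)" "0 \<le> ln (1 / \<epsilon>)"
    using n \<epsilon> by (auto simp: L_def ln_div)
  have L1: "1 \<le> L" "ln (real n) \<le> L" "ln (1 / \<epsilon>) \<le> L" using L ln3 by auto
  \<comment> \<open>In the bracket, 1 pays for \<open>n ln n\<close> (number of permutations), 2 for
    \<open>2 ln (1 / \<epsilon>)\<close>, and the last term for the least weight. The
    \<open>+ 1\<close> in the final constant pays for rounding up.\<close>
  define B where "B = real n ^ 2 * (3 + \<bar>ln \<delta>\<bar>) * L"
  define t0 where "t0 = nat \<lceil>K * B\<rceil>"
  have ratio: "sum W \<S> / W xs \<le> exp (B) * \<epsilon>\<^sup>2" if xs: "xs \<in> \<S>" for xs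
  proof -
    have "W ys \<le> 1" if "ys \<in> \<S>" for ys
      using list_weight_le_1[of ys p] perm_props[OF that] up less_imp_le[OF pos] by simp
    then have "sum W \<S> \<le> (\<Sum>xs\<in>\<S>. 1)" by (rule sum_mono)
    also have "\<dots> = fact n" by simp
    also have "\<dots> \<le> real n ^ n" using fact_le_power[of n] by (metis le_refl of_nat_fact of_nat_le_iff of_nat_power)
    finally have 1: "sum W \<S> \<le> real n ^ n" .
    have 2: "\<delta> ^ (n * n) \<le> W xs"
      using list_weight_ge[of xs \<delta> p n] low perm_props[OF xs] \<delta> \<delta>2 by auto
    have "sum W \<S> / W xs \<le> real n ^ n / \<delta> ^ (n * n)"
      using 1 2 \<delta> Zpos by (intro frac_le) auto
    also have "\<dots> = exp (real n * ln (real n) + real n ^ 2 * (- ln \<delta>))"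
      using n \<delta> by (simp add: exp_add exp_minus exp_diff power2_eq_square exp_of_nat_mult mult.assoc[symmetric]
          divide_inverse flip: of_nat_mult)
    also have "\<dots> \<le> exp (B + 2 * ln \<epsilon>)"
    proof -
      have n1: "real n \<le> real n ^ 2" "1 \<le> real n ^ 2"
        using n self_le_power[of "real n" 2] one_le_power[of "real n" 2] by linarith+
      have "real n * ln (real n) \<le> real n ^ 2 * L" using n1 L1 ln3 by (intro mult_mono) auto
      moreover have "real n ^ 2 * (- ln \<delta>) \<le> real n ^ 2 * \<bar>ln \<delta>\<bar> * L"
      proof -
        have "- ln \<delta> * 1 \<le> \<bar>ln \<delta>\<bar> * L" using L1 by (intro mult_mono) auto
        then show ?thesis using mult_left_mono[of "- ln \<delta>" "\<bar>ln \<delta>\<bar> * L" "real n ^ 2"] by (simp add: mult.assoc)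
      qed
      moreover have "2 * ln (1 / \<epsilon>) \<le> 2 * (real n ^ 2 * L)"
        using mult_mono[of 1 "real n ^ 2" "ln (1 / \<epsilon>)" L] n1 L1 L(2) by simp
      moreover have "ln (1 / \<epsilon>) = - ln \<epsilon>" using \<epsilon> by (simp add: ln_div)
      ultimately show ?thesis unfolding B_def by (simp add: algebra_simps)
    qed
    also have "\<dots> = exp B * \<epsilon>\<^sup>2" using \<epsilon> by (simp add: exp_add exp_double)
    finally show ?thesis .
  qed
  have tv: "tv_dist \<S> (nn_step n p) (nn_stationary n p) t \<le> \<epsilon>" if t: "t0 \<le> t" for t
    unfolding tv_dist_def
  proof (rule Max.boundedI)
    show "(\<lambda>xs. 1/2 * deviation t xs) ` \<S> \<noteq> {}" by simp
    fix a assume "a \<in> (\<lambda>xs. 1/2 * deviation t xs) ` \<S>"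
    then obtain xs where xs: "xs \<in> \<S>"
      and a: "a = 1/2 * deviation t xs" by blast
    have "K * B \<le> real t" using t unfolding t0_def by linarith
    then have "- real t / K \<le> - B" using K by (simp add: field_simps)
    then have "exp (- real t / K) \<le> exp (- B)" by simp
    have "a\<^sup>2 \<le> exp (- real t / K) * (sum W \<S> / W xs)"
      unfolding a by (rule tv_bound[OF poin K xs])
    also have "\<dots> \<le> exp (- B) * (exp B * \<epsilon>\<^sup>2)"
      using \<open>exp (- real t / K) \<le> exp (- B)\<close> ratio[OF xs] weight_pos[OF xs] Zpos by (intro mult_mono) auto
    also have "\<dots> = \<epsilon>\<^sup>2" by (simp add: exp_minus)
    finally show "a \<le> \<epsilon>" by (rule power2_le_imp_le) (use \<epsilon> in simp)
  qed simp
  have "nn_mixing_time n p \<epsilon> \<le> enat t0"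
    unfolding nn_mixing_time_def mixing_time_def
    by (rule Inf_lower, rule CollectI) (intro exI[of _ t0] conjI refl allI impI tv)
  then have "ereal_of_enat (nn_mixing_time n p \<epsilon>) \<le> ereal_of_enat (enat t0)"
    by (simp only: ereal_of_enat_le_iff)
  also have "\<dots> = ereal (real t0)" by simp
  also have "real t0 \<le> (16 * (3 + \<bar>ln \<delta>\<bar>) + 1) * real n ^ 9 * L"
  proof -
    have "0 \<le> K * B" using K L1 by (simp add: B_def)
    then have "real t0 \<le> K * B + 1" unfolding t0_def by linarith
    also have "K * B = 16 * (3 + \<bar>ln \<delta>\<bar>) * real n ^ 9 * L"
      by (simp add: K_def B_def power_add[of "real n" 7 2, simplified])
    also have "1 \<le> real n ^ 9 * L"
      using mult_mono[of 1 "real n ^ 9" 1 L] L1 n one_le_power[of "real n" 9] by simp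
    finally show ?thesis by (simp add: algebra_simps)
  qed
  finally show ?thesis by (simp add: p_def L_def)
qed

theorem theorem7:
  fixes \<delta> :: real
  assumes "\<delta> > 0"
  shows "\<exists>C>0. \<forall>\<^sub>F n in sequentially. \<forall>T.
           leaves T = [1..<n + 1] \<longrightarrow>
           (\<forall>q \<in> internal_labels T. 1/2 \<le> q \<and> q \<le> 1) \<longrightarrow>
           weakly_monotone n (tree_prob T) \<longrightarrow>
           (\<forall>i j. 1 \<le> i \<and> i < j \<and> j \<le> n \<longrightarrow> tree_prob T i j \<le> 1 - \<delta>) \<longrightarrow>
           (\<forall>\<epsilon>. 0 < \<epsilon> \<and> \<epsilon> < 1 \<longrightarrow>
             ereal_of_enat (nn_mixing_time n (tree_prob T) \<epsilon>)
               \<le> ereal (C * real n ^ 9 * ln (real n / \<epsilon>)))"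
  by (intro exI[of _ "16 * (3 + \<bar>ln \<delta>\<bar>) + 1"] conjI eventually_mono[OF eventually_ge_at_top[of 3]] allI impI)
     (simp, elim conjE, rule nn_mixing_time_le[OF _ _ _ _ _ assms], assumption+)

end
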